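(* Let $M$ be a connected smooth manifold, let $(\mathcal{A},[\cdot,\cdot]_{\mathcal{A}},\rho)$ be a transitive Lie algebroid over $M$ with adjoint bundle $L=\mathrm{Ker}(\rho)$, and let $\mathfrak{L}:\mathcal{A}\to \mathcal{CDO}(F)$ be a representation of $\mathcal{A}$ on a vector bundle $F\to M$. Let $F_0\subset F$ be the vector subbundle with fibres $F_{0x}=H^0(L_x,F_x)$, equipped with its reduced flat connection. Let $[\rho^*(\cdot)]:H^1_{deR}(M,F_0)\to H^1(\mathcal{A},F)$ be the map $[\theta]\mapsto[\rho^*\theta]$, where $(\rho^*\theta)(A)=\theta(\rho(A))$. Then for every $x\in M$ the localization map $\Upsilon^1_x:H^1(\mathcal{A},F)\to H^1(L_x,F_x)$ satisfies $$\mathrm{Ker}(\Upsilon_x^1)=\mathrm{Im}[\rho^*(\cdot)]\cong H^1_{deR}(M,F_0).$$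
   Context: A Lie algebroid $(\mathcal{A},[\cdot,\cdot]_{\mathcal{A}},\rho)$ over $M$ is a real vector bundle $\mathcal{A}\to M$ with a bundle map $\rho:\mathcal{A}\to TM$ (the anchor) and a real Lie bracket $[\cdot,\cdot]_{\mathcal{A}}$ on $\Gamma(\mathcal{A})$ such that $\rho:\Gamma(\mathcal{A})\to\mathcal{X}(M)$ is a Lie algebra morphism and $[A,fB]_{\mathcal{A}}=f[A,B]_{\mathcal{A}}+(\rho(A)f)B$ for $f\in C^\infty(M)$. It is transitive if $\rho$ is surjective; then $L=\mathrm{Ker}(\rho)$ is a bundle of Lie algebras, called the adjoint bundle. $\mathcal{CDO}(F)$ is the bundle of covariant differential operators of the vector bundle $F$: an element of $\mathcal{CDO}(F)_x$ is a linear operator $D_x:\Gamma(F)\to F_x$ for which there is a (unique) $X=\sigma(D_x)\in T_xM$ with $D_x(f\mu)=X(f)\mu(x)+f(x)D_x\mu$. It is a transitive Lie algebroid with anchor $\sigma$ and the commutator bracket. A representation of $\mathcal{A}$ on $F$ is a bundle map $\mathfrak{L}:\mathcal{A}\to\mathcal{CDO}(F)$, $A\mapsto \mathfrak{L}_A$, with $\sigma\circ\mathfrak{L}=\rho$ and $\mathfrak{L}_{[A,B]_{\mathcal{A}}}=\mathfrak{L}_A\circ\mathfrak{L}_B-\mathfrak{L}_B\circ\mathfrak{L}_A$ for $A,B\in\Gamma(\mathcal{A})$. $C^k(\mathcal{A},F)$ is the space of bundle maps $\wedge^k\mathcal{A}\to F$ ($C^0=\Gamma(F)$), with the usual Chevalley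 (Chevalley–Eilenberg) coboundary operator $\mathfrak{D}$ defined by $\mathfrak{L}$; $H^k(\mathcal{A},F)$ is its cohomology. In particular a 1-cocycle is a bundle map $\Omega:\mathcal{A}\to F$ with $\Omega([A,B]_{\mathcal{A}})=\mathfrak{L}_A(\Omega(B))-\mathfrak{L}_B(\Omega(A))$, and it is a coboundary if $\Omega=\mathfrak{D}\mu$, i.e. $\Omega(A)=\mathfrak{L}_A\mu$, for some $\mu\in\Gamma(F)$. For $x\in M$ the Lie algebra $L_x$ acts on $F_x$ by $\underline{\mathfrak{L}}_u(\mu)=\mathfrak{L}_u(\overline{\mu})$, where $\overline\mu$ is any local smooth extension of $\mu\in F_x$; $H^k(L_x,F_x)$ is the Lie algebra cohomology. The localization map $\Upsilon^k_x:H^k(\mathcal{A},F)\to H^k(L_x,F_x)$ is $[\Omega]\mapsto[\Omega|_{\wedge^kL_x}]$. $F_{0x}=\{\nu\in F_x \mid \underline{\mathfrak{L}}_u(\nu)=0\ \forall u\in L_x\}=H^0(L_x,F_x)$; for transitive $\mathcal{A}$ these form a vector subbundle $F_0\subset F$ preserved by $\mathfrak{L}$. The reduced flat connection of $F_0$ is the representation $\bar{\mathfrak{L}}:TM\to\mathcal{CDO}(F_0)$, $\bar{\mathfrak{L}}_X\nu=\mathfrak{L}_A\nu$ for any $A\in\mathcal{A}_x$ with $\rho(A)=X\in T_xM$ and $\nu\in\Gamma(F_0)$ (independent of the choice of $A$). $H^1_{deR}(M,F_0)$ is the first cohomology of the de Rham complex $C^\bullet(TM,F_0)$ of $F_0$-valued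 forms with the exterior differential $d$ determined by this flat connection; $D^1(TM,F_0)$ denotes the closed $F_0$-valued 1-forms. *)

theory Defs
  imports "HOL-Analysis.Analysis" "HOL-Library.Function_Algebras"
begin

text \<open>Pointwise real vector space structure on functions; tangent vectors, sections and cochains
  all live in such spaces.\<close>

instantiation "fun" :: (type, real_vector) real_vector
begin

definition scaleR_fun :: "real \<Rightarrow> ('a \<Rightarrow> 'b) \<Rightarrow> 'a \<Rightarrow> 'b"
  where "scaleR_fun r f = (\<lambda>x. r *\<^sub>R f x)"

instance
  by standard (auto simp: scaleR_fun_def fun_eq_iff algebra_simps)

end


section \<open>Smooth manifolds\<close>

primrec Ck_on :: "nat \<Rightarrow> 'e::real_normed_vector set \<Rightarrow> ('e \<Rightarrow> 'b::real_normed_vector) \<Rightarrow> bool" where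
  "Ck_on 0 W f \<longleftrightarrow> continuous_on W f"
| "Ck_on (Suc k) W f \<longleftrightarrow> (\<forall>x\<in>W. f differentiable (at x)) \<and>
     (\<forall>v. Ck_on k W (\<lambda>x. frechet_derivative f (at x) v))"

text \<open>Smoothness on an arbitrary subset of a Euclidean space: local extendability to smooth maps
  on open sets. On relatively open subsets of a linear subspace, the only sets it is used for, this
  is the ordinary notion.\<close>

definition smooth_on :: "'e::real_normed_vector set \<Rightarrow> ('e \<Rightarrow> 'b::real_normed_vector) \<Rightarrow> bool" where
  "smooth_on S f \<longleftrightarrow> (\<forall>x\<in>S. \<exists>W g. open W \<and> x \<in> W \<and> (\<forall>k. Ck_on k W g) \<and> (\<forall>y\<in>S \<inter> W. g y = f y))"

text \<open>The underlying set of the manifold is the whole type \<open>'m\<close>, whose type classes supply a second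
  countable Hausdorff topology. Charts take values in a linear subspace \<open>model M\<close> of \<open>'e\<close>, of which
  only the dimension matters; a type of class \<open>euclidean_space\<close> alone would exclude dimension
  0.\<close>

record ('m, 'e) manifold =
  model :: "'e set"
  charts :: "('m set \<times> ('m \<Rightarrow> 'e)) set"

definition smooth_manifold ::
  "('m::{t2_space, second_countable_topology}, 'e::euclidean_space) manifold \<Rightarrow> bool" where
  "smooth_manifold M \<longleftrightarrow>
     subspace (model M) \<and>
     (\<Union>(U, \<phi>)\<in>charts M. U) = UNIV \<and>
     (\<forall>(U, \<phi>)\<in>charts M. open U \<and> inj_on \<phi> U \<and>
        openin (top_of_set (model M)) (\<phi> ` U) \<and> homeomorphism U (\<phi> ` U) \<phi> (inv_into U \<phi>)) \<and>
     (\<forall>(U, \<phi>)\<in>charts M. \<forall>(W, \<psi>)\<in>charts M. smooth_on (\<phi> ` (U \<inter> W)) (\<psi> \<circ> inv_into U \<phi>))"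

definition smooth_fun_on ::
  "('m, 'e::euclidean_space) manifold \<Rightarrow> 'm set \<Rightarrow> ('m \<Rightarrow> real) \<Rightarrow> bool" where
  "smooth_fun_on M U f \<longleftrightarrow> (\<forall>(W, \<phi>)\<in>charts M. smooth_on (\<phi> ` (U \<inter> W)) (f \<circ> inv_into W \<phi>))"

definition smooth_funs :: "('m, 'e::euclidean_space) manifold \<Rightarrow> ('m \<Rightarrow> real) set" where
  "smooth_funs M = {f. smooth_fun_on M UNIV f}"


section \<open>Vector bundles\<close>

text \<open>The fibres are linear subspaces of a common real vector space without topology. The smooth
  structure is an atlas of local trivialisations, given as local frames: a pair \<open>(U, es)\<close> of an open
  set and a list of sections that form a basis of the fibre at each point of \<open>U\<close>. Lists allow
  rank 0.\<close>

record ('m, 'v) vbundle =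
  fib :: "'m \<Rightarrow> 'v set"
  frames :: "('m set \<times> ('m \<Rightarrow> 'v) list) set"

definition is_basis_list :: "'v::real_vector list \<Rightarrow> 'v set \<Rightarrow> bool" where
  "is_basis_list bs S \<longleftrightarrow> distinct bs \<and> independent (set bs) \<and> span (set bs) = S"

definition is_frame_on :: "('m \<Rightarrow> 'v::real_vector set) \<Rightarrow> 'm set \<Rightarrow> ('m \<Rightarrow> 'v) list \<Rightarrow> bool" where
  "is_frame_on E U es \<longleftrightarrow> (\<forall>x\<in>U. is_basis_list (map (\<lambda>e. e x) es) (E x))"

definition smooth_section_on ::
  "('m, 'e::euclidean_space) manifold \<Rightarrow> ('m, 'v::real_vector, 'z) vbundle_scheme \<Rightarrow> 'm set \<Rightarrow>
   ('m \<Rightarrow> 'v) \<Rightarrow> bool" where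
  "smooth_section_on M E W s \<longleftrightarrow>
     (\<forall>x\<in>W. s x \<in> fib E x) \<and>
     (\<forall>(U, es)\<in>frames E. \<exists>c. (\<forall>i<length es. smooth_fun_on M (U \<inter> W) (c i)) \<and>
        (\<forall>x\<in>U \<inter> W. s x = (\<Sum>i<length es. c i x *\<^sub>R (es ! i) x)))"

definition sections ::
  "('m, 'e::euclidean_space) manifold \<Rightarrow> ('m, 'v::real_vector, 'z) vbundle_scheme \<Rightarrow> ('m \<Rightarrow> 'v) set"
  where "sections M E = {s. smooth_section_on M E UNIV s}"

text \<open>The last condition says that transition functions are smooth.\<close>

definition vector_bundle ::
  "('m::{t2_space, second_countable_topology}, 'e::euclidean_space) manifold \<Rightarrow>
   ('m, 'v::real_vector, 'z) vbundle_scheme \<Rightarrow> bool" where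
  "vector_bundle M E \<longleftrightarrow>
     (\<forall>x. subspace (fib E x)) \<and>
     (\<Union>(U, es)\<in>frames E. U) = UNIV \<and>
     (\<forall>(U, es)\<in>frames E. open U \<and> is_frame_on (fib E) U es) \<and>
     (\<forall>(U, es)\<in>frames E. \<forall>e\<in>set es. smooth_section_on M E U e)"

text \<open>Smooth fibrewise linear maps over the identity.\<close>

definition bundle_map ::
  "('m, 'e::euclidean_space) manifold \<Rightarrow> ('m, 'v::real_vector, 'y) vbundle_scheme \<Rightarrow>
   ('m, 'w::real_vector, 'z) vbundle_scheme \<Rightarrow> ('m \<Rightarrow> 'v \<Rightarrow> 'w) \<Rightarrow> bool" where
  "bundle_map M E F \<Phi> \<longleftrightarrow>
     (\<forall>x. \<forall>u\<in>fib E x. \<Phi> x u \<in> fib F x) \<and>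
     (\<forall>x. \<forall>u\<in>fib E x. \<forall>v\<in>fib E x. \<Phi> x (u + v) = \<Phi> x u + \<Phi> x v) \<and>
     (\<forall>x. \<forall>u\<in>fib E x. \<forall>r. \<Phi> x (r *\<^sub>R u) = r *\<^sub>R \<Phi> x u) \<and>
     (\<forall>(U, es)\<in>frames E. \<forall>e\<in>set es. smooth_section_on M F U (\<lambda>x. \<Phi> x (e x)))"

text \<open>The family of fibres \<open>W x \<subseteq> fib F x\<close> with all local frames that are smooth as local sections
  of \<open>F\<close>. It is a vector bundle exactly when \<open>W\<close> is a vector subbundle of \<open>F\<close>.\<close>

definition subbundle ::
  "('m::topological_space, 'e::euclidean_space) manifold \<Rightarrow>
   ('m, 'v::real_vector, 'z) vbundle_scheme \<Rightarrow> ('m \<Rightarrow> 'v set) \<Rightarrow> ('m, 'v) vbundle" where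
  "subbundle M F W = \<lparr>fib = W,
     frames = {(U, es). open U \<and> is_frame_on W U es \<and> (\<forall>e\<in>set es. smooth_section_on M F U e)}\<rparr>"


section \<open>Lie algebroids\<close>

text \<open>Tangent vectors at \<open>x\<close> are the derivations of \<open>smooth_funs M\<close> at \<open>x\<close>, set to 0 on functions
  that are not smooth so that they are determined by their values on smooth functions.\<close>

definition tangent_space ::
  "('m, 'e::euclidean_space) manifold \<Rightarrow> 'm \<Rightarrow> (('m \<Rightarrow> real) \<Rightarrow> real) set" where
  "tangent_space M x = {D.
     (\<forall>f\<in>smooth_funs M. \<forall>g\<in>smooth_funs M. D (\<lambda>y. f y + g y) = D f + D g) \<and>
     (\<forall>f\<in>smooth_funs M. \<forall>r. D (\<lambda>y. r * f y) = r * D f) \<and>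
     (\<forall>f\<in>smooth_funs M. \<forall>g\<in>smooth_funs M. D (\<lambda>y. f y * g y) = D f * g x + f x * D g) \<and>
     (\<forall>f. f \<notin> smooth_funs M \<longrightarrow> D f = 0)}"

definition coord_field ::
  "('m, 'e::euclidean_space) manifold \<Rightarrow> 'm set \<Rightarrow> ('m \<Rightarrow> 'e) \<Rightarrow> 'e \<Rightarrow> 'm \<Rightarrow> ('m \<Rightarrow> real) \<Rightarrow> real" where
  "coord_field M U \<phi> v x f =
     (if f \<in> smooth_funs M then deriv (\<lambda>t. f (inv_into U \<phi> (\<phi> x + t *\<^sub>R v))) 0 else 0)"

record ('m, 'v) lie_algebroid = "('m, 'v) vbundle" +
  anchor :: "'m \<Rightarrow> 'v \<Rightarrow> ('m \<Rightarrow> real) \<Rightarrow> real"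
  bracket :: "('m \<Rightarrow> 'v) \<Rightarrow> ('m \<Rightarrow> 'v) \<Rightarrow> 'm \<Rightarrow> 'v"

definition tangent_algebroid ::
  "('m, 'e::euclidean_space) manifold \<Rightarrow> ('m, ('m \<Rightarrow> real) \<Rightarrow> real) lie_algebroid" where
  "tangent_algebroid M = \<lparr>fib = tangent_space M,
     frames = {(U, map (coord_field M U \<phi>) bs) | U \<phi> bs.
       (U, \<phi>) \<in> charts M \<and> is_basis_list bs (model M)},
     anchor = (\<lambda>x X. X),
     bracket = (\<lambda>X Y x f. if f \<in> smooth_funs M
       then X x (\<lambda>y. Y y f) - Y x (\<lambda>y. X y f) else 0)\<rparr>"

definition lie_algebroid ::
  "('m::{t2_space, second_countable_topology}, 'e::euclidean_space) manifold \<Rightarrow>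
   ('m, 'a::real_vector) lie_algebroid \<Rightarrow> bool" where
  "lie_algebroid M A \<longleftrightarrow>
     vector_bundle M A \<and>
     bundle_map M A (tangent_algebroid M) (anchor A) \<and>
     (\<forall>a\<in>sections M A. \<forall>b\<in>sections M A. bracket A a b \<in> sections M A) \<and>
     (\<forall>a\<in>sections M A. \<forall>b\<in>sections M A. \<forall>c\<in>sections M A. \<forall>r.
        bracket A (a + b) c = bracket A a c + bracket A b c \<and>
        bracket A c (a + b) = bracket A c a + bracket A c b \<and>
        bracket A (r *\<^sub>R a) b = r *\<^sub>R bracket A a b \<and>
        bracket A a (r *\<^sub>R b) = r *\<^sub>R bracket A a b) \<and>
     (\<forall>a\<in>sections M A. bracket A a a = 0) \<and>
     (\<forall>a\<in>sections M A. \<forall>b\<in>sections M A. \<forall>c\<in>sections M A.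
        bracket A a (bracket A b c) + bracket A b (bracket A c a) + bracket A c (bracket A a b) = 0) \<and>
     (\<forall>a\<in>sections M A. \<forall>b\<in>sections M A.
        (\<lambda>x. anchor A x (bracket A a b x)) =
        bracket (tangent_algebroid M) (\<lambda>x. anchor A x (a x)) (\<lambda>x. anchor A x (b x))) \<and>
     (\<forall>a\<in>sections M A. \<forall>b\<in>sections M A. \<forall>f\<in>smooth_funs M.
        bracket A a (\<lambda>x. f x *\<^sub>R b x) =
        (\<lambda>x. f x *\<^sub>R bracket A a b x + anchor A x (a x) f *\<^sub>R b x))"

definition transitive_algebroid ::
  "('m, 'e::euclidean_space) manifold \<Rightarrow> ('m, 'a) lie_algebroid \<Rightarrow> bool" where
  "transitive_algebroid M A \<longleftrightarrow> (\<forall>x. anchor A x ` fib A x = tangent_space M x)"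

definition adjoint_fib :: "('m, 'a) lie_algebroid \<Rightarrow> 'm \<Rightarrow> 'a set" where
  "adjoint_fib A x = {u \<in> fib A x. anchor A x u = 0}"

text \<open>For \<open>u, v\<close> in \<open>L\<^sub>x\<close> the value \<open>[a, b](x)\<close> is the same for all sections \<open>a, b\<close> through
  \<open>u, v\<close>, because \<open>\<rho>\<close> vanishes on \<open>u\<close> and \<open>v\<close>.\<close>

definition adjoint_bracket ::
  "('m, 'e::euclidean_space) manifold \<Rightarrow> ('m, 'a::real_vector) lie_algebroid \<Rightarrow> 'm \<Rightarrow>
   'a \<Rightarrow> 'a \<Rightarrow> 'a" where
  "adjoint_bracket M A x u v =
     (THE w. \<forall>a\<in>sections M A. \<forall>b\<in>sections M A. a x = u \<and> b x = v \<longrightarrow> bracket A a b x = w)"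


section \<open>Representations\<close>

text \<open>\<open>is_CDO M F x X D\<close>: \<open>D\<close> belongs to the fibre of \<open>CDO(F)\<close> at \<open>x\<close> and has symbol \<open>X\<close>. It is a
  relation because the symbol is not unique when \<open>F\<close> has rank 0.\<close>

definition is_CDO ::
  "('m, 'e::euclidean_space) manifold \<Rightarrow> ('m, 'f::real_vector, 'z) vbundle_scheme \<Rightarrow> 'm \<Rightarrow>
   (('m \<Rightarrow> real) \<Rightarrow> real) \<Rightarrow> (('m \<Rightarrow> 'f) \<Rightarrow> 'f) \<Rightarrow> bool" where
  "is_CDO M F x X D \<longleftrightarrow>
     X \<in> tangent_space M x \<and>
     (\<forall>\<mu>\<in>sections M F. D \<mu> \<in> fib F x) \<and>
     (\<forall>\<mu>\<in>sections M F. \<forall>\<nu>\<in>sections M F. D (\<mu> + \<nu>) = D \<mu> + D \<nu>) \<and>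
     (\<forall>\<mu>\<in>sections M F. \<forall>r. D (r *\<^sub>R \<mu>) = r *\<^sub>R D \<mu>) \<and>
     (\<forall>\<mu>\<in>sections M F. \<forall>f\<in>smooth_funs M.
        D (\<lambda>y. f y *\<^sub>R \<mu> y) = X f *\<^sub>R \<mu> x + f x *\<^sub>R D \<mu>)"

text \<open>A local section of \<open>CDO(F)\<close> is smooth when it maps smooth sections of \<open>F\<close> to smooth local
  sections of \<open>F\<close>. \<open>R x u\<close> is the operator \<open>\<LL>\<^sub>u\<close> for \<open>u\<close> in the fibre of \<open>A\<close> at \<open>x\<close>.\<close>

definition lie_representation ::
  "('m, 'e::euclidean_space) manifold \<Rightarrow> ('m, 'a::real_vector) lie_algebroid \<Rightarrow>
   ('m, 'f::real_vector, 'z) vbundle_scheme \<Rightarrow> ('m \<Rightarrow> 'a \<Rightarrow> ('m \<Rightarrow> 'f) \<Rightarrow> 'f) \<Rightarrow> bool" where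
  "lie_representation M A F R \<longleftrightarrow>
     (\<forall>x. \<forall>u\<in>fib A x. is_CDO M F x (anchor A x u) (R x u)) \<and>
     (\<forall>x. \<forall>u\<in>fib A x. \<forall>v\<in>fib A x. \<forall>\<mu>\<in>sections M F. R x (u + v) \<mu> = R x u \<mu> + R x v \<mu>) \<and>
     (\<forall>x. \<forall>u\<in>fib A x. \<forall>r. \<forall>\<mu>\<in>sections M F. R x (r *\<^sub>R u) \<mu> = r *\<^sub>R R x u \<mu>) \<and>
     (\<forall>(U, es)\<in>frames A. \<forall>e\<in>set es. \<forall>\<mu>\<in>sections M F. smooth_section_on M F U (\<lambda>x. R x (e x) \<mu>)) \<and>
     (\<forall>a\<in>sections M A. \<forall>b\<in>sections M A. \<forall>\<mu>\<in>sections M F. \<forall>x.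
        R x (bracket A a b x) \<mu> =
        R x (a x) (\<lambda>y. R y (b y) \<mu>) - R x (b x) (\<lambda>y. R y (a y) \<mu>))"

text \<open>The action of \<open>L\<^sub>x\<close> on \<open>F\<^sub>x\<close>; independent of the extension of \<open>\<nu>\<close> since \<open>\<LL>\<^sub>u\<close> has symbol 0.\<close>

definition adjoint_action ::
  "('m, 'e::euclidean_space) manifold \<Rightarrow> ('m, 'f::real_vector, 'z) vbundle_scheme \<Rightarrow>
   ('m \<Rightarrow> 'a \<Rightarrow> ('m \<Rightarrow> 'f) \<Rightarrow> 'f) \<Rightarrow> 'm \<Rightarrow> 'a \<Rightarrow> 'f \<Rightarrow> 'f" where
  "adjoint_action M F R x u \<nu> = (THE w. \<forall>\<mu>\<in>sections M F. \<mu> x = \<nu> \<longrightarrow> R x u \<mu> = w)"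

definition invariant_fib ::
  "('m, 'e::euclidean_space) manifold \<Rightarrow> ('m, 'a::real_vector) lie_algebroid \<Rightarrow>
   ('m, 'f::real_vector, 'z) vbundle_scheme \<Rightarrow> ('m \<Rightarrow> 'a \<Rightarrow> ('m \<Rightarrow> 'f) \<Rightarrow> 'f) \<Rightarrow> 'm \<Rightarrow> 'f set" where
  "invariant_fib M A F R x = {\<nu> \<in> fib F x. \<forall>u\<in>adjoint_fib A x. adjoint_action M F R x u \<nu> = 0}"

definition invariant_bundle ::
  "('m::topological_space, 'e::euclidean_space) manifold \<Rightarrow> ('m, 'a::real_vector) lie_algebroid \<Rightarrow>
   ('m, 'f::real_vector, 'z) vbundle_scheme \<Rightarrow> ('m \<Rightarrow> 'a \<Rightarrow> ('m \<Rightarrow> 'f) \<Rightarrow> 'f) \<Rightarrow> ('m, 'f) vbundle" where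
  "invariant_bundle M A F R = subbundle M F (invariant_fib M A F R)"

text \<open>The reduced flat connection; to be applied to sections of \<open>invariant_bundle M A F R\<close>.\<close>

definition reduced_connection ::
  "('m, 'a) lie_algebroid \<Rightarrow> ('m \<Rightarrow> 'a \<Rightarrow> ('m \<Rightarrow> 'f) \<Rightarrow> 'f) \<Rightarrow>
   'm \<Rightarrow> (('m \<Rightarrow> real) \<Rightarrow> real) \<Rightarrow> ('m \<Rightarrow> 'f) \<Rightarrow> 'f" where
  "reduced_connection A R x X \<nu> = (THE w. \<forall>u\<in>fib A x. anchor A x u = X \<longrightarrow> R x u \<nu> = w)"


section \<open>Quotients of real vector spaces\<close>

record 'v real_space =
  space_carrier :: "'v set"
  space_zero :: "'v"
  space_add :: "'v \<Rightarrow> 'v \<Rightarrow> 'v"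
  space_scale :: "real \<Rightarrow> 'v \<Rightarrow> 'v"

definition cong_mod :: "'v::real_vector set \<Rightarrow> 'v set \<Rightarrow> ('v \<times> 'v) set" where
  "cong_mod Z B = {(z, w). z \<in> Z \<and> w \<in> Z \<and> z - w \<in> B}"

definition quotient_space :: "'v::real_vector set \<Rightarrow> 'v set \<Rightarrow> 'v set real_space" where
  "quotient_space Z B = \<lparr>
     space_carrier = Z // cong_mod Z B,
     space_zero = cong_mod Z B `` {0},
     space_add = (\<lambda>c d. \<Union>z\<in>c. \<Union>w\<in>d. cong_mod Z B `` {z + w}),
     space_scale = (\<lambda>r c. \<Union>z\<in>c. cong_mod Z B `` {r *\<^sub>R z})\<rparr>"

text \<open>The map of quotients \<open>[z] \<mapsto> [h z]\<close>, where the target is the quotient of \<open>Z\<close> by \<open>B\<close>.\<close>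

definition induced_map ::
  "'w::real_vector set \<Rightarrow> 'w set \<Rightarrow> ('v \<Rightarrow> 'w) \<Rightarrow> 'v set \<Rightarrow> 'w set" where
  "induced_map Z B h c = (\<Union>z\<in>c. cong_mod Z B `` {h z})"

definition space_kernel :: "'v real_space \<Rightarrow> 'w real_space \<Rightarrow> ('v \<Rightarrow> 'w) \<Rightarrow> 'v set" where
  "space_kernel V W h = {c \<in> space_carrier V. h c = space_zero W}"

text \<open>\<open>h\<close> is a linear isomorphism of \<open>V\<close> onto the linear subspace \<open>S\<close> of \<open>W\<close>.\<close>

definition linear_iso_onto :: "'v real_space \<Rightarrow> 'w real_space \<Rightarrow> 'w set \<Rightarrow> ('v \<Rightarrow> 'w) \<Rightarrow> bool" where
  "linear_iso_onto V W S h \<longleftrightarrow>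
     S \<subseteq> space_carrier W \<and>
     bij_betw h (space_carrier V) S \<and>
     (\<forall>c\<in>space_carrier V. \<forall>d\<in>space_carrier V. h (space_add V c d) = space_add W (h c) (h d)) \<and>
     (\<forall>c\<in>space_carrier V. \<forall>r. h (space_scale V r c) = space_scale W r (h c))"


section \<open>First cohomology\<close>

text \<open>Cochains are set to 0 outside the fibres, so that equality of cochains is equality of
  bundle maps.\<close>

definition cochains1 ::
  "('m, 'e::euclidean_space) manifold \<Rightarrow> ('m, 'a::real_vector) lie_algebroid \<Rightarrow>
   ('m, 'f::real_vector, 'z) vbundle_scheme \<Rightarrow> ('m \<Rightarrow> 'a \<Rightarrow> 'f) set" where
  "cochains1 M A F = {\<Omega>. bundle_map M A F \<Omega> \<and> (\<forall>x u. u \<notin> fib A x \<longrightarrow> \<Omega> x u = 0)}"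

definition cocycles1 ::
  "('m, 'e::euclidean_space) manifold \<Rightarrow> ('m, 'a::real_vector) lie_algebroid \<Rightarrow>
   ('m, 'f::real_vector, 'z) vbundle_scheme \<Rightarrow> ('m \<Rightarrow> 'a \<Rightarrow> ('m \<Rightarrow> 'f) \<Rightarrow> 'f) \<Rightarrow>
   ('m \<Rightarrow> 'a \<Rightarrow> 'f) set" where
  "cocycles1 M A F R = {\<Omega> \<in> cochains1 M A F. \<forall>a\<in>sections M A. \<forall>b\<in>sections M A. \<forall>x.
     \<Omega> x (bracket A a b x) = R x (a x) (\<lambda>y. \<Omega> y (b y)) - R x (b x) (\<lambda>y. \<Omega> y (a y))}"

definition coboundary0 ::
  "('m, 'a) lie_algebroid \<Rightarrow> ('m \<Rightarrow> 'a \<Rightarrow> ('m \<Rightarrow> 'f::zero) \<Rightarrow> 'f) \<Rightarrow> ('m \<Rightarrow> 'f) \<Rightarrow> 'm \<Rightarrow> 'a \<Rightarrow> 'f" where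
  "coboundary0 A R \<mu> = (\<lambda>x u. if u \<in> fib A x then R x u \<mu> else 0)"

definition coboundaries1 ::
  "('m, 'e::euclidean_space) manifold \<Rightarrow> ('m, 'a::real_vector) lie_algebroid \<Rightarrow>
   ('m, 'f::real_vector, 'z) vbundle_scheme \<Rightarrow> ('m \<Rightarrow> 'a \<Rightarrow> ('m \<Rightarrow> 'f) \<Rightarrow> 'f) \<Rightarrow>
   ('m \<Rightarrow> 'a \<Rightarrow> 'f) set" where
  "coboundaries1 M A F R = coboundary0 A R ` sections M F"

definition cohomology1 ::
  "('m, 'e::euclidean_space) manifold \<Rightarrow> ('m, 'a::real_vector) lie_algebroid \<Rightarrow>
   ('m, 'f::real_vector, 'z) vbundle_scheme \<Rightarrow> ('m \<Rightarrow> 'a \<Rightarrow> ('m \<Rightarrow> 'f) \<Rightarrow> 'f) \<Rightarrow>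
   ('m \<Rightarrow> 'a \<Rightarrow> 'f) set real_space" where
  "cohomology1 M A F R = quotient_space (cocycles1 M A F R) (coboundaries1 M A F R)"

text \<open>Lie algebra cohomology of a Lie algebra \<open>\<gg>\<close> with bracket \<open>br\<close> acting on \<open>V\<close> by \<open>act\<close>.\<close>

definition lie_cocycles1 ::
  "'a::real_vector set \<Rightarrow> ('a \<Rightarrow> 'a \<Rightarrow> 'a) \<Rightarrow> 'f::real_vector set \<Rightarrow> ('a \<Rightarrow> 'f \<Rightarrow> 'f) \<Rightarrow>
   ('a \<Rightarrow> 'f) set" where
  "lie_cocycles1 \<gg> br V act = {\<omega>.
     (\<forall>u\<in>\<gg>. \<omega> u \<in> V) \<and> (\<forall>u. u \<notin> \<gg> \<longrightarrow> \<omega> u = 0) \<and>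
     (\<forall>u\<in>\<gg>. \<forall>v\<in>\<gg>. \<omega> (u + v) = \<omega> u + \<omega> v) \<and> (\<forall>u\<in>\<gg>. \<forall>r. \<omega> (r *\<^sub>R u) = r *\<^sub>R \<omega> u) \<and>
     (\<forall>u\<in>\<gg>. \<forall>v\<in>\<gg>. \<omega> (br u v) = act u (\<omega> v) - act v (\<omega> u))}"

definition lie_coboundaries1 ::
  "'a set \<Rightarrow> 'f::real_vector set \<Rightarrow> ('a \<Rightarrow> 'f \<Rightarrow> 'f) \<Rightarrow> ('a \<Rightarrow> 'f) set" where
  "lie_coboundaries1 \<gg> V act = (\<lambda>\<nu> u. if u \<in> \<gg> then act u \<nu> else 0) ` V"

definition adjoint_cocycles1 ::
  "('m, 'e::euclidean_space) manifold \<Rightarrow> ('m, 'a::real_vector) lie_algebroid \<Rightarrow>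
   ('m, 'f::real_vector, 'z) vbundle_scheme \<Rightarrow> ('m \<Rightarrow> 'a \<Rightarrow> ('m \<Rightarrow> 'f) \<Rightarrow> 'f) \<Rightarrow> 'm \<Rightarrow> ('a \<Rightarrow> 'f) set" where
  "adjoint_cocycles1 M A F R x =
     lie_cocycles1 (adjoint_fib A x) (adjoint_bracket M A x) (fib F x) (adjoint_action M F R x)"

definition adjoint_coboundaries1 ::
  "('m, 'e::euclidean_space) manifold \<Rightarrow> ('m, 'a::real_vector) lie_algebroid \<Rightarrow>
   ('m, 'f::real_vector, 'z) vbundle_scheme \<Rightarrow> ('m \<Rightarrow> 'a \<Rightarrow> ('m \<Rightarrow> 'f) \<Rightarrow> 'f) \<Rightarrow> 'm \<Rightarrow> ('a \<Rightarrow> 'f) set" where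
  "adjoint_coboundaries1 M A F R x =
     lie_coboundaries1 (adjoint_fib A x) (fib F x) (adjoint_action M F R x)"

definition adjoint_cohomology1 ::
  "('m, 'e::euclidean_space) manifold \<Rightarrow> ('m, 'a::real_vector) lie_algebroid \<Rightarrow>
   ('m, 'f::real_vector, 'z) vbundle_scheme \<Rightarrow> ('m \<Rightarrow> 'a \<Rightarrow> ('m \<Rightarrow> 'f) \<Rightarrow> 'f) \<Rightarrow> 'm \<Rightarrow>
   ('a \<Rightarrow> 'f) set real_space" where
  "adjoint_cohomology1 M A F R x =
     quotient_space (adjoint_cocycles1 M A F R x) (adjoint_coboundaries1 M A F R x)"

text \<open>The localization map \<open>\<Upsilon>\<^sup>1\<close> at \<open>x\<close>.\<close>

definition localization1 ::
  "('m, 'e::euclidean_space) manifold \<Rightarrow> ('m, 'a::real_vector) lie_algebroid \<Rightarrow>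
   ('m, 'f::real_vector, 'z) vbundle_scheme \<Rightarrow> ('m \<Rightarrow> 'a \<Rightarrow> ('m \<Rightarrow> 'f) \<Rightarrow> 'f) \<Rightarrow> 'm \<Rightarrow>
   ('m \<Rightarrow> 'a \<Rightarrow> 'f) set \<Rightarrow> ('a \<Rightarrow> 'f) set" where
  "localization1 M A F R x =
     induced_map (adjoint_cocycles1 M A F R x) (adjoint_coboundaries1 M A F R x)
       (\<lambda>\<Omega> u. if u \<in> adjoint_fib A x then \<Omega> x u else 0)"

text \<open>The de Rham complex with values in \<open>F\<^sub>0\<close> is the complex of the Lie algebroid \<open>TM\<close> acting on
  \<open>F\<^sub>0\<close> by the reduced flat connection.\<close>

definition deRham1 ::
  "('m::topological_space, 'e::euclidean_space) manifold \<Rightarrow> ('m, 'a::real_vector) lie_algebroid \<Rightarrow>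
   ('m, 'f::real_vector, 'z) vbundle_scheme \<Rightarrow> ('m \<Rightarrow> 'a \<Rightarrow> ('m \<Rightarrow> 'f) \<Rightarrow> 'f) \<Rightarrow>
   ('m \<Rightarrow> (('m \<Rightarrow> real) \<Rightarrow> real) \<Rightarrow> 'f) set real_space" where
  "deRham1 M A F R =
     cohomology1 M (tangent_algebroid M) (invariant_bundle M A F R) (reduced_connection A R)"

definition anchor_pullback ::
  "('m, 'a) lie_algebroid \<Rightarrow> ('m \<Rightarrow> (('m \<Rightarrow> real) \<Rightarrow> real) \<Rightarrow> 'f::zero) \<Rightarrow> 'm \<Rightarrow> 'a \<Rightarrow> 'f" where
  "anchor_pullback A \<theta> = (\<lambda>x u. if u \<in> fib A x then \<theta> x (anchor A x u) else 0)"

definition anchor_pullback_cohomology ::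
  "('m, 'e::euclidean_space) manifold \<Rightarrow> ('m, 'a::real_vector) lie_algebroid \<Rightarrow>
   ('m, 'f::real_vector, 'z) vbundle_scheme \<Rightarrow> ('m \<Rightarrow> 'a \<Rightarrow> ('m \<Rightarrow> 'f) \<Rightarrow> 'f) \<Rightarrow>
   ('m \<Rightarrow> (('m \<Rightarrow> real) \<Rightarrow> real) \<Rightarrow> 'f) set \<Rightarrow> ('m \<Rightarrow> 'a \<Rightarrow> 'f) set" where
  "anchor_pullback_cohomology M A F R =
     induced_map (cocycles1 M A F R) (coboundaries1 M A F R) (anchor_pullback A)"

end

theory Submission
  imports Defs
begin

text \<open>The kernel of the localization map is understood once a cocycle \<open>\<Omega>\<close> with \<open>\<Omega> u = \<LL>\<^sub>u \<nu>\<close> for all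
  \<open>u \<in> L\<^sub>x\<close> at a single point \<open>x\<close> is shown to satisfy \<open>\<Omega> u = \<LL>\<^sub>u \<mu>\<close> on all of \<open>L\<close> for some global section
  \<open>\<mu>\<close>: then \<open>\<Omega> - \<DD>\<mu>\<close> vanishes on \<open>L\<close>, hence takes values in \<open>F\<^sub>0\<close> and descends along the anchor.
  In local frames the condition on \<open>\<mu>\<close> is a linear system \<open>T \<mu> = \<omega>\<close>. The cocycle identity for a lift of
  a coordinate vector field and a section of \<open>L\<close> says that the columns of \<open>T\<close> and \<open>\<omega>\<close> satisfy a linear
  differential equation \<open>dT = C T + T G\<close>, \<open>d\<omega> = C \<omega> + T g\<close>. Gaussian elimination preserves the form of
  these equations, and a column whose equation involves no other columns vanishes identically near every
  zero. Hence the rank of \<open>T\<close> is locally constant, so that \<open>F\<^sub>0\<close> is a subbundle, and solvability is an open and closed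
  condition on the point. The local solutions form affine spaces and are glued with a partition of
  unity.\<close>

section \<open>Smooth functions on Euclidean spaces\<close>

text \<open>The obstacle is that pointwise solvability of a linear system with smooth coefficients
  yields nothing smooth: the kernel may jump and solutions may blow up. The differential equation
  excludes this. For a lift X of a coordinate field and a section l of L the bracket [X, l] lies in
  L again, so the cocycle identity expresses the derivative of \<Omega>(l) along X by values of
  \<Omega> on L, by connection coefficients of X, and by the action of l on \<Omega>(X). The last
  term is a combination of the columns of T; hence these columns satisfy a closed system, while a
  right-hand side is coupled to them until elimination has removed them. Uniqueness for linear
  equations along coordinate segments thus does the work of parallel transport. The isomorphism with
  de Rham cohomology rests on one more observation: if the pullback of a form along the anchor is
  \<DD>\<mu>, then L annihilates \<mu>, so \<mu> is already a section of F_0. Closed and exact forms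
  are therefore exactly those whose pullbacks are cocycles and coboundaries, and injectivity becomes
  linear algebra of quotients.\<close>

definition smooth_open :: "'e::real_normed_vector set \<Rightarrow> ('e \<Rightarrow> 'b::real_normed_vector) \<Rightarrow> bool" where
  "smooth_open W f \<longleftrightarrow> (\<forall>k. Ck_on k W f)"

lemma Ck_on_subset: "Ck_on k W f \<Longrightarrow> V \<subseteq> W \<Longrightarrow> Ck_on k V f"
  by (induction k arbitrary: f) (auto intro: continuous_on_subset)

lemma Ck_on_SucD: "Ck_on (Suc k) W f \<Longrightarrow> Ck_on k W f"
proof (induction k arbitrary: f)
  case 0
  then show ?case
    by (auto intro!: continuous_at_imp_continuous_on differentiable_imp_continuous_within)
next
  case (Suc k)
  then show ?case by (metis Ck_on.simps(2))
qed

text \<open>On an open \<open>W\<close> the derivative at a point of \<open>W\<close> sees only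
  values on \<open>W\<close>, and \<open>frechet_derivative\<close> is a choice among the
  derivatives, so it is the same for both functions; the next order follows by induction.\<close>

lemma Ck_on_cong:
  assumes "open W" "\<And>x. x \<in> W \<Longrightarrow> f x = g x"
  shows "Ck_on k W f \<longleftrightarrow> Ck_on k W g"
  using assms
proof (induction k arbitrary: f g)
  case 0
  then show ?case by (simp cong: continuous_on_cong)
next
  case (Suc k)
  have d: "(f has_derivative D) (at x) \<longleftrightarrow> (g has_derivative D) (at x)" if "x \<in> W" for x D
    using has_derivative_transform_within_open[OF _ Suc.prems(1) that, of f D UNIV g]
      has_derivative_transform_within_open[OF _ Suc.prems(1) that, of g D UNIV f] Suc.prems(2) by auto
  have fd: "frechet_derivative f (at x) = frechet_derivative g (at x)" if "x \<in> W" for x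
    unfolding frechet_derivative_def using d[OF that] by simp
  have "f differentiable (at x) \<longleftrightarrow> g differentiable (at x)" if "x \<in> W" for x
    unfolding differentiable_def using d[OF that] by simp
  moreover have "Ck_on k W (\<lambda>x. frechet_derivative f (at x) v) \<longleftrightarrow>
      Ck_on k W (\<lambda>x. frechet_derivative g (at x) v)" for v
    by (rule Suc.IH) (use Suc.prems fd in auto)
  ultimately show ?case by auto
qed

text \<open>Closure properties are proved with this rule: an explicit derivative \<open>D\<close>
  replaces the choice operator \<open>frechet_derivative\<close>, and the next order is checked one
  direction \<open>v\<close> at a time.\<close>

lemma Ck_on_SucI:
  assumes "open W" "\<And>x. x \<in> W \<Longrightarrow> (f has_derivative D x) (at x)"
    "\<And>v. Ck_on k W (\<lambda>x. D x v)"
  shows "Ck_on (Suc k) W f"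
proof -
  have "frechet_derivative f (at x) = D x" if "x \<in> W" for x
    using frechet_derivative_at[OF assms(2)[OF that]] by simp
  then have "Ck_on k W (\<lambda>x. frechet_derivative f (at x) v)" for v
    using Ck_on_cong[OF assms(1), of "\<lambda>x. frechet_derivative f (at x) v" "\<lambda>x. D x v" k]
      assms(3) by simp
  then show ?thesis
    using assms(2) by (auto simp: differentiable_def)
qed

lemma Ck_on_has_derivative:
  "Ck_on (Suc k) W f \<Longrightarrow> x \<in> W \<Longrightarrow> (f has_derivative frechet_derivative f (at x)) (at x)"
  by (simp add: frechet_derivative_works[symmetric])

lemma Ck_on_const: "Ck_on k W (\<lambda>x. c)"
proof (induction k arbitrary: c)
  case (Suc k)
  then show ?case
    by (simp add: frechet_derivative_const)
qed simp

lemma Ck_on_bounded_linear: "bounded_linear f \<Longrightarrow> open W \<Longrightarrow> Ck_on k W f"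
proof (induction k)
  case (Suc k)
  then show ?case
    by (intro Ck_on_SucI[where D="\<lambda>_. f"]) (auto intro: bounded_linear_imp_has_derivative Ck_on_const)
qed (simp add: linear_continuous_on)

lemma Ck_on_add: "open W \<Longrightarrow> Ck_on k W f \<Longrightarrow> Ck_on k W g \<Longrightarrow> Ck_on k W (\<lambda>x. f x + g x)"
proof (induction k arbitrary: f g)
  case (Suc k)
  show ?case
  proof (rule Ck_on_SucI)
    show "((\<lambda>x. f x + g x) has_derivative
        (\<lambda>v. frechet_derivative f (at x) v + frechet_derivative g (at x) v)) (at x)" if "x \<in> W" for x
      using Suc.prems that by (intro has_derivative_add Ck_on_has_derivative)
    show "Ck_on k W (\<lambda>x. frechet_derivative f (at x) v + frechet_derivative g (at x) v)" for v
      using Suc.prems by (intro Suc.IH) auto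
  qed (use Suc.prems in auto)
qed (auto intro: continuous_on_add)

lemma Ck_on_mult:
  fixes f g :: "'e::real_normed_vector \<Rightarrow> real"
  shows "open W \<Longrightarrow> Ck_on k W f \<Longrightarrow> Ck_on k W g \<Longrightarrow> Ck_on k W (\<lambda>x. f x * g x)"
proof (induction k arbitrary: f g)
  case (Suc k)
  note fg = Ck_on_SucD[OF Suc.prems(2)] Ck_on_SucD[OF Suc.prems(3)]
  show ?case
  proof (rule Ck_on_SucI)
    show "((\<lambda>x. f x * g x) has_derivative
        (\<lambda>v. f x * frechet_derivative g (at x) v + frechet_derivative f (at x) v * g x)) (at x)"
      if "x \<in> W" for x
      using Suc.prems that by (intro has_derivative_mult Ck_on_has_derivative)
    show "Ck_on k W (\<lambda>x. f x * frechet_derivative g (at x) v + frechet_derivative f (at x) v * g x)" for v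
      using Suc.prems by (intro Ck_on_add[OF Suc.prems(1) Suc.IH[OF Suc.prems(1) fg(1)]
            Suc.IH[OF Suc.prems(1) _ fg(2)]]) auto
  qed (use Suc.prems in auto)
qed (auto intro: continuous_on_mult)

lemma Ck_on_sum:
  assumes "open W" "\<And>i. i \<in> I \<Longrightarrow> Ck_on k W (f i)"
  shows "Ck_on k W (\<lambda>x. \<Sum>i\<in>I. f i x)"
  using assms
  by (induction I rule: infinite_finite_induct) (auto intro: Ck_on_const Ck_on_add)

text \<open>In the chain rule the derivative of \<open>g\<close> is applied to a vector that moves
  with \<open>x\<close>. Expanding this vector in \<open>Basis\<close> leaves derivatives of
  \<open>g\<close> in fixed directions, to which the induction hypothesis for scalar functions
  applies.\<close>

lemma Ck_on_compose:
  fixes f :: "'a::real_normed_vector \<Rightarrow> 'b::euclidean_space" and g :: "'b \<Rightarrow> real"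
  assumes "open W" "open V"
  shows "\<lbrakk>Ck_on k W f; Ck_on k V g; f ` W \<subseteq> V\<rbrakk> \<Longrightarrow> Ck_on k W (\<lambda>x. g (f x))"
proof (induction k arbitrary: g)
  case 0
  then show ?case by (auto intro: continuous_on_compose2)
next
  case (Suc k)
  let ?D = "\<lambda>x v. \<Sum>b\<in>Basis. (frechet_derivative f (at x) v \<bullet> b) * frechet_derivative g (at (f x)) b"
  have inner_Ck: "Ck_on k W (\<lambda>x. h x \<bullet> b)" if "Ck_on k W h" for h :: "'a \<Rightarrow> 'b" and b k
    using that
  proof (induction k arbitrary: h)
    case 0
    then show ?case by (auto intro: continuous_intros)
  next
    case (Suc k)
    show ?case
    proof (rule Ck_on_SucI[OF assms(1)])
      show "((\<lambda>x. h x \<bullet> b) has_derivative (\<lambda>v. frechet_derivative h (at x) v \<bullet> b)) (at x)"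
        if "x \<in> W" for x
        using Suc.prems that by (intro has_derivative_inner_left Ck_on_has_derivative)
      show "Ck_on k W (\<lambda>x. frechet_derivative h (at x) v \<bullet> b)" for v
        using Suc.prems by (intro Suc.IH) auto
    qed
  qed
  show ?case
  proof (rule Ck_on_SucI[OF assms(1)])
    fix x assume x: "x \<in> W"
    have g: "(g has_derivative frechet_derivative g (at (f x))) (at (f x))"
      using Suc.prems x by (intro Ck_on_has_derivative) auto
    have "((\<lambda>x. g (f x)) has_derivative
        (\<lambda>v. frechet_derivative g (at (f x)) (frechet_derivative f (at x) v))) (at x)"
      using has_derivative_compose[OF Ck_on_has_derivative[OF Suc.prems(1) x] g] .
    moreover have "frechet_derivative g (at (f x)) w =
        (\<Sum>b\<in>Basis. (w \<bullet> b) * frechet_derivative g (at (f x)) b)" for w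
    proof -
      have l: "linear (frechet_derivative g (at (f x)))"
        using g has_derivative_linear by blast
      have "frechet_derivative g (at (f x)) w =
          frechet_derivative g (at (f x)) (\<Sum>b\<in>Basis. (w \<bullet> b) *\<^sub>R b)"
        by (simp add: euclidean_representation)
      also have "\<dots> = (\<Sum>b\<in>Basis. (w \<bullet> b) * frechet_derivative g (at (f x)) b)"
        by (simp add: linear_sum[OF l] linear_scale[OF l])
      finally show ?thesis .
    qed
    then have "(\<lambda>v. frechet_derivative g (at (f x)) (frechet_derivative f (at x) v)) = ?D x"
      by (intro ext)
    ultimately show "((\<lambda>x. g (f x)) has_derivative ?D x) (at x)"
      by simp
  next
    fix v
    have 1: "Ck_on k W (\<lambda>x. frechet_derivative g (at (f x)) b)" for b
      using Suc.prems Ck_on_SucD[OF Suc.prems(1)] by (intro Suc.IH) auto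
    have 2: "Ck_on k W (\<lambda>x. frechet_derivative f (at x) v)"
      using Suc.prems by simp
    show "Ck_on k W (\<lambda>x. ?D x v)"
      by (rule Ck_on_sum[OF assms(1)], rule Ck_on_mult[OF assms(1) inner_Ck[OF 2] 1])
  qed
qed

lemma Ck_on_inverse:
  fixes f :: "'e::real_normed_vector \<Rightarrow> real"
  assumes "open W" "\<And>x. x \<in> W \<Longrightarrow> f x \<noteq> 0"
  shows "Ck_on k W f \<Longrightarrow> Ck_on k W (\<lambda>x. inverse (f x))"
proof (induction k)
  case 0
  then show ?case using assms by (auto intro: continuous_intros)
next
  case (Suc k)
  show ?case
  proof (rule Ck_on_SucI[OF assms(1)])
    show "((\<lambda>x. inverse (f x)) has_derivative
        (\<lambda>v. - 1 * (inverse (f x) * frechet_derivative f (at x) v * inverse (f x)))) (at x)"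
      if "x \<in> W" for x
      using Deriv.has_derivative_inverse[OF assms(2)[OF that] Ck_on_has_derivative[OF Suc.prems that]]
      by simp
    show "Ck_on k W (\<lambda>x. - 1 * (inverse (f x) * frechet_derivative f (at x) v * inverse (f x)))" for v
      using Suc.prems assms(1) Suc.IH[OF Ck_on_SucD[OF Suc.prems]]
      by (intro Ck_on_mult Ck_on_const) auto
  qed
qed

lemma smooth_open_subset: "smooth_open W f \<Longrightarrow> V \<subseteq> W \<Longrightarrow> smooth_open V f"
  by (auto simp: smooth_open_def intro: Ck_on_subset)

lemma smooth_open_const: "smooth_open W (\<lambda>x. c)"
  by (simp add: smooth_open_def Ck_on_const)

lemma smooth_open_bounded_linear: "bounded_linear f \<Longrightarrow> open W \<Longrightarrow> smooth_open W f"
  by (simp add: smooth_open_def Ck_on_bounded_linear)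

lemma smooth_open_add:
  "open W \<Longrightarrow> smooth_open W f \<Longrightarrow> smooth_open W g \<Longrightarrow> smooth_open W (\<lambda>x. f x + g x)"
  by (simp add: smooth_open_def Ck_on_add)

lemma smooth_open_mult:
  fixes f g :: "'e::real_normed_vector \<Rightarrow> real"
  shows "open W \<Longrightarrow> smooth_open W f \<Longrightarrow> smooth_open W g \<Longrightarrow> smooth_open W (\<lambda>x. f x * g x)"
  by (simp add: smooth_open_def Ck_on_mult)

lemma smooth_open_inverse:
  fixes f :: "'e::real_normed_vector \<Rightarrow> real"
  shows "open W \<Longrightarrow> smooth_open W f \<Longrightarrow> (\<And>x. x \<in> W \<Longrightarrow> f x \<noteq> 0) \<Longrightarrow> smooth_open W (\<lambda>x. inverse (f x))"
  by (simp add: smooth_open_def Ck_on_inverse)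

lemma smooth_open_compose:
  fixes f :: "'a::real_normed_vector \<Rightarrow> 'b::euclidean_space" and g :: "'b \<Rightarrow> real"
  shows "open W \<Longrightarrow> open V \<Longrightarrow> smooth_open W f \<Longrightarrow> smooth_open V g \<Longrightarrow> f ` W \<subseteq> V \<Longrightarrow>
    smooth_open W (\<lambda>x. g (f x))"
  by (simp add: smooth_open_def Ck_on_compose)

lemma smooth_open_continuous: "smooth_open W f \<Longrightarrow> continuous_on W f"
  unfolding smooth_open_def by (metis Ck_on.simps(1))

lemma smooth_open_has_derivative:
  "smooth_open W f \<Longrightarrow> x \<in> W \<Longrightarrow> (f has_derivative frechet_derivative f (at x)) (at x)"
  unfolding smooth_open_def using Ck_on_has_derivative by blast

subsection \<open>Bump functions\<close>

text \<open>The functions \<open>p(1/t) exp(-1/t)\<close> with \<open>p\<close> a polynomial are closed under differentiation.\<close>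

definition flat_fun :: "real poly \<Rightarrow> real \<Rightarrow> real" where
  "flat_fun p t = (if t > 0 then poly p (1/t) * exp (-(1/t)) else 0)"

lemma poly_times_exp_neg_tendsto_0:
  "((\<lambda>x::real. poly p x * exp (- x)) \<longlongrightarrow> 0) at_top"
proof -
  have "((\<lambda>x. \<Sum>i\<le>degree p. coeff p i * (x ^ i / exp x)) \<longlongrightarrow> (\<Sum>i\<le>degree p. coeff p i * 0)) at_top"
    by (intro tendsto_sum tendsto_mult tendsto_const tendsto_power_div_exp_0)
  then show ?thesis
    by (simp add: poly_altdef exp_minus sum_distrib_right divide_inverse mult.assoc)
qed

text \<open>With s = 1/t the derivative of p(s) exp(-s) with respect to t is s^2 (p(s) - p'(s))
  exp(-s), and the factor s^2 is \<open>[:0,0,1:]\<close>. At t = 0 the right difference quotient is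
  s p(s) exp(-s), which tends to 0 as s tends to infinity.\<close>

lemma flat_fun_has_derivative:
  "(flat_fun p has_real_derivative flat_fun ([:0,0,1:] * (p - pderiv p)) t) (at t)"
proof -
  consider "t > 0" | "t < 0" | "t = 0" by linarith
  then show ?thesis
  proof cases
    case 1
    have "((\<lambda>t. poly p (1/t) * exp (-(1/t))) has_real_derivative
        flat_fun ([:0,0,1:] * (p - pderiv p)) t) (at t)"
      using 1 unfolding flat_fun_def
      by (auto intro!: derivative_eq_intros poly_DERIV[THEN DERIV_chain2]
          simp: field_simps power2_eq_square)
    then show ?thesis
      by (rule has_field_derivative_transform_within_open[where S="{0<..}"])
        (use 1 in \<open>auto simp: flat_fun_def\<close>)
  next
    case 2
    have "((\<lambda>t. 0) has_real_derivative flat_fun ([:0,0,1:] * (p - pderiv p)) t) (at t)"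
      using 2 by (simp add: flat_fun_def)
    then show ?thesis
      by (rule has_field_derivative_transform_within_open[where S="{..<0}"])
        (use 2 in \<open>auto simp: flat_fun_def\<close>)
  next
    case 3
    have r: "((\<lambda>h. flat_fun p h / h) \<longlongrightarrow> 0) (at_right 0)"
    proof -
      have "((\<lambda>h. poly ([:0,1:] * p) (inverse h) * exp (- inverse h)) \<longlongrightarrow> 0) (at_right (0::real))"
        by (rule filterlim_compose[OF poly_times_exp_neg_tendsto_0 filterlim_inverse_at_top_right])
      moreover have "eventually (\<lambda>h. poly ([:0,1:] * p) (inverse h) * exp (- inverse h) = flat_fun p h / h)
          (at_right 0)"
        unfolding eventually_at_right_field
        by (intro exI[of _ 1]) (auto simp: flat_fun_def field_simps)
      ultimately show ?thesis by (rule Lim_transform_eventually)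
    qed
    have l: "((\<lambda>h. flat_fun p h / h) \<longlongrightarrow> 0) (at_left 0)"
      by (rule tendsto_eventually) (auto simp: eventually_at_left_field flat_fun_def intro!: exI[of _ "-1"])
    have "((\<lambda>h. flat_fun p h / h) \<longlongrightarrow> 0) (at 0)"
      using l r by (simp add: filterlim_split_at)
    then show ?thesis
      using 3 by (simp add: DERIV_def flat_fun_def)
  qed
qed

lemma smooth_open_flat_fun: "smooth_open UNIV (flat_fun p)"
proof -
  have "Ck_on k UNIV (flat_fun p)" for k
  proof (induction k arbitrary: p)
    case 0
    then show ?case
      using flat_fun_has_derivative DERIV_isCont by (fastforce intro!: continuous_at_imp_continuous_on)
  next
    case (Suc k)
    show ?case
    proof (rule Ck_on_SucI)
      show "(flat_fun p has_derivative (\<lambda>v. flat_fun ([:0,0,1:] * (p - pderiv p)) t * v)) (at t)" for t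
        using flat_fun_has_derivative by (simp add: has_field_derivative_def)
      show "Ck_on k UNIV (\<lambda>t. flat_fun ([:0,0,1:] * (p - pderiv p)) t * v)" for v
        by (intro Ck_on_mult Suc.IH Ck_on_const) auto
    qed auto
  qed
  then show ?thesis by (simp add: smooth_open_def)
qed

text \<open>The usual quotient of flat functions, taken in the squared distance \<open>s\<close>,
  which unlike the distance is smooth at \<open>a\<close>. The two arguments of \<open>h\<close> add
  up to 3 r^2 > 0, so one of them is positive and the denominator never vanishes.\<close>

lemma smooth_bump_euclidean:
  fixes a :: "'e::euclidean_space"
  assumes "r > 0"
  obtains \<beta> :: "'e \<Rightarrow> real" where "smooth_open UNIV \<beta>"
    "\<And>z. dist z a < r \<Longrightarrow> \<beta> z = 1" "\<And>z. dist z a \<ge> 2 * r \<Longrightarrow> \<beta> z = 0"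
proof -
  define s where "s z = (z - a) \<bullet> (z - a)" for z
  define h where "h = flat_fun 1"
  have h: "smooth_open UNIV h" and hpos: "t > 0 \<Longrightarrow> h t > 0" and h0: "t \<le> 0 \<Longrightarrow> h t = 0" for t
    by (auto simp: h_def smooth_open_flat_fun) (auto simp: flat_fun_def)
  define \<beta> where "\<beta> z = h (4 * r\<^sup>2 - s z) * inverse (h (4 * r\<^sup>2 - s z) + h (s z - r\<^sup>2))" for z
  have s: "smooth_open UNIV s"
  proof -
    have c: "smooth_open UNIV (\<lambda>z::'e. (z - a) \<bullet> b)" for b
    proof -
      have "smooth_open UNIV (\<lambda>z::'e. z \<bullet> b + - (a \<bullet> b))"
        by (intro smooth_open_add smooth_open_const smooth_open_bounded_linear bounded_linear_inner_left) auto
      then show ?thesis by (simp add: inner_diff_left)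
    qed
    have "smooth_open UNIV (\<lambda>z::'e. \<Sum>b\<in>Basis. ((z - a) \<bullet> b) * ((z - a) \<bullet> b))"
      unfolding smooth_open_def
      using smooth_open_mult[OF open_UNIV c c] by (intro allI Ck_on_sum) (auto simp: smooth_open_def)
    then show ?thesis
      by (simp add: s_def[abs_def] euclidean_inner[of "_ - a" "_ - a"])
  qed
  have s1: "smooth_open UNIV (\<lambda>z. 4 * r\<^sup>2 - s z)"
  proof -
    have "smooth_open UNIV (\<lambda>z. 4 * r\<^sup>2 + (-1) * s z)"
      by (intro smooth_open_add smooth_open_const smooth_open_mult s) auto
    then show ?thesis by simp
  qed
  have s2: "smooth_open UNIV (\<lambda>z. s z - r\<^sup>2)"
  proof -
    have "smooth_open UNIV (\<lambda>z. s z + - r\<^sup>2)"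
      by (intro smooth_open_add smooth_open_const s) auto
    then show ?thesis by simp
  qed
  have hnn: "h t \<ge> 0" for t using hpos[of t] h0[of t] by (cases "t > 0") auto
  have r2: "r\<^sup>2 > 0" using assms by simp
  have nz: "h (4 * r\<^sup>2 - s z) + h (s z - r\<^sup>2) \<noteq> 0" for z
  proof (cases "s z < 4 * r\<^sup>2")
    case True
    then show ?thesis using hpos[of "4 * r\<^sup>2 - s z"] hnn[of "s z - r\<^sup>2"] by simp
  next
    case False
    then have "s z - r\<^sup>2 > 0" using r2 by linarith
    then show ?thesis using hpos[of "s z - r\<^sup>2"] hnn[of "4 * r\<^sup>2 - s z"] by simp
  qed
  have "smooth_open UNIV \<beta>"
    unfolding \<beta>_def[abs_def]
    by (intro smooth_open_mult smooth_open_inverse smooth_open_add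
        smooth_open_compose[OF _ _ s1 h] smooth_open_compose[OF _ _ s2 h] nz) auto
  moreover have sd: "s z = (dist z a)\<^sup>2" for z
    by (simp add: s_def dist_norm power2_norm_eq_inner)
  have "\<beta> z = 1" if "dist z a < r" for z
  proof -
    have "(dist z a)\<^sup>2 \<le> r\<^sup>2" using that by (intro power_mono) auto
    then have "h (s z - r\<^sup>2) = 0" by (intro h0) (simp add: sd)
    then show ?thesis using nz[of z] by (simp add: \<beta>_def)
  qed
  moreover have "\<beta> z = 0" if "dist z a \<ge> 2 * r" for z
  proof -
    have "(2 * r)\<^sup>2 \<le> (dist z a)\<^sup>2" using that assms by (intro power_mono) auto
    then have "h (4 * r\<^sup>2 - s z) = 0" by (intro h0) (simp add: sd power_mult_distrib)
    then show ?thesis by (simp add: \<beta>_def)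
  qed
  ultimately show ?thesis using that by blast
qed

section \<open>Smooth functions on manifolds\<close>

text \<open>Smoothness near a point in terms of germs; on an open set it amounts to
  \<open>smooth_fun_on\<close>, by \<open>smooth_fun_on_iff\<close>. The extension \<open>g\<close>
  lives on an ambient open set because chart images are only relatively open in
  \<open>model M\<close>.\<close>

definition smooth_at :: "('m, 'e::euclidean_space) manifold \<Rightarrow> ('m \<Rightarrow> real) \<Rightarrow> 'm \<Rightarrow> bool" where
  "smooth_at M f y \<longleftrightarrow> (\<forall>(W, \<phi>)\<in>charts M. y \<in> W \<longrightarrow>
     (\<exists>U g. open U \<and> \<phi> y \<in> U \<and> smooth_open U g \<and> (\<forall>z\<in>U \<inter> \<phi> ` W. g z = f (inv_into W \<phi> z))))"

text \<open>The formula inside \<open>coord_field\<close> without the test for membership in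
  \<open>smooth_funs\<close>, so that it also applies to functions that are smooth only near the
  point, such as frame coefficients.\<close>

definition dird :: "'m set \<Rightarrow> ('m \<Rightarrow> 'e) \<Rightarrow> 'e::real_vector \<Rightarrow> ('m \<Rightarrow> real) \<Rightarrow> 'm \<Rightarrow> real" where
  "dird W \<phi> v f y = deriv (\<lambda>t. f (inv_into W \<phi> (\<phi> y + t *\<^sub>R v))) 0"

locale smooth_mfd =
  fixes M :: "('m::{t2_space, second_countable_topology}, 'e::euclidean_space) manifold"
  assumes smooth_manifold: "smooth_manifold M"
begin

lemma model_subspace: "subspace (model M)"
  using smooth_manifold by (simp add: smooth_manifold_def)

lemma chart_exists: obtains W \<phi> where "(W, \<phi>) \<in> charts M" "y \<in> W"
proof -
  have "(\<Union>(W, \<phi>)\<in>charts M. W) = UNIV"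
    using smooth_manifold by (simp add: smooth_manifold_def)
  then have "y \<in> (\<Union>(W, \<phi>)\<in>charts M. W)"
    by simp
  then show ?thesis using that by blast
qed

context
  fixes W \<phi>
  assumes chart: "(W, \<phi>) \<in> charts M"
begin

lemma chart_facts: "open W" "inj_on \<phi> W" "openin (top_of_set (model M)) (\<phi> ` W)"
    "homeomorphism W (\<phi> ` W) \<phi> (inv_into W \<phi>)"
proof -
  have "\<forall>(U, \<phi>)\<in>charts M. open U \<and> inj_on \<phi> U \<and>
        openin (top_of_set (model M)) (\<phi> ` U) \<and> homeomorphism U (\<phi> ` U) \<phi> (inv_into U \<phi>)"
    using smooth_manifold unfolding smooth_manifold_def by blast
  then show "open W" "inj_on \<phi> W" "openin (top_of_set (model M)) (\<phi> ` W)"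
    "homeomorphism W (\<phi> ` W) \<phi> (inv_into W \<phi>)"
    using chart by blast+
qed

lemma chart_inv [simp]: "y \<in> W \<Longrightarrow> inv_into W \<phi> (\<phi> y) = y"
  using chart_facts by simp

lemma chart_model: "y \<in> W \<Longrightarrow> \<phi> y \<in> model M"
  using chart_facts(3) openin_imp_subset by fastforce

lemma chart_continuous: "continuous_on W \<phi>" "continuous_on (\<phi> ` W) (inv_into W \<phi>)"
  using chart_facts(4) by (auto simp: homeomorphism_def)

lemma chart_image_open:
  assumes "open V"
  obtains U where "open U" "\<phi> ` (V \<inter> W) = model M \<inter> U"
proof -
  have "openin (top_of_set W) (V \<inter> W)"
    using assms by (metis Int_commute openin_open_Int)
  then have "openin (top_of_set (\<phi> ` W)) (\<phi> ` (V \<inter> W))"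
    using homeomorphism_imp_open_map[OF chart_facts(4)] by blast
  then have "openin (top_of_set (model M)) (\<phi> ` (V \<inter> W))"
    using chart_facts(3) openin_trans by blast
  then show ?thesis using that by (auto simp: openin_open)
qed

lemma chart_vimage_open: "open U \<Longrightarrow> open (W \<inter> \<phi> -` U)"
  using chart_continuous(1) chart_facts(1) continuous_on_open_vimage[of W \<phi>] by (simp add: Int_commute)

end

text \<open>One chart suffices because transition maps are smooth: in a second chart
  \<open>\<psi>\<close> the composite of \<open>g\<close> with a local extension
  \<open>\<tau>\<close> of the transition map serves as the extension.\<close>

lemma smooth_atI:
  assumes chart: "(W, \<phi>) \<in> charts M"
    and y: "y \<in> W" and U: "open U" "\<phi> y \<in> U" "smooth_open U g"
    and g: "\<And>z. z \<in> U \<Longrightarrow> z \<in> \<phi> ` W \<Longrightarrow> g z = f (inv_into W \<phi> z)"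
  shows "smooth_at M f y"
  unfolding smooth_at_def
proof (clarify)
  fix W' \<psi> assume c': "(W', \<psi>) \<in> charts M" and y': "y \<in> W'"
  have "\<forall>(U, \<phi>)\<in>charts M. \<forall>(W, \<psi>)\<in>charts M. smooth_on (\<phi> ` (U \<inter> W)) (\<psi> \<circ> inv_into U \<phi>)"
    using smooth_manifold unfolding smooth_manifold_def by blast
  then have "smooth_on (\<psi> ` (W' \<inter> W)) (\<phi> \<circ> inv_into W' \<psi>)"
    using chart c' by blast
  moreover have "\<psi> y \<in> \<psi> ` (W' \<inter> W)" using y y' by blast
  ultimately obtain U1 \<tau> where U1: "open U1" "\<psi> y \<in> U1" "smooth_open U1 \<tau>"
    and \<tau>: "\<forall>z\<in>\<psi> ` (W' \<inter> W) \<inter> U1. \<tau> z = (\<phi> \<circ> inv_into W' \<psi>) z"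
    unfolding smooth_on_def smooth_open_def by blast
  note inv' = chart_inv[OF c']
  obtain U2 where U2: "open U2" "\<psi> ` (W \<inter> W') = model M \<inter> U2"
    using chart_image_open[OF c' chart_facts(1)[OF chart]] .
  have m': "z \<in> model M" if "z \<in> \<psi> ` W'" for z
    using that chart_model[OF c'] by blast
  \<comment> \<open>\<open>U1\<close> carries \<open>\<tau>\<close>; \<open>U2\<close> forces points
    of the image of \<open>W'\<close> to come from \<open>W \<inter> W'\<close>, where
    \<open>\<tau>\<close> is the true transition map; the preimage of \<open>U\<close> puts
    \<open>\<tau> z\<close> where \<open>g\<close> is smooth.\<close>
  define U3 where "U3 = (U1 \<inter> U2) \<inter> \<tau> -` U"
  have "continuous_on (U1 \<inter> U2) \<tau>"
    using smooth_open_continuous[OF U1(3)] continuous_on_subset by blast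
  then have o3: "open U3"
    unfolding U3_def using U1(1) U2(1) U(1) by (intro continuous_open_preimage) auto
  have "\<psi> y \<in> U2" using U2(2) y y' by blast
  moreover have "\<tau> (\<psi> y) = \<phi> y" using \<tau> U1(2) y y' inv' by force
  ultimately have y3: "\<psi> y \<in> U3" using U1(2) U(2) by (simp add: U3_def)
  have s3: "smooth_open U3 (\<lambda>z. g (\<tau> z))"
    by (rule smooth_open_compose[OF o3 U(1) smooth_open_subset[OF U1(3)] U(3)]) (auto simp: U3_def)
  have "g (\<tau> z) = f (inv_into W' \<psi> z)" if z: "z \<in> U3" "z \<in> \<psi> ` W'" for z
  proof -
    have "z \<in> \<psi> ` (W \<inter> W')" using z m' U2(2) by (auto simp: U3_def)
    then obtain p where p: "p \<in> W" "p \<in> W'" "z = \<psi> p" by blast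
    then have t: "\<tau> z = \<phi> p" using \<tau> z inv' by (auto simp: U3_def)
    have "g (\<tau> z) = f (inv_into W \<phi> (\<phi> p))"
      unfolding t using z(1) p(1) by (intro g) (auto simp: U3_def t)
    then show ?thesis using p inv' chart_inv[OF chart] by simp
  qed
  then show "\<exists>U g. open U \<and> \<psi> y \<in> U \<and> smooth_open U g \<and> (\<forall>z\<in>U \<inter> \<psi> ` W'. g z = f (inv_into W' \<psi> z))"
    using o3 y3 s3 by blast
qed

lemma smooth_atE:
  assumes chart: "(W, \<phi>) \<in> charts M" and "smooth_at M f y" "y \<in> W"
  obtains U g where "open U" "\<phi> y \<in> U" "smooth_open U g"
    "\<And>z. z \<in> U \<Longrightarrow> z \<in> \<phi> ` W \<Longrightarrow> g z = f (inv_into W \<phi> z)"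
proof -
  have "\<exists>U g. open U \<and> \<phi> y \<in> U \<and> smooth_open U g \<and> (\<forall>z\<in>U \<inter> \<phi> ` W. g z = f (inv_into W \<phi> z))"
    using bspec[OF assms(2)[unfolded smooth_at_def] chart] assms(3) by simp
  then obtain U g where *: "open U" "\<phi> y \<in> U" "smooth_open U g"
    "\<forall>z\<in>U \<inter> \<phi> ` W. g z = f (inv_into W \<phi> z)"
    by (elim exE conjE)
  show ?thesis
    by (rule that[OF *(1-3)]) (use *(4) in auto)
qed

lemma smooth_fun_on_iff:
  assumes "open U"
  shows "smooth_fun_on M U f \<longleftrightarrow> (\<forall>y\<in>U. smooth_at M f y)"
proof
  assume L: "smooth_fun_on M U f"
  show "\<forall>y\<in>U. smooth_at M f y"
  proof
    fix y assume y: "y \<in> U"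
    obtain W \<phi> where c: "(W, \<phi>) \<in> charts M" "y \<in> W" by (rule chart_exists)
    have "smooth_on (\<phi> ` (U \<inter> W)) (f \<circ> inv_into W \<phi>)"
      using L c unfolding smooth_fun_on_def by blast
    moreover have "\<phi> y \<in> \<phi> ` (U \<inter> W)" using y c by blast
    ultimately obtain O1 g where O1: "open O1" "\<phi> y \<in> O1" "smooth_open O1 g"
      "\<forall>z\<in>\<phi> ` (U \<inter> W) \<inter> O1. g z = (f \<circ> inv_into W \<phi>) z"
      unfolding smooth_on_def smooth_open_def by blast
    obtain O2 where O2: "open O2" "\<phi> ` (U \<inter> W) = model M \<inter> O2"
      using chart_image_open[OF c(1) assms] .
    show "smooth_at M f y"
    proof (rule smooth_atI[OF c])
      show "open (O1 \<inter> O2)" using O1 O2 by blast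
      show "\<phi> y \<in> O1 \<inter> O2" using O1 O2 \<open>\<phi> y \<in> \<phi> ` (U \<inter> W)\<close> by blast
      show "smooth_open (O1 \<inter> O2) g" using O1(3) smooth_open_subset by blast
      show "g z = f (inv_into W \<phi> z)" if "z \<in> O1 \<inter> O2" "z \<in> \<phi> ` W" for z
      proof -
        have "z \<in> model M" using that(2) chart_model[OF c(1)] by blast
        then have "z \<in> \<phi> ` (U \<inter> W)" using O2 that by blast
        then show ?thesis using O1 that by simp
      qed
    qed
  qed
next
  assume R: "\<forall>y\<in>U. smooth_at M f y"
  show "smooth_fun_on M U f"
    unfolding smooth_fun_on_def
  proof clarify
    fix W \<phi> assume c: "(W, \<phi>) \<in> charts M"
    show "smooth_on (\<phi> ` (U \<inter> W)) (f \<circ> inv_into W \<phi>)"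
      unfolding smooth_on_def
    proof
      fix z assume "z \<in> \<phi> ` (U \<inter> W)"
      then obtain y where y: "y \<in> U" "y \<in> W" "z = \<phi> y" by blast
      obtain V g where "open V" "\<phi> y \<in> V" "smooth_open V g"
        "\<And>z. z \<in> V \<Longrightarrow> z \<in> \<phi> ` W \<Longrightarrow> g z = f (inv_into W \<phi> z)"
        using smooth_atE[OF c _ y(2)] R y(1) by blast
      then show "\<exists>Wa g. open Wa \<and> z \<in> Wa \<and> (\<forall>k. Ck_on k Wa g) \<and>
          (\<forall>y\<in>\<phi> ` (U \<inter> W) \<inter> Wa. g y = (f \<circ> inv_into W \<phi>) y)"
        unfolding smooth_open_def y(3) by (intro exI[of _ V] exI[of _ g]) auto
    qed
  qed
qed

lemma smooth_funs_iff: "f \<in> smooth_funs M \<longleftrightarrow> (\<forall>y. smooth_at M f y)"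
  by (simp add: smooth_funs_def smooth_fun_on_iff)

lemma smooth_at_cong:
  assumes "smooth_at M f y" "open N" "y \<in> N" "\<And>z. z \<in> N \<Longrightarrow> f z = g z"
  shows "smooth_at M g y"
proof -
  obtain W \<phi> where c: "(W, \<phi>) \<in> charts M" "y \<in> W" by (rule chart_exists)
  obtain U h where U: "open U" "\<phi> y \<in> U" "smooth_open U h"
    "\<And>z. z \<in> U \<Longrightarrow> z \<in> \<phi> ` W \<Longrightarrow> h z = f (inv_into W \<phi> z)"
    using smooth_atE[OF c(1) assms(1) c(2)] by metis
  obtain O2 where O2: "open O2" "\<phi> ` (N \<inter> W) = model M \<inter> O2"
    using chart_image_open[OF c(1) assms(2)] .
  show ?thesis
  proof (rule smooth_atI[OF c])
    show "open (U \<inter> O2)" using U O2 by blast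
    show "\<phi> y \<in> U \<inter> O2" using U O2 assms(3) c(2) by blast
    show "smooth_open (U \<inter> O2) h" using U(3) smooth_open_subset by blast
    show "h z = g (inv_into W \<phi> z)" if z: "z \<in> U \<inter> O2" "z \<in> \<phi> ` W" for z
    proof -
      have "z \<in> model M" using z(2) chart_model[OF c(1)] by blast
      then have "z \<in> \<phi> ` (N \<inter> W)" using O2 z by blast
      then have "inv_into W \<phi> z \<in> N" using chart_inv[OF c(1)] by force
      then show ?thesis using U(4) z assms(4) by auto
    qed
  qed
qed

lemma smooth_at_const [simp]: "smooth_at M (\<lambda>x. r) y"
proof -
  obtain W \<phi> where c: "(W, \<phi>) \<in> charts M" "y \<in> W" by (rule chart_exists)
  show ?thesis by (rule smooth_atI[OF c open_UNIV UNIV_I smooth_open_const[of _ r]]) simp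
qed

lemma smooth_at_binop:
  assumes "smooth_at M f y" "smooth_at M g y"
    and op: "\<And>(U :: 'e set) f g. open U \<Longrightarrow> smooth_open U f \<Longrightarrow> smooth_open U g \<Longrightarrow>
      smooth_open U (\<lambda>x. opr (f x) (g x))"
  shows "smooth_at M (\<lambda>x. opr (f x) (g x)) y"
proof -
  obtain W \<phi> where c: "(W, \<phi>) \<in> charts M" "y \<in> W" by (rule chart_exists)
  obtain U h where U: "open U" "\<phi> y \<in> U" "smooth_open U h"
    "\<And>z. z \<in> U \<Longrightarrow> z \<in> \<phi> ` W \<Longrightarrow> h z = f (inv_into W \<phi> z)"
    using smooth_atE[OF c(1) assms(1) c(2)] by metis
  obtain V k where V: "open V" "\<phi> y \<in> V" "smooth_open V k"
    "\<And>z. z \<in> V \<Longrightarrow> z \<in> \<phi> ` W \<Longrightarrow> k z = g (inv_into W \<phi> z)"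
    using smooth_atE[OF c(1) assms(2) c(2)] by metis
  show ?thesis
  proof (rule smooth_atI[OF c])
    show "open (U \<inter> V)" "\<phi> y \<in> U \<inter> V" using U V by auto
    show "smooth_open (U \<inter> V) (\<lambda>z. opr (h z) (k z))"
      using U(1) V(1) by (intro op smooth_open_subset[OF U(3)] smooth_open_subset[OF V(3)]) auto
    show "opr (h z) (k z) = opr (f (inv_into W \<phi> z)) (g (inv_into W \<phi> z))"
      if "z \<in> U \<inter> V" "z \<in> \<phi> ` W" for z
      using that U(4) V(4) by simp
  qed
qed

lemma smooth_at_add: "smooth_at M f y \<Longrightarrow> smooth_at M g y \<Longrightarrow> smooth_at M (\<lambda>x. f x + g x) y"
  by (rule smooth_at_binop[where opr="(+)"]) (auto intro: smooth_open_add)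

lemma smooth_at_mult: "smooth_at M f y \<Longrightarrow> smooth_at M g y \<Longrightarrow> smooth_at M (\<lambda>x. f x * g x) y"
  by (rule smooth_at_binop[where opr="(*)"]) (auto intro: smooth_open_mult)

lemma smooth_at_minus: "smooth_at M f y \<Longrightarrow> smooth_at M (\<lambda>x. - f x) y"
  using smooth_at_mult[OF smooth_at_const[of "-1"]] by simp

lemma smooth_at_diff: "smooth_at M f y \<Longrightarrow> smooth_at M g y \<Longrightarrow> smooth_at M (\<lambda>x. f x - g x) y"
  using smooth_at_add[OF _ smooth_at_minus, of f y g] by simp

lemma smooth_at_sum: "(\<And>i. i \<in> I \<Longrightarrow> smooth_at M (f i) y) \<Longrightarrow> smooth_at M (\<lambda>x. \<Sum>i\<in>I. f i x) y"
  by (induction I rule: infinite_finite_induct) (auto intro: smooth_at_add)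

lemma smooth_at_open:
  assumes "smooth_at M f y"
  obtains N where "open N" "y \<in> N" "\<And>z. z \<in> N \<Longrightarrow> smooth_at M f z" "continuous_on N f"
proof -
  obtain W \<phi> where c: "(W, \<phi>) \<in> charts M" "y \<in> W" by (rule chart_exists)
  obtain U h where U: "open U" "\<phi> y \<in> U" "smooth_open U h"
    "\<And>z. z \<in> U \<Longrightarrow> z \<in> \<phi> ` W \<Longrightarrow> h z = f (inv_into W \<phi> z)"
    using smooth_atE[OF c(1) assms(1) c(2)] by metis
  show ?thesis
  proof (rule that)
    show "open (W \<inter> \<phi> -` U)" by (rule chart_vimage_open[OF c(1) U(1)])
    show "y \<in> W \<inter> \<phi> -` U" using c U by blast
    show "smooth_at M f z" if "z \<in> W \<inter> \<phi> -` U" for z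
      using that U by (intro smooth_atI[OF c(1), of z U h]) auto
    have "continuous_on (W \<inter> \<phi> -` U) (\<lambda>z. h (\<phi> z))"
      by (rule continuous_on_compose2[OF smooth_open_continuous[OF U(3)]
            continuous_on_subset[OF chart_continuous(1)[OF c(1)]]]) auto
    moreover have "h (\<phi> z) = f z" if "z \<in> W \<inter> \<phi> -` U" for z
      using that U(4) chart_inv[OF c(1)] by auto
    ultimately show "continuous_on (W \<inter> \<phi> -` U) f"
      by (rule continuous_on_eq)
  qed
qed

lemma smooth_at_isCont: "smooth_at M f y \<Longrightarrow> isCont f y"
  by (metis smooth_at_open continuous_on_eq_continuous_at)

lemma smooth_at_continuous_on: "(\<And>y. y \<in> N \<Longrightarrow> smooth_at M f y) \<Longrightarrow> continuous_on N f"
  using smooth_at_isCont by (blast intro: continuous_at_imp_continuous_on)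

lemma smooth_at_inverse:
  assumes "smooth_at M f y" "f y \<noteq> 0"
  shows "smooth_at M (\<lambda>x. inverse (f x)) y"
proof -
  obtain W \<phi> where c: "(W, \<phi>) \<in> charts M" "y \<in> W" by (rule chart_exists)
  obtain U h where U: "open U" "\<phi> y \<in> U" "smooth_open U h"
    "\<And>z. z \<in> U \<Longrightarrow> z \<in> \<phi> ` W \<Longrightarrow> h z = f (inv_into W \<phi> z)"
    using smooth_atE[OF c(1) assms(1) c(2)] by metis
  define V where "V = U \<inter> h -` (- {0})"
  have "open V"
    unfolding V_def using smooth_open_continuous[OF U(3)] U(1)
    by (intro continuous_open_preimage) auto
  then have "smooth_open V (\<lambda>z. inverse (h z))"
    using smooth_open_subset[OF U(3)] by (intro smooth_open_inverse) (auto simp: V_def)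
  then show ?thesis
  proof (rule smooth_atI[OF c \<open>open V\<close>, rotated])
    show "\<phi> y \<in> V" using U(2,4) c(2) assms(2) chart_inv[OF c] by (simp add: V_def)
  qed (use U in \<open>auto simp: V_def\<close>)
qed

lemma smooth_at_divide:
  "smooth_at M f y \<Longrightarrow> smooth_at M g y \<Longrightarrow> g y \<noteq> 0 \<Longrightarrow> smooth_at M (\<lambda>x. f x / g x) y"
  using smooth_at_mult[OF _ smooth_at_inverse, of f y g] by (simp add: divide_inverse)

lemma smooth_funs_closed:
  assumes "f \<in> smooth_funs M" "g \<in> smooth_funs M"
  shows "(\<lambda>y. f y + g y) \<in> smooth_funs M" "(\<lambda>y. f y * g y) \<in> smooth_funs M" "(\<lambda>y. r * f y) \<in> smooth_funs M"
    "(\<lambda>y. f y - g y) \<in> smooth_funs M" "(\<lambda>y. r) \<in> smooth_funs M"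
  using assms unfolding smooth_funs_iff
  by (auto intro: smooth_at_add smooth_at_mult smooth_at_diff)

text \<open>The Euclidean bump lives in a closed ball whose trace on \<open>model M\<close> is
  compact; the image \<open>K\<close> of this trace is compact, hence closed in the Hausdorff space,
  and so extension by 0 is smooth. \<open>K\<close> appears in the conclusion because later cut-offs
  use its open complement in the same way.\<close>

lemma bump:
  assumes U: "open U" "y \<in> U"
  obtains \<beta> V K where "\<beta> \<in> smooth_funs M" "open V" "y \<in> V" "V \<subseteq> K" "closed K" "K \<subseteq> U"
    "\<And>z. z \<in> V \<Longrightarrow> \<beta> z = 1" "\<And>z. z \<notin> K \<Longrightarrow> \<beta> z = 0"
proof -
  obtain W \<phi> where c: "(W, \<phi>) \<in> charts M" "y \<in> W" by (rule chart_exists)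
  obtain U' where U': "open U'" "\<phi> ` (U \<inter> W) = model M \<inter> U'"
    using chart_image_open[OF c(1) U(1)] .
  have "\<phi> y \<in> U'" using U'(2) c U(2) by blast
  then obtain r' where r': "r' > 0" "cball (\<phi> y) r' \<subseteq> U'"
    using U'(1) open_contains_cball by blast
  define r where "r = r' / 2"
  have r: "r > 0" "cball (\<phi> y) (2 * r) \<subseteq> U'" using r' by (auto simp: r_def)
  obtain b :: "'e \<Rightarrow> real" where b: "smooth_open UNIV b"
    "\<And>z. dist z (\<phi> y) < r \<Longrightarrow> b z = 1" "\<And>z. dist z (\<phi> y) \<ge> 2 * r \<Longrightarrow> b z = 0"
    using smooth_bump_euclidean[OF r(1)] by blast
  let ?B = "model M \<inter> cball (\<phi> y) (2 * r)"
  define K where "K = inv_into W \<phi> ` ?B"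
  define V where "V = W \<inter> \<phi> -` ball (\<phi> y) r"
  define \<beta> where "\<beta> z = (if z \<in> W then b (\<phi> z) else 0)" for z
  have B: "?B \<subseteq> \<phi> ` (U \<inter> W)" using U'(2) r(2) by blast
  have "compact ?B" using closed_subspace[OF model_subspace] by (simp add: closed_Int_compact)
  moreover have "continuous_on ?B (inv_into W \<phi>)"
    by (rule continuous_on_subset[OF chart_continuous(2)[OF c(1)]]) (use B in auto)
  ultimately have "closed K" unfolding K_def by (intro compact_imp_closed compact_continuous_image)
  have KU: "K \<subseteq> U \<inter> W" using B chart_inv[OF c(1)] by (force simp: K_def)
  have inK: "z \<in> K" if "z \<in> W" "dist (\<phi> z) (\<phi> y) \<le> 2 * r" for z
  proof -
    have "\<phi> z \<in> ?B" using that chart_model[OF c(1)] by (simp add: dist_commute)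
    then show ?thesis unfolding K_def using chart_inv[OF c(1) that(1)] by (metis imageI)
  qed
  have zero: "\<beta> z = 0" if "z \<notin> K" for z
    using inK that b(3) by (force simp: \<beta>_def)
  have "smooth_at M \<beta> z" for z
  proof (cases "z \<in> W")
    case True
    then show ?thesis
      by (intro smooth_atI[OF c(1) True open_UNIV UNIV_I b(1)])
        (auto simp: \<beta>_def inv_into_into f_inv_into_f)
  next
    case False
    then have "z \<in> - K" using KU by blast
    then show ?thesis
      using smooth_at_cong[OF smooth_at_const[of 0], of "- K" z \<beta>] \<open>closed K\<close> zero by auto
  qed
  then have "\<beta> \<in> smooth_funs M" by (simp add: smooth_funs_iff)
  moreover have "open V" unfolding V_def by (rule chart_vimage_open[OF c(1)]) simp
  moreover have "y \<in> V" using c r by (simp add: V_def)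
  moreover have "V \<subseteq> K" using inK r by (auto simp: V_def dist_commute)
  moreover have "\<And>z. z \<in> V \<Longrightarrow> \<beta> z = 1" using b(2) by (auto simp: V_def \<beta>_def dist_commute)
  ultimately show ?thesis using that \<open>closed K\<close> KU zero by blast
qed

text \<open>Tangent vectors and Leibniz rules accept only members of \<open>smooth_funs M\<close>;
  this turns a locally smooth function into one of them without changing its germ at
  \<open>y\<close>.\<close>

lemma globalize_fun:
  assumes "open U" "y \<in> U" "\<And>z. z \<in> U \<Longrightarrow> smooth_at M f z"
  obtains g N where "g \<in> smooth_funs M" "open N" "y \<in> N" "N \<subseteq> U" "\<And>z. z \<in> N \<Longrightarrow> g z = f z"
proof -
  obtain \<beta> V K where b: "\<beta> \<in> smooth_funs M" "open V" "y \<in> V" "V \<subseteq> K" "closed K" "K \<subseteq> U"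
    "\<And>z. z \<in> V \<Longrightarrow> \<beta> z = 1" "\<And>z. z \<notin> K \<Longrightarrow> \<beta> z = 0"
    using bump[OF assms(1,2)] by metis
  have "smooth_at M (\<lambda>z. \<beta> z * f z) z" for z
  proof (cases "z \<in> K")
    case True
    then show ?thesis using b assms(3) by (intro smooth_at_mult) (auto simp: smooth_funs_iff)
  next
    case False
    then show ?thesis
      using smooth_at_cong[OF smooth_at_const[of 0], of "- K" z "\<lambda>z. \<beta> z * f z"] b(5,8) by auto
  qed
  then have "(\<lambda>z. \<beta> z * f z) \<in> smooth_funs M" by (simp add: smooth_funs_iff)
  then show ?thesis
    by (rule that[of _ V]) (use b in auto)
qed

subsection \<open>Directional derivatives in a chart\<close>

context
  fixes W \<phi>
  assumes chart: "(W, \<phi>) \<in> charts M"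
begin

text \<open>\<open>L\<close> is the derivative of an ambient extension. It is linear on the whole
  type, but only its values on \<open>model M\<close> belong to \<open>f\<close>, since only in
  these directions does the line stay in the chart image for small \<open>t\<close>.\<close>

lemma line_derivative:
  assumes "smooth_at M f y" "y \<in> W"
  obtains L where "linear L"
    "\<And>v. v \<in> model M \<Longrightarrow>
      ((\<lambda>t. f (inv_into W \<phi> (\<phi> y + t *\<^sub>R v))) has_real_derivative L v) (at 0)"
proof -
  obtain U g where U: "open U" "\<phi> y \<in> U" "smooth_open U g"
    "\<And>z. z \<in> U \<Longrightarrow> z \<in> \<phi> ` W \<Longrightarrow> g z = f (inv_into W \<phi> z)"
    using smooth_atE[OF chart assms] by metis
  obtain O2 where O2: "open O2" "\<phi> ` (UNIV \<inter> W) = model M \<inter> O2"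
    using chart_image_open[OF chart open_UNIV] .
  let ?L = "frechet_derivative g (at (\<phi> y))"
  have d: "(g has_derivative ?L) (at (\<phi> y))"
    by (rule smooth_open_has_derivative[OF U(3,2)])
  show ?thesis
  proof (rule that)
    show "linear ?L" using d has_derivative_linear by blast
    fix v assume v: "v \<in> model M"
    let ?S = "(\<lambda>t. \<phi> y + t *\<^sub>R v) -` (U \<inter> O2)"
    have "((\<lambda>t. \<phi> y + t *\<^sub>R v) has_derivative (\<lambda>t. t *\<^sub>R v)) (at 0)"
      by (auto intro!: derivative_eq_intros)
    then have "((\<lambda>t. g (\<phi> y + t *\<^sub>R v)) has_derivative (\<lambda>t. ?L (t *\<^sub>R v))) (at 0)"
      using has_derivative_compose[of "\<lambda>t. \<phi> y + t *\<^sub>R v" "\<lambda>t. t *\<^sub>R v" 0 UNIV g ?L] d by simp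
    then have "((\<lambda>t. g (\<phi> y + t *\<^sub>R v)) has_real_derivative ?L v) (at 0)"
      by (simp add: has_field_derivative_def linear_scale[OF \<open>linear ?L\<close>] mult.commute[of "?L v", abs_def])
    then show "((\<lambda>t. f (inv_into W \<phi> (\<phi> y + t *\<^sub>R v))) has_real_derivative ?L v) (at 0)"
    proof (rule has_field_derivative_transform_within_open)
      show "open ?S"
        using U(1) O2(1) by (intro continuous_open_vimage continuous_intros) auto
      show "0 \<in> ?S" using U(2) O2(2) assms(2) by auto
      fix t assume t: "t \<in> ?S"
      have "\<phi> y + t *\<^sub>R v \<in> model M"
        using v chart_model[OF chart assms(2)] model_subspace by (simp add: subspace_add subspace_scale)
      then have "\<phi> y + t *\<^sub>R v \<in> \<phi> ` W" using O2(2) t by auto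
      then show "g (\<phi> y + t *\<^sub>R v) = f (inv_into W \<phi> (\<phi> y + t *\<^sub>R v))"
        using U(4) t by simp
    qed
  qed
qed

lemma dird_works:
  assumes "smooth_at M f y" "y \<in> W" "v \<in> model M"
  shows "((\<lambda>t. f (inv_into W \<phi> (\<phi> y + t *\<^sub>R v))) has_real_derivative dird W \<phi> v f y) (at 0)"
  using line_derivative[OF assms(1,2)] assms(3) unfolding dird_def by (metis DERIV_imp_deriv)

lemma dird_eqI:
  "((\<lambda>t. f (inv_into W \<phi> (\<phi> y + t *\<^sub>R v))) has_real_derivative d) (at 0) \<Longrightarrow> dird W \<phi> v f y = d"
  unfolding dird_def by (rule DERIV_imp_deriv)

lemma dird_linear:
  assumes "smooth_at M f y" "y \<in> W"
  obtains L where "linear L" "\<And>v. v \<in> model M \<Longrightarrow> dird W \<phi> v f y = L v"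
  using line_derivative[OF assms] dird_eqI by metis

lemma dird_cong:
  assumes "smooth_at M f y" "y \<in> W" "v \<in> model M" "open N" "y \<in> N" "\<And>z. z \<in> N \<Longrightarrow> f z = g z"
  shows "dird W \<phi> v f y = dird W \<phi> v g y"
proof -
  obtain O2 where O2: "open O2" "\<phi> ` (N \<inter> W) = model M \<inter> O2"
    using chart_image_open[OF chart assms(4)] .
  let ?S = "(\<lambda>t. \<phi> y + t *\<^sub>R v) -` O2"
  have "((\<lambda>t. g (inv_into W \<phi> (\<phi> y + t *\<^sub>R v))) has_real_derivative dird W \<phi> v f y) (at 0)"
  proof (rule has_field_derivative_transform_within_open[OF dird_works[OF assms(1-3)]])
    show "open ?S" using O2(1) by (intro continuous_open_vimage continuous_intros) auto
    show "0 \<in> ?S" using O2(2) assms(2,5) by auto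
    fix t assume t: "t \<in> ?S"
    have "\<phi> y + t *\<^sub>R v \<in> model M"
      using assms(2,3) chart_model[OF chart] model_subspace by (simp add: subspace_add subspace_scale)
    then have "\<phi> y + t *\<^sub>R v \<in> \<phi> ` (N \<inter> W)" using O2(2) t by auto
    then have "inv_into W \<phi> (\<phi> y + t *\<^sub>R v) \<in> N" using chart_inv[OF chart] by force
    then show "f (inv_into W \<phi> (\<phi> y + t *\<^sub>R v)) = g (inv_into W \<phi> (\<phi> y + t *\<^sub>R v))"
      by (rule assms(6))
  qed
  then show ?thesis by (simp add: dird_eqI)
qed

text \<open>Re-centres the derivative from parameter 0 to parameter \<open>t\<close>, the form in
  which \<open>linear_system_zero\<close> integrates along a segment.\<close>

lemma dird_along_line:
  assumes p: "p \<in> W" "\<phi> p = a + t *\<^sub>R v" and "smooth_at M f p" "v \<in> model M"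
  shows "((\<lambda>s. f (inv_into W \<phi> (a + s *\<^sub>R v))) has_real_derivative dird W \<phi> v f p) (at t)"
proof -
  have "((\<lambda>s. f (inv_into W \<phi> (\<phi> p + s *\<^sub>R v))) has_real_derivative dird W \<phi> v f p) (at (t + - t))"
    using dird_works[OF assms(3) p(1) assms(4)] by simp
  then have "((\<lambda>s. f (inv_into W \<phi> (\<phi> p + (s + - t) *\<^sub>R v))) has_real_derivative dird W \<phi> v f p) (at t)"
    by (subst (asm) DERIV_shift)
  then show ?thesis by (simp add: p(2) algebra_simps)
qed

context
  fixes f g :: "'m \<Rightarrow> real" and y :: 'm and v :: 'e
  assumes fg: "smooth_at M f y" "smooth_at M g y" and y: "y \<in> W" and v: "v \<in> model M"
begin

lemma dird_add: "dird W \<phi> v (\<lambda>x. f x + g x) y = dird W \<phi> v f y + dird W \<phi> v g y"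
  by (rule dird_eqI) (intro DERIV_add dird_works fg y v)

lemma dird_diff: "dird W \<phi> v (\<lambda>x. f x - g x) y = dird W \<phi> v f y - dird W \<phi> v g y"
  by (rule dird_eqI) (intro DERIV_diff dird_works fg y v)

lemma dird_mult: "dird W \<phi> v (\<lambda>x. f x * g x) y = dird W \<phi> v f y * g y + f y * dird W \<phi> v g y"
  using DERIV_mult[OF dird_works[OF fg(1) y v] dird_works[OF fg(2) y v]]
  by (intro dird_eqI) (simp add: chart_inv[OF chart y] algebra_simps)

lemma dird_divide:
  "g y \<noteq> 0 \<Longrightarrow> dird W \<phi> v (\<lambda>x. f x / g x) y = (dird W \<phi> v f y * g y - f y * dird W \<phi> v g y) / (g y * g y)"
  using DERIV_divide[OF dird_works[OF fg(1) y v] dird_works[OF fg(2) y v]]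
  by (intro dird_eqI) (simp add: chart_inv[OF chart y])

end

lemma dird_const: "dird W \<phi> v (\<lambda>x. r) y = 0"
  by (rule dird_eqI) simp

end

end

section \<open>Vector bundles\<close>

subsection \<open>Finite bases as indexed families\<close>

text \<open>Families indexed below \<open>n\<close> fit frames, whose members are functions of the
  point. The independence clause concerns the family and not its set of values, so it already
  excludes repetitions.\<close>

definition basis_fam :: "nat \<Rightarrow> (nat \<Rightarrow> 'v::real_vector) \<Rightarrow> 'v set \<Rightarrow> bool" where
  "basis_fam n e S \<longleftrightarrow> (\<forall>i<n. e i \<in> S) \<and> (\<forall>v\<in>S. \<exists>c. v = (\<Sum>i<n. c i *\<^sub>R e i)) \<and>
     (\<forall>c. (\<Sum>i<n. c i *\<^sub>R e i) = 0 \<longrightarrow> (\<forall>i<n. c i = 0))"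

text \<open>The choice is determined only for vectors in the span and indices below \<open>n\<close>
  of a basis; elsewhere the values are arbitrary.\<close>

definition bcoef :: "nat \<Rightarrow> (nat \<Rightarrow> 'v::real_vector) \<Rightarrow> 'v \<Rightarrow> nat \<Rightarrow> real" where
  "bcoef n e v = (SOME c. v = (\<Sum>i<n. c i *\<^sub>R e i))"

lemma bcoef_sum:
  assumes "basis_fam n e S" "v \<in> S"
  shows "(\<Sum>i<n. bcoef n e v i *\<^sub>R e i) = v"
proof -
  have "\<exists>c. v = (\<Sum>i<n. c i *\<^sub>R e i)" using assms by (simp add: basis_fam_def)
  from someI_ex[OF this] show ?thesis unfolding bcoef_def by simp
qed

lemma basis_fam_unique:
  assumes "basis_fam n e S" "(\<Sum>i<n. c i *\<^sub>R e i) = (\<Sum>i<n. d i *\<^sub>R e i)" "i < n"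
  shows "c i = d i"
proof -
  have "(\<Sum>i<n. (c i - d i) *\<^sub>R e i) = 0"
    using assms(2) by (simp add: scaleR_left_diff_distrib sum_subtractf)
  then have "c i - d i = 0"
    using assms(1)[unfolded basis_fam_def, THEN conjunct2, THEN conjunct2, rule_format, of "\<lambda>i. c i - d i"]
      assms(3) by simp
  then show ?thesis by simp
qed

lemma basis_fam_sum_in: "basis_fam n e S \<Longrightarrow> subspace S \<Longrightarrow> (\<Sum>i<n. c i *\<^sub>R e i) \<in> S"
  by (auto simp: basis_fam_def intro!: subspace_sum subspace_scale)

lemma bcoef_eq: "basis_fam n e S \<Longrightarrow> subspace S \<Longrightarrow> i < n \<Longrightarrow> bcoef n e (\<Sum>i<n. c i *\<^sub>R e i) i = c i"
  by (rule basis_fam_unique[OF _ bcoef_sum]) (auto intro: basis_fam_sum_in)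

lemma basis_list_imp_fam:
  assumes "is_basis_list bs S"
  shows "basis_fam (length bs) ((!) bs) S"
proof -
  have bs: "distinct bs" "independent (set bs)" "span (set bs) = S"
    using assms by (auto simp: is_basis_list_def)
  have sum_eq: "(\<Sum>i<length bs. g (bs ! i)) = (\<Sum>b\<in>set bs. g b)" for g :: "'a \<Rightarrow> 'a"
    using sum.reindex_bij_betw[OF bij_betw_nth[OF bs(1) refl refl]] by simp
  show ?thesis
    unfolding basis_fam_def
  proof (intro conjI allI ballI impI)
    show "bs ! i \<in> S" if "i < length bs" for i
      using that bs(3) span_base[of "bs ! i" "set bs"] by auto
    show "\<exists>c. v = (\<Sum>i<length bs. c i *\<^sub>R bs ! i)" if "v \<in> S" for v
    proof -
      have "v \<in> span (set bs)" using that bs by simp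
      then obtain u where u: "v = (\<Sum>b\<in>set bs. u b *\<^sub>R b)"
        by (auto simp: span_finite)
      show ?thesis
        by (rule exI[of _ "\<lambda>i. u (bs ! i)"]) (use u sum_eq[of "\<lambda>b. u b *\<^sub>R b"] in simp)
    qed
    fix c i assume c: "(\<Sum>i<length bs. c i *\<^sub>R bs ! i) = 0" and i: "i < length bs"
    define u where "u b = c (THE j. j < length bs \<and> bs ! j = b)" for b
    have u: "u (bs ! j) = c j" if "j < length bs" for j
    proof -
      have "(THE k. k < length bs \<and> bs ! k = bs ! j) = j"
        using that bs(1) by (intro the_equality) (auto simp: nth_eq_iff_index_eq)
      then show ?thesis by (simp add: u_def)
    qed
    have "(\<Sum>i<length bs. u (bs ! i) *\<^sub>R bs ! i) = 0" using c u by simp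
    then have "(\<Sum>b\<in>set bs. u b *\<^sub>R b) = 0" using sum_eq[of "\<lambda>b. u b *\<^sub>R b"] by simp
    then have "\<forall>b\<in>set bs. u b = 0" using bs(2) dependent_finite[of "set bs"] by blast
    then show "c i = 0" using u[OF i] i by auto
  qed
qed

lemma basis_fam_imp_list:
  assumes "basis_fam n e S" "subspace S"
  shows "is_basis_list (map e [0..<n]) S"
proof -
  have inj: "inj_on e {..<n}"
  proof (rule inj_onI, rule ccontr)
    fix i j assume ij: "i \<in> {..<n}" "j \<in> {..<n}" "e i = e j" "i \<noteq> j"
    have "(\<Sum>k<n. (if k = i then 1 else 0) *\<^sub>R e k) = (\<Sum>k<n. (if k = j then 1 else 0) *\<^sub>R e k)"
      using ij by (simp add: if_distrib[of "\<lambda>r. r *\<^sub>R _"] cong: if_cong)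
    from basis_fam_unique[OF assms(1) this, of i] ij show False by simp
  qed
  have set: "set (map e [0..<n]) = e ` {..<n}" by auto
  have sum_eq: "(\<Sum>b\<in>e ` {..<n}. u b *\<^sub>R b) = (\<Sum>i<n. u (e i) *\<^sub>R e i)" for u
    using sum.reindex[OF inj, of "\<lambda>b. u b *\<^sub>R b"] by simp
  have "independent (e ` {..<n})"
  proof
    assume "dependent (e ` {..<n})"
    then obtain u where u: "\<exists>v\<in>e ` {..<n}. u v \<noteq> 0" "(\<Sum>v\<in>e ` {..<n}. u v *\<^sub>R v) = 0"
      using dependent_finite[of "e ` {..<n}"] by auto
    then have "(\<Sum>i<n. u (e i) *\<^sub>R e i) = 0" using sum_eq by simp
    then have "\<forall>i<n. u (e i) = 0"
      using assms(1)[unfolded basis_fam_def, THEN conjunct2, THEN conjunct2, rule_format, of "\<lambda>i. u (e i)"]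
      by simp
    then show False using u(1) by auto
  qed
  moreover have "span (e ` {..<n}) = S"
  proof
    show "span (e ` {..<n}) \<subseteq> S"
      using assms by (intro span_minimal) (auto simp: basis_fam_def)
    show "S \<subseteq> span (e ` {..<n})"
    proof
      fix v assume "v \<in> S"
      then obtain c where "v = (\<Sum>i<n. c i *\<^sub>R e i)" using assms(1) unfolding basis_fam_def by blast
      then show "v \<in> span (e ` {..<n})"
        by (simp only:) (intro span_sum span_scale span_base imageI)
    qed
  qed
  moreover have "distinct (map e [0..<n])" using inj by (simp add: distinct_map atLeast0LessThan)
  ultimately show ?thesis unfolding is_basis_list_def set by blast
qed

subsection \<open>Smooth sections\<close>

text \<open>\<open>vector_bundle\<close> without the covering property and the smooth transitions.
  This is what is established for the tangent algebroid, and for the bundle of invariants it is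
  available before its frames are known to cover the base.\<close>

definition framed :: "('m::topological_space, 'v::real_vector, 'z) vbundle_scheme \<Rightarrow> bool" where
  "framed E \<longleftrightarrow> (\<forall>x. subspace (fib E x)) \<and> (\<forall>(U, es)\<in>frames E. open U \<and> is_frame_on (fib E) U es)"

text \<open>Germ form of \<open>smooth_section_on\<close>, in which the coefficients may change with
  the point. It makes locality, sums and cut-offs pointwise statements.\<close>

definition sec_at ::
  "('m::topological_space, 'e::euclidean_space) manifold \<Rightarrow> ('m, 'v::real_vector, 'z) vbundle_scheme \<Rightarrow>
   ('m \<Rightarrow> 'v) \<Rightarrow> 'm \<Rightarrow> bool" where
  "sec_at M E s y \<longleftrightarrow> (\<forall>(U, es)\<in>frames E. y \<in> U \<longrightarrow> (\<exists>c N. (\<forall>i<length es. smooth_at M (c i) y) \<and>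
     open N \<and> y \<in> N \<and> (\<forall>z\<in>N. s z = (\<Sum>i<length es. c i z *\<^sub>R (es ! i) z))))"

lemma framedD:
  assumes "framed E"
  shows "subspace (fib E x)" "(U, es) \<in> frames E \<Longrightarrow> open U"
    "(U, es) \<in> frames E \<Longrightarrow> x \<in> U \<Longrightarrow> basis_fam (length es) (\<lambda>i. (es ! i) x) (fib E x)"
proof -
  show "subspace (fib E x)" using assms by (simp add: framed_def)
  assume "(U, es) \<in> frames E"
  then have *: "open U" "is_frame_on (fib E) U es" using assms by (auto simp: framed_def)
  show "open U" by fact
  assume "x \<in> U"
  then have "is_basis_list (map (\<lambda>e. e x) es) (fib E x)" using *(2) by (simp add: is_frame_on_def)
  from basis_list_imp_fam[OF this]
  have "basis_fam (length es) (\<lambda>i. map (\<lambda>e. e x) es ! i) (fib E x)" by simp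
  then show "basis_fam (length es) (\<lambda>i. (es ! i) x) (fib E x)"
    by (simp add: basis_fam_def)
qed

context smooth_mfd
begin

lemma sec_at_cong:
  assumes "sec_at M E s y" "open N" "y \<in> N" "\<And>z. z \<in> N \<Longrightarrow> s z = t z"
  shows "sec_at M E t y"
  unfolding sec_at_def
proof clarify
  fix U es assume "(U, es) \<in> frames E" "y \<in> U"
  then obtain c N' where "\<forall>i<length es. smooth_at M (c i) y" "open N'" "y \<in> N'"
    "\<forall>z\<in>N'. s z = (\<Sum>i<length es. c i z *\<^sub>R (es ! i) z)"
    using assms(1) unfolding sec_at_def by blast
  then show "\<exists>c N. (\<forall>i<length es. smooth_at M (c i) y) \<and> open N \<and> y \<in> N \<and>
      (\<forall>z\<in>N. t z = (\<Sum>i<length es. c i z *\<^sub>R (es ! i) z))"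
    using assms(2-4) by (intro exI[of _ c] exI[of _ "N \<inter> N'"]) auto
qed

lemma sec_at_add:
  assumes "sec_at M E s y" "sec_at M E t y"
  shows "sec_at M E (\<lambda>x. s x + t x) y"
  unfolding sec_at_def
proof clarify
  fix U es assume U: "(U, es) \<in> frames E" "y \<in> U"
  obtain c N where c: "\<forall>i<length es. smooth_at M (c i) y" "open N" "y \<in> N"
    "\<forall>z\<in>N. s z = (\<Sum>i<length es. c i z *\<^sub>R (es ! i) z)"
    using assms(1) U unfolding sec_at_def by blast
  obtain c' N' where c': "\<forall>i<length es. smooth_at M (c' i) y" "open N'" "y \<in> N'"
    "\<forall>z\<in>N'. t z = (\<Sum>i<length es. c' i z *\<^sub>R (es ! i) z)"
    using assms(2) U unfolding sec_at_def by blast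
  show "\<exists>c N. (\<forall>i<length es. smooth_at M (c i) y) \<and> open N \<and> y \<in> N \<and>
      (\<forall>z\<in>N. s z + t z = (\<Sum>i<length es. c i z *\<^sub>R (es ! i) z))"
    using c c' by (intro exI[of _ "\<lambda>i z. c i z + c' i z"] exI[of _ "N \<inter> N'"])
      (auto simp: smooth_at_add scaleR_left_distrib sum.distrib)
qed

lemma sec_at_scale:
  assumes "sec_at M E s y" "smooth_at M f y"
  shows "sec_at M E (\<lambda>x. f x *\<^sub>R s x) y"
  unfolding sec_at_def
proof clarify
  fix U es assume U: "(U, es) \<in> frames E" "y \<in> U"
  obtain c N where c: "\<forall>i<length es. smooth_at M (c i) y" "open N" "y \<in> N"
    "\<forall>z\<in>N. s z = (\<Sum>i<length es. c i z *\<^sub>R (es ! i) z)"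
    using assms(1) U unfolding sec_at_def by blast
  show "\<exists>c N. (\<forall>i<length es. smooth_at M (c i) y) \<and> open N \<and> y \<in> N \<and>
      (\<forall>z\<in>N. f z *\<^sub>R s z = (\<Sum>i<length es. c i z *\<^sub>R (es ! i) z))"
    using c assms(2) by (intro exI[of _ "\<lambda>i z. f z * c i z"] exI[of _ "N"])
      (auto simp: smooth_at_mult scaleR_sum_right)
qed

lemma sec_at_zero: "sec_at M E (\<lambda>x. 0) y"
  unfolding sec_at_def
  by (intro ballI) (clarify, intro exI[of _ "\<lambda>_ _. 0"] exI[of _ UNIV], auto)

lemma sec_at_sum: "(\<And>i. i \<in> I \<Longrightarrow> sec_at M E (s i) y) \<Longrightarrow> sec_at M E (\<lambda>x. \<Sum>i\<in>I. s i x) y"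
  by (induction I rule: infinite_finite_induct) (auto intro: sec_at_add sec_at_zero)

lemma sec_at_diff:
  "sec_at M E s y \<Longrightarrow> sec_at M E t y \<Longrightarrow> sec_at M E (\<lambda>x. s x - t x) y"
  using sec_at_add[OF _ sec_at_scale[OF _ smooth_at_const[of "-1"]], of E s y t] by simp

text \<open>Passing from germs to a region requires one set of coefficients per frame. Coefficients
  in a basis are unique, so \<open>bcoef\<close> agrees near each point with the choice made by the
  germ there and is smooth.\<close>

lemma smooth_section_on_iff:
  assumes "framed E" "open W"
  shows "smooth_section_on M E W s \<longleftrightarrow> (\<forall>y\<in>W. s y \<in> fib E y \<and> sec_at M E s y)"
proof
  assume L: "smooth_section_on M E W s"
  have "sec_at M E s y" if "y \<in> W" for y
    unfolding sec_at_def
  proof clarify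
    fix U es assume U: "(U, es) \<in> frames E" "y \<in> U"
    have oU: "open (U \<inter> W)" using framedD(2)[OF assms(1) U(1)] assms(2) by blast
    obtain c where "\<forall>i<length es. smooth_fun_on M (U \<inter> W) (c i)"
        "\<forall>x\<in>U \<inter> W. s x = (\<Sum>i<length es. c i x *\<^sub>R (es ! i) x)"
      using L U unfolding smooth_section_on_def by blast
    then show "\<exists>c N. (\<forall>i<length es. smooth_at M (c i) y) \<and> open N \<and> y \<in> N \<and>
      (\<forall>z\<in>N. s z = (\<Sum>i<length es. c i z *\<^sub>R (es ! i) z))"
      using U that oU smooth_fun_on_iff[OF oU] by (intro exI[of _ c] exI[of _ "U \<inter> W"]) auto
  qed
  then show "\<forall>y\<in>W. s y \<in> fib E y \<and> sec_at M E s y"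
    using L by (simp add: smooth_section_on_def)
next
  assume R: "\<forall>y\<in>W. s y \<in> fib E y \<and> sec_at M E s y"
  show "smooth_section_on M E W s"
    unfolding smooth_section_on_def
  proof (intro conjI, use R in simp, clarify)
    fix U es assume U: "(U, es) \<in> frames E"
    have oU: "open (U \<inter> W)" using framedD(2)[OF assms(1) U(1)] assms(2) by blast
    define c where "c i z = bcoef (length es) (\<lambda>i. (es ! i) z) (s z) i" for i z
    have "smooth_at M (c i) y" if i: "i < length es" and y: "y \<in> U \<inter> W" for i y
    proof -
      obtain d N where d: "\<forall>i<length es. smooth_at M (d i) y" "open N" "y \<in> N"
        "\<forall>z\<in>N. s z = (\<Sum>i<length es. d i z *\<^sub>R (es ! i) z)"
        using R U y unfolding sec_at_def by blast
      have "d i z = c i z" if "z \<in> U \<inter> W \<inter> N" for z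
        using that d(4) i bcoef_eq[OF framedD(3)[OF assms(1) U] framedD(1)[OF assms(1)] i, of z "\<lambda>i. d i z"]
        by (simp add: c_def)
      then show ?thesis
        using smooth_at_cong[OF d(1)[rule_format, OF i], of "U \<inter> W \<inter> N" "c i"] oU d(2,3) y by auto
    qed
    moreover have "s x = (\<Sum>i<length es. c i x *\<^sub>R (es ! i) x)" if "x \<in> U \<inter> W" for x
      using that R bcoef_sum[OF framedD(3)[OF assms(1) U]] by (simp add: c_def)
    ultimately show "\<exists>c. (\<forall>i<length es. smooth_fun_on M (U \<inter> W) (c i)) \<and>
        (\<forall>x\<in>U \<inter> W. s x = (\<Sum>i<length es. c i x *\<^sub>R (es ! i) x))"
      using smooth_fun_on_iff[OF oU] by blast
  qed
qed

lemma sections_iff: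
  "framed E \<Longrightarrow> s \<in> sections M E \<longleftrightarrow> (\<forall>y. s y \<in> fib E y \<and> sec_at M E s y)"
  by (simp add: sections_def smooth_section_on_iff)

end

section \<open>Global sections, local frames and gluing in a vector bundle\<close>

locale vbun = smooth_mfd M
  for M :: "('m::{t2_space, second_countable_topology}, 'e::euclidean_space) manifold" +
  fixes E :: "('m, 'v::real_vector, 'z) vbundle_scheme"
  assumes vector_bundle: "vector_bundle M E"
begin

lemma framed: "framed E"
  using vector_bundle unfolding vector_bundle_def framed_def by auto

lemma fib_subspace: "subspace (fib E y)"
  by (rule framedD(1)[OF framed])

lemma frame_exists: obtains U es where "(U, es) \<in> frames E" "y \<in> U" "open U"
    "basis_fam (length es) (\<lambda>i. (es ! i) y) (fib E y)"
proof -
  have "(\<Union>(U, es)\<in>frames E. U) = UNIV" using vector_bundle by (simp add: vector_bundle_def)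
  then have "y \<in> (\<Union>(U, es)\<in>frames E. U)" by simp
  then obtain U es where "(U, es) \<in> frames E" "y \<in> U" by blast
  then show ?thesis using that framedD[OF framed] by blast
qed

lemma frame_sec_at:
  assumes "(U, es) \<in> frames E" "y \<in> U" "i < length es"
  shows "sec_at M E (es ! i) y"
proof -
  have "smooth_section_on M E U (es ! i)"
    using vector_bundle assms(1,3) unfolding vector_bundle_def by (metis (no_types, lifting) case_prodD nth_mem)
  then show ?thesis
    using smooth_section_on_iff[OF framed framedD(2)[OF framed assms(1)]] assms(2) by blast
qed

lemma sectionsI: "(\<And>y. s y \<in> fib E y) \<Longrightarrow> (\<And>y. sec_at M E s y) \<Longrightarrow> s \<in> sections M E"
  by (simp add: sections_iff[OF framed])

lemma sectionsD:
  assumes "s \<in> sections M E" shows "s y \<in> fib E y" "sec_at M E s y"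
  using assms by (auto simp: sections_iff[OF framed])

lemma sections_scale_fun: "f \<in> smooth_funs M \<Longrightarrow> s \<in> sections M E \<Longrightarrow> (\<lambda>y. f y *\<^sub>R s y) \<in> sections M E"
  by (auto simp: sections_iff[OF framed] smooth_funs_iff intro!: sec_at_scale subspace_scale fib_subspace)

lemma sections_add_fun: "s \<in> sections M E \<Longrightarrow> t \<in> sections M E \<Longrightarrow> (\<lambda>y. s y + t y) \<in> sections M E"
  by (auto simp: sections_iff[OF framed] intro!: sec_at_add subspace_add fib_subspace)

lemma sections_add: "s \<in> sections M E \<Longrightarrow> t \<in> sections M E \<Longrightarrow> s + t \<in> sections M E"
  using sections_add_fun by (simp add: plus_fun_def)

lemma sections_scale: "s \<in> sections M E \<Longrightarrow> r *\<^sub>R s \<in> sections M E"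
  unfolding scaleR_fun_def by (rule sections_scale_fun) (simp add: smooth_funs_iff)

lemma sections_zero: "(\<lambda>y. 0) \<in> sections M E"
  by (auto intro!: sectionsI sec_at_zero subspace_0 fib_subspace)

lemma sections_sum_fun: "(\<And>i. i \<in> I \<Longrightarrow> s i \<in> sections M E) \<Longrightarrow> (\<lambda>y. \<Sum>i\<in>I. s i y) \<in> sections M E"
  by (induction I rule: infinite_finite_induct) (auto intro: sections_add_fun sections_zero)

lemma bump_section:
  assumes U: "open U" and s: "\<And>z. z \<in> U \<Longrightarrow> s z \<in> fib E z" "\<And>z. z \<in> U \<Longrightarrow> sec_at M E s z"
    and \<beta>: "\<beta> \<in> smooth_funs M" "closed K" "K \<subseteq> U" "\<And>z. z \<notin> K \<Longrightarrow> \<beta> z = 0"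
  shows "(\<lambda>z. \<beta> z *\<^sub>R s z) \<in> sections M E"
proof (rule sectionsI)
  show "\<beta> y *\<^sub>R s y \<in> fib E y" for y
    using s(1) \<beta> subspace_0[OF fib_subspace] subspace_scale[OF fib_subspace] by (cases "y \<in> K") auto
  show "sec_at M E (\<lambda>z. \<beta> z *\<^sub>R s z) y" for y
  proof (cases "y \<in> K")
    case True
    then show ?thesis using s(2) \<beta> by (intro sec_at_scale) (auto simp: smooth_funs_iff)
  next
    case False
    then show ?thesis
      using sec_at_cong[OF sec_at_zero, of "- K" y "\<lambda>z. \<beta> z *\<^sub>R s z"] \<beta>(2,4) by auto
  qed
qed

text \<open>The last conclusion says that the extension is a pointwise multiple of \<open>s\<close>
  and zero outside \<open>U\<close>; membership in a family of fibrewise subspaces thus passes from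
  \<open>s\<close> to the global section.\<close>

lemma globalize_section:
  assumes "open U" "y \<in> U" "\<And>z. z \<in> U \<Longrightarrow> s z \<in> fib E z" "\<And>z. z \<in> U \<Longrightarrow> sec_at M E s z"
  obtains t N where "t \<in> sections M E" "open N" "y \<in> N" "N \<subseteq> U" "\<And>z. z \<in> N \<Longrightarrow> t z = s z"
    "\<And>z. \<exists>r. t z = r *\<^sub>R s z \<and> (r \<noteq> 0 \<longrightarrow> z \<in> U)"
proof -
  obtain \<beta> V K where b: "\<beta> \<in> smooth_funs M" "open V" "y \<in> V" "V \<subseteq> K" "closed K" "K \<subseteq> U"
    "\<And>z. z \<in> V \<Longrightarrow> \<beta> z = 1" "\<And>z. z \<notin> K \<Longrightarrow> \<beta> z = 0"
    using bump[OF assms(1,2)] by metis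
  show ?thesis
    by (rule that[OF bump_section[OF assms(1,3,4) b(1,5,6,8)] b(2,3)])
      (use b in \<open>auto intro!: exI[of _ "\<beta> _"]\<close>)
qed

lemma section_through:
  assumes "v \<in> fib E y"
  obtains s where "s \<in> sections M E" "s y = v"
proof -
  obtain U es where U: "(U, es) \<in> frames E" "y \<in> U" "open U"
    "basis_fam (length es) (\<lambda>i. (es ! i) y) (fib E y)"
    by (rule frame_exists)
  define s where "s z = (\<Sum>i<length es. bcoef (length es) (\<lambda>i. (es ! i) y) v i *\<^sub>R (es ! i) z)" for z
  have "s z \<in> fib E z" if "z \<in> U" for z
    unfolding s_def by (rule basis_fam_sum_in[OF framedD(3)[OF framed U(1) that] fib_subspace])
  moreover have "sec_at M E s z" if "z \<in> U" for z
    unfolding s_def[abs_def] using that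
    by (intro sec_at_sum sec_at_scale frame_sec_at[OF U(1)]) auto
  ultimately obtain t N where "t \<in> sections M E" "y \<in> N" "\<And>z. z \<in> N \<Longrightarrow> t z = s z"
    using globalize_section[OF U(3,2), of s] by metis
  moreover have "s y = v" unfolding s_def by (rule bcoef_sum[OF U(4) assms])
  ultimately show ?thesis using that by simp
qed

text \<open>Frames made of global sections, because the bracket and the representation are only
  controlled on global sections; they are bases of the fibres over \<open>N\<close> only.\<close>

definition local_frame :: "'m set \<Rightarrow> nat \<Rightarrow> (nat \<Rightarrow> 'm \<Rightarrow> 'v) \<Rightarrow> bool" where
  "local_frame N n e \<longleftrightarrow> open N \<and> (\<forall>i<n. e i \<in> sections M E) \<and>
     (\<forall>z\<in>N. basis_fam n (\<lambda>i. e i z) (fib E z)) \<and>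
     (\<forall>z\<in>N. \<forall>s. sec_at M E s z \<longrightarrow> (\<forall>i<n. smooth_at M (\<lambda>z. bcoef n (\<lambda>i. e i z) (s z) i) z))"

lemma local_frameD:
  assumes "local_frame N n e"
  shows "open N" "i < n \<Longrightarrow> e i \<in> sections M E" "z \<in> N \<Longrightarrow> basis_fam n (\<lambda>i. e i z) (fib E z)"
    "z \<in> N \<Longrightarrow> sec_at M E s z \<Longrightarrow> i < n \<Longrightarrow> smooth_at M (\<lambda>z. bcoef n (\<lambda>i. e i z) (s z) i) z"
  using assms by (auto simp: local_frame_def)

lemma local_frame_exists:
  assumes "open U0" "y \<in> U0"
  obtains N n e where "local_frame N n e" "y \<in> N" "N \<subseteq> U0"
proof -
  obtain U es where U: "(U, es) \<in> frames E" "y \<in> U" "open U" by (rule frame_exists)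
  let ?n = "length es"
  have "\<exists>t N. t \<in> sections M E \<and> open N \<and> y \<in> N \<and> N \<subseteq> U \<and> (\<forall>z\<in>N. t z = (es ! i) z)"
    if i: "i < ?n" for i
  proof -
    have "(es ! i) z \<in> fib E z" if "z \<in> U" for z
      using framedD(3)[OF framed U(1) that] i by (auto simp: basis_fam_def)
    from globalize_section[OF U(3,2) this frame_sec_at[OF U(1) _ i]] show ?thesis by metis
  qed
  then obtain e N' where e: "\<And>i. i < ?n \<Longrightarrow> e i \<in> sections M E" "\<And>i. i < ?n \<Longrightarrow> open (N' i)"
    "\<And>i. i < ?n \<Longrightarrow> y \<in> N' i" "\<And>i z. i < ?n \<Longrightarrow> z \<in> N' i \<Longrightarrow> e i z = (es ! i) z"
    by metis
  define N where "N = U0 \<inter> U \<inter> (\<Inter>i<?n. N' i)"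
  have eN: "e i z = (es ! i) z" if "z \<in> N" "i < ?n" for z i using e that by (auto simp: N_def)
  have oN: "open N" unfolding N_def using assms U e by (intro open_Int open_INT) auto
  have bf: "basis_fam ?n (\<lambda>i. e i z) (fib E z)" if z: "z \<in> N" for z
    using framedD(3)[OF framed U(1), of z] z eN[OF z] by (simp add: N_def basis_fam_def)
  have "smooth_at M (\<lambda>z. bcoef ?n (\<lambda>i. e i z) (s z) i) z"
    if z: "z \<in> N" and s: "sec_at M E s z" and i: "i < ?n" for s z i
  proof -
    have "z \<in> U" using z by (simp add: N_def)
    then obtain c N2 where c: "\<forall>i<?n. smooth_at M (c i) z" "open N2" "z \<in> N2"
      "\<forall>x\<in>N2. s x = (\<Sum>i<?n. c i x *\<^sub>R (es ! i) x)"
      using s U(1) unfolding sec_at_def by blast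
    show ?thesis
    proof (rule smooth_at_cong[of "c i" z "N \<inter> N2"])
      show "c i x = bcoef ?n (\<lambda>i. e i x) (s x) i" if x: "x \<in> N \<inter> N2" for x
      proof -
        have "s x = (\<Sum>i<?n. c i x *\<^sub>R e i x)" using c(4) eN x by auto
        then show ?thesis using bcoef_eq[OF bf fib_subspace i, of x "\<lambda>i. c i x"] x by simp
      qed
    qed (use c i z oN in auto)
  qed
  then have "local_frame N ?n e"
    unfolding local_frame_def using oN e bf by blast
  moreover have "y \<in> N" "N \<subseteq> U0" using assms U e by (auto simp: N_def)
  ultimately show ?thesis using that by blast
qed

lemma local_frame_expand:
  assumes "local_frame N n e" "z \<in> N" "v \<in> fib E z"
  shows "v = (\<Sum>i<n. bcoef n (\<lambda>i. e i z) v i *\<^sub>R e i z)"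
  using bcoef_sum[OF local_frameD(3)[OF assms(1,2)] assms(3)] by simp

text \<open>Near \<open>y\<close>, a section vanishing at \<open>y\<close> is a combination of sections with coefficients
  vanishing at \<open>y\<close>.\<close>

lemma tensorial:
  fixes D :: "('m \<Rightarrow> 'v) \<Rightarrow> 'w::real_vector"
  assumes add: "\<And>s t. s \<in> sections M E \<Longrightarrow> t \<in> sections M E \<Longrightarrow> D (\<lambda>z. s z + t z) = D s + D t"
    and scale: "\<And>f s. f \<in> smooth_funs M \<Longrightarrow> s \<in> sections M E \<Longrightarrow> D (\<lambda>z. f z *\<^sub>R s z) = f y *\<^sub>R D s"
    and s: "s \<in> sections M E" "t \<in> sections M E" "s y = t y"
  shows "D s = D t"
proof -
  obtain N n e where e: "local_frame N n e" "y \<in> N" using local_frame_exists[OF open_UNIV UNIV_I] by metis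
  obtain \<beta> V K where b: "\<beta> \<in> smooth_funs M" "open V" "y \<in> V" "V \<subseteq> K" "closed K" "K \<subseteq> N"
    "\<And>z. z \<in> V \<Longrightarrow> \<beta> z = 1" "\<And>z. z \<notin> K \<Longrightarrow> \<beta> z = 0"
    using bump[OF local_frameD(1)[OF e(1)] e(2)] by metis
  define c where "c r i z = \<beta> z * bcoef n (\<lambda>i. e i z) (r z) i" for r i z
  have D0: "D (\<lambda>z. 0) = 0" using scale[OF _ sections_zero, of "\<lambda>_. 0"] by (simp add: smooth_funs_iff)
  have cs: "c r i \<in> smooth_funs M" if "r \<in> sections M E" "i < n" for r i
    unfolding smooth_funs_iff
  proof
    fix z show "smooth_at M (c r i) z"
    proof (cases "z \<in> K")
      case True
      then show ?thesis unfolding c_def[abs_def]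
        using b that by (intro smooth_at_mult local_frameD(4)[OF e(1)] sectionsD) (auto simp: smooth_funs_iff)
    next
      case False
      then show ?thesis
        using smooth_at_cong[OF smooth_at_const[of 0], of "- K" z "c r i"] b(5,8) by (auto simp: c_def)
    qed
  qed
  have Dsum: "D (\<lambda>z. \<Sum>i\<in>I. c r i z *\<^sub>R e i z) = (\<Sum>i\<in>I. c r i y *\<^sub>R D (e i))"
    if "finite I" "I \<subseteq> {..<n}" "r \<in> sections M E" for I r
    using that
  proof (induction I)
    case (insert i I)
    have "D (\<lambda>z. c r i z *\<^sub>R e i z + (\<Sum>i\<in>I. c r i z *\<^sub>R e i z)) =
        D (\<lambda>z. c r i z *\<^sub>R e i z) + D (\<lambda>z. \<Sum>i\<in>I. c r i z *\<^sub>R e i z)"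
      using insert.prems by (intro add sections_sum_fun sections_scale_fun cs local_frameD(2)[OF e(1)]) auto
    also have "D (\<lambda>z. c r i z *\<^sub>R e i z) = c r i y *\<^sub>R D (e i)"
      using insert.prems by (intro scale cs local_frameD(2)[OF e(1)]) auto
    finally show ?case using insert by simp
  qed (simp add: D0)
  \<comment> \<open>The vectors \<open>D (e i)\<close> are fixed, so the right-hand side depends on
    \<open>r\<close> only through \<open>r y\<close>. The cut-off makes the local expansion global
    and costs nothing because \<open>\<beta> y = 1\<close>.\<close>
  have "D r = (\<Sum>i<n. bcoef n (\<lambda>i. e i y) (r y) i *\<^sub>R D (e i))" if r: "r \<in> sections M E" for r
  proof -
    have 1: "\<beta> z *\<^sub>R r z = (\<Sum>i<n. c r i z *\<^sub>R e i z)" for z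
    proof (cases "z \<in> N")
      case True
      have "\<beta> z *\<^sub>R r z = \<beta> z *\<^sub>R (\<Sum>i<n. bcoef n (\<lambda>i. e i z) (r z) i *\<^sub>R e i z)"
        by (rule arg_cong[OF local_frame_expand[OF e(1) True sectionsD(1)[OF r]]])
      then show ?thesis by (simp add: c_def scaleR_sum_right)
    next
      case False
      then have "\<beta> z = 0" using b by blast
      then show ?thesis by (simp add: c_def)
    qed
    have "D r = D (\<lambda>z. \<beta> z *\<^sub>R r z)" using scale[OF b(1) r] b(3,7) by simp
    also have "\<dots> = (\<Sum>i<n. c r i y *\<^sub>R D (e i))" unfolding 1 by (rule Dsum) (use r in auto)
    finally show ?thesis using b(3,7) by (simp add: c_def)
  qed
  then show ?thesis using s by simp
qed

text \<open>The difference \<open>r\<close> of the sections vanishes near \<open>y\<close>, so it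
  equals \<open>(1 - \<beta>) r\<close> with both factors zero at \<open>y\<close>, and the Leibniz
  rule gives \<open>D r = 0\<close>.\<close>

lemma operator_local:
  assumes add: "\<And>s t. s \<in> sections M E \<Longrightarrow> t \<in> sections M E \<Longrightarrow> D (\<lambda>z. s z + t z) = D s + D t"
    and leibniz: "\<And>f s. f \<in> smooth_funs M \<Longrightarrow> s \<in> sections M E \<Longrightarrow>
      D (\<lambda>z. f z *\<^sub>R s z) = X f *\<^sub>R s y + f y *\<^sub>R D s"
    and s: "s \<in> sections M E" "t \<in> sections M E" "open N" "y \<in> N" "\<And>z. z \<in> N \<Longrightarrow> s z = t z"
  shows "D s = D t"
proof -
  obtain \<beta> V K where b: "\<beta> \<in> smooth_funs M" "open V" "y \<in> V" "V \<subseteq> K" "closed K" "K \<subseteq> N"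
    "\<And>z. z \<in> V \<Longrightarrow> \<beta> z = 1" "\<And>z. z \<notin> K \<Longrightarrow> \<beta> z = 0"
    using bump[OF s(3,4)] by metis
  define r where "r z = s z + (-1) *\<^sub>R t z" for z
  have m: "(\<lambda>z. (-1) *\<^sub>R t z) \<in> sections M E" by (rule sections_scale_fun[OF _ s(2)]) (simp add: smooth_funs_iff)
  have r: "r \<in> sections M E" unfolding r_def[abs_def] by (rule sections_add_fun[OF s(1) m])
  have "\<beta> z = 0 \<or> r z = 0" for z
    using b s(5)[of z] by (auto simp: r_def)
  then have eq: "(\<lambda>z. (1 - \<beta> z) *\<^sub>R r z) = r" by (auto simp: fun_eq_iff algebra_simps)
  have "(\<lambda>z. 1 - \<beta> z) \<in> smooth_funs M" using b(1) by (auto simp: smooth_funs_iff intro: smooth_at_diff)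
  from leibniz[OF this r] have "D r = X (\<lambda>z. 1 - \<beta> z) *\<^sub>R r y + (1 - \<beta> y) *\<^sub>R D r" unfolding eq .
  moreover have "r y = 0" using s(4,5) by (simp add: r_def)
  ultimately have "D r = 0" using b(3,7) by simp
  moreover have "D r = D s + D (\<lambda>z. (-1) *\<^sub>R t z)" unfolding r_def[abs_def] by (rule add[OF s(1) m])
  moreover have "D (\<lambda>z. (-1) *\<^sub>R t z) = X (\<lambda>z. -1) *\<^sub>R t y + (-1) *\<^sub>R D t"
    by (rule leibniz[OF _ s(2)]) (simp add: smooth_funs_iff)
  \<comment> \<open>No linearity of \<open>X\<close> is assumed, so its value on the constant -1 has
    to be dealt with: applying the Leibniz rule twice with this constant must return
    \<open>D t\<close>, which forces twice the vector in question to vanish.\<close>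
  moreover have "X (\<lambda>z. -1) *\<^sub>R t y = 0"
  proof -
    define x where "x = X (\<lambda>z. -1) *\<^sub>R t y"
    have 1: "D (\<lambda>z. (-1) *\<^sub>R t z) = x - D t"
      using leibniz[of "\<lambda>_. -1", OF _ s(2)] by (simp add: smooth_funs_iff x_def)
    have "D (\<lambda>z. (-1) *\<^sub>R ((-1) *\<^sub>R t z)) = X (\<lambda>z. -1) *\<^sub>R ((-1) *\<^sub>R t y) + (-1) *\<^sub>R D (\<lambda>z. (-1) *\<^sub>R t z)"
      by (rule leibniz[OF _ m]) (simp add: smooth_funs_iff)
    then have "D t = - x - (x - D t)" by (simp add: x_def 1[unfolded x_def, simplified])
    then have "D t + (x + x) = D t + 0" by (metis add.right_neutral add_diff_cancel_left' diff_add_cancel diff_diff_eq2 minus_diff_eq uminus_add_conv_diff)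
    then have "(2::real) *\<^sub>R x = 0" by (simp only: add_left_cancel scaleR_2)
    then have "x = 0" by (simp only: scaleR_eq_0_iff) simp
    then show ?thesis by (simp only: x_def)
  qed
  ultimately show ?thesis by simp
qed

text \<open>The weights \<open>w n = f n * (\<Prod>k<n. 1 - f k)\<close> of bump functions \<open>f n\<close> form a partition of unity,
  and at most \<open>m + 1\<close> of them are nonzero where \<open>f m = 1\<close>; so no paracompactness is needed.\<close>

lemma glue_sections:
  assumes affine: "\<And>y u v r. u \<in> P y \<Longrightarrow> v \<in> P y \<Longrightarrow> r *\<^sub>R u + (1 - r) *\<^sub>R v \<in> P y"
    and local: "\<And>y. \<exists>U s. open U \<and> y \<in> U \<and> (\<forall>z\<in>U. s z \<in> fib E z \<and> sec_at M E s z \<and> s z \<in> P z)"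
  shows "\<exists>s\<in>sections M E. \<forall>y. s y \<in> P y"
proof -
  have "\<exists>\<beta> V t. \<beta> \<in> smooth_funs M \<and> open V \<and> y \<in> V \<and> (\<forall>z\<in>V. \<beta> z = 1) \<and>
      (\<lambda>z. \<beta> z *\<^sub>R t z) \<in> sections M E \<and> (\<forall>z. \<beta> z \<noteq> 0 \<longrightarrow> t z \<in> P z)" (is "\<exists>\<beta> V t. ?Q y \<beta> V t") for y
  proof -
    obtain U t where U: "open U" "y \<in> U" "\<And>z. z \<in> U \<Longrightarrow> t z \<in> fib E z" "\<And>z. z \<in> U \<Longrightarrow> sec_at M E t z"
      "\<And>z. z \<in> U \<Longrightarrow> t z \<in> P z"
      using local by metis
    obtain \<beta> V K where b: "\<beta> \<in> smooth_funs M" "open V" "y \<in> V" "V \<subseteq> K" "closed K" "K \<subseteq> U"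
      "\<And>z. z \<in> V \<Longrightarrow> \<beta> z = 1" "\<And>z. z \<notin> K \<Longrightarrow> \<beta> z = 0"
      using bump[OF U(1,2)] by metis
    have "\<forall>z. \<beta> z \<noteq> 0 \<longrightarrow> t z \<in> P z" using b(6,8) U(5) by blast
    then show ?thesis
      using bump_section[OF U(1,3,4) b(1,5,6,8)] b
      by (intro exI[of _ \<beta>] exI[of _ V] exI[of _ t]) auto
  qed
  then have "\<forall>y. \<exists>\<beta> V t. ?Q y \<beta> V t" by blast
  then obtain \<beta> V t where *: "\<forall>y. ?Q y (\<beta> y) (V y) (t y)"
    unfolding choice_iff by (elim exE)
  have b: "\<And>y. \<beta> y \<in> smooth_funs M" "\<And>y. open (V y)" "\<And>y. y \<in> V y"
    "\<And>y z. z \<in> V y \<Longrightarrow> \<beta> y z = 1" "\<And>y. (\<lambda>z. \<beta> y z *\<^sub>R t y z) \<in> sections M E"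
    "\<And>y z. \<beta> y z \<noteq> 0 \<Longrightarrow> t y z \<in> P z"
    using * by simp_all
  \<comment> \<open>Second countability reduces the cover to a sequence, so that the products below
    run over initial segments.\<close>
  obtain \<V> where \<V>: "\<V> \<subseteq> range V" "countable \<V>" "\<Union>\<V> = \<Union>(range V)"
  proof (rule Lindelof[of "range V"])
    show "open S" if "S \<in> range V" for S using that b(2) by (elim rangeE) simp
  qed
  obtain Y where Y: "countable Y" "\<V> = V ` Y"
    using \<V>(1,2) countable_subset_image[of \<V> V UNIV] by metis
  have cov: "\<exists>p\<in>Y. z \<in> V p" for z
  proof -
    have "z \<in> \<Union>\<V>" unfolding \<V>(3) using b(3)[of z] by (rule UnionI[OF rangeI])
    then show ?thesis unfolding Y(2) by simp
  qed
  then have "Y \<noteq> {}" by blast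
  define p where "p = from_nat_into Y"
  have p: "\<exists>n. z \<in> V (p n)" for z
  proof -
    obtain q where q: "q \<in> Y" "z \<in> V q" using cov by blast
    then have "q \<in> range p" unfolding p_def using range_from_nat_into[OF \<open>Y \<noteq> {}\<close> Y(1)] by simp
    then show ?thesis using q(2) by blast
  qed
  define \<rho> where "\<rho> n z = (\<Prod>k<n. 1 - \<beta> (p k) z)" for n z
  define \<tau> where "\<tau> n z = (\<Sum>k<n. \<rho> k z *\<^sub>R (\<beta> (p k) z *\<^sub>R t (p k) z))" for n z
  have \<rho>: "\<rho> n \<in> smooth_funs M" for n
  proof (induction n)
    case (Suc n)
    have "(\<lambda>z. \<rho> n z * (1 - \<beta> (p n) z)) \<in> smooth_funs M"
      by (intro smooth_funs_closed(2)[OF Suc] smooth_funs_closed(4)[OF _ b(1)]) (simp add: smooth_funs_iff)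
    then show ?case by (simp add: \<rho>_def[abs_def])
  qed (simp add: \<rho>_def[abs_def] smooth_funs_iff)
  have \<tau>: "\<tau> n \<in> sections M E" for n
    unfolding \<tau>_def[abs_def] by (intro sections_sum_fun sections_scale_fun[OF \<rho>] b(5))
  \<comment> \<open>The weights used so far and \<open>\<rho> n\<close> sum to 1, so completing the
    partial sum by any \<open>q\<close> in \<open>P z\<close> gives an affine combination. In the
    induction \<open>q\<close> is replaced by \<open>q'\<close>; where the bump is 0 the value
    \<open>t (p n) z\<close> need not lie in \<open>P z\<close>, and there \<open>q'\<close> is just
    \<open>q\<close>.\<close>
  have inv: "\<tau> n z + \<rho> n z *\<^sub>R q \<in> P z" if "q \<in> P z" for n z q
    using that
  proof (induction n arbitrary: q)
    case 0
    then show ?case by (simp add: \<tau>_def \<rho>_def)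
  next
    case (Suc n)
    define q' where "q' = \<beta> (p n) z *\<^sub>R t (p n) z + (1 - \<beta> (p n) z) *\<^sub>R q"
    have "q' \<in> P z"
      using affine[OF b(6)[of "p n" z] Suc.prems, of "\<beta> (p n) z"] Suc.prems
      by (cases "\<beta> (p n) z = 0") (simp_all add: q'_def)
    then have "\<tau> n z + \<rho> n z *\<^sub>R q' \<in> P z" by (rule Suc.IH)
    then show ?case by (simp add: q'_def \<tau>_def \<rho>_def algebra_simps)
  qed
  have \<rho>0: "\<rho> n z = 0" if "z \<in> V (p m)" "m < n" for n m z
    using that b(4) by (auto simp: \<rho>_def)
  have stable: "\<tau> n z = \<tau> (Suc m) z" if "z \<in> V (p m)" "m < n" for n m z
  proof -
    have "\<tau> (Suc m + k) z = \<tau> (Suc m) z" for k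
    proof (induction k)
      case (Suc k)
      have "\<rho> (Suc m + k) z = 0" by (rule \<rho>0[OF that(1)]) simp
      then show ?case using Suc by (simp add: \<tau>_def)
    qed simp
    from this[of "n - Suc m"] show ?thesis using that(2) by simp
  qed
  define s where "s z = \<tau> (Suc (LEAST m. z \<in> V (p m))) z" for z
  have s: "s z = \<tau> (Suc m) z" if "z \<in> V (p m)" for z m
  proof -
    let ?l = "LEAST m. z \<in> V (p m)"
    have l: "z \<in> V (p ?l)" "?l \<le> m" using that by (auto intro: LeastI Least_le)
    then show ?thesis using stable[OF l(1), of "Suc m"] by (simp add: s_def)
  qed
  show ?thesis
  proof (intro bexI[of _ s] allI)
    show "s \<in> sections M E"
    proof (rule sectionsI)
      fix y
      obtain m where m: "y \<in> V (p m)" using p by blast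
      show "s y \<in> fib E y" using s[OF m] sectionsD(1)[OF \<tau>] by simp
      show "sec_at M E s y"
        by (rule sec_at_cong[OF sectionsD(2)[OF \<tau>[of "Suc m"]] b(2) m]) (simp add: s)
    qed
    show "s y \<in> P y" for y
    proof -
      obtain m where m: "y \<in> V (p m)" using p by blast
      have "t (p m) y \<in> P y" using b(4,6) m by simp
      from inv[OF this, of "Suc m"] show ?thesis using s[OF m] \<rho>0[OF m] by simp
    qed
  qed
qed

end

section \<open>Linear systems with smooth coefficients\<close>

text \<open>Gronwall's argument for the sum of squares \<open>g\<close>: the bound 2 |f_i f_k| \<le>
  f_i^2 + f_k^2, summed over all pairs, gives g' \<le> c g with c = 2 |K| card I. Hence g(t) exp(-c
  t) is nonincreasing, starts at 0 and is nonnegative.\<close>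

lemma linear_ode_zero:
  fixes f f' :: "'i \<Rightarrow> real \<Rightarrow> real"
  assumes I: "finite I"
    and d: "\<And>i t. i \<in> I \<Longrightarrow> 0 \<le> t \<Longrightarrow> t \<le> 1 \<Longrightarrow> (f i has_real_derivative f' i t) (at t)"
    and bd: "\<And>i t. i \<in> I \<Longrightarrow> 0 \<le> t \<Longrightarrow> t \<le> 1 \<Longrightarrow> \<bar>f' i t\<bar> \<le> K * (\<Sum>k\<in>I. \<bar>f k t\<bar>)"
    and z: "\<And>i. i \<in> I \<Longrightarrow> f i 0 = 0" and i: "i \<in> I"
  shows "f i 1 = 0"
proof -
  define g where "g t = (\<Sum>i\<in>I. (f i t)\<^sup>2)" for t
  define c where "c = 2 * \<bar>K\<bar> * card I"
  define h where "h t = g t * exp (- c * t)" for t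
  have g0: "g t \<ge> 0" for t by (simp add: g_def sum_nonneg)
  have dg: "(g has_real_derivative (\<Sum>i\<in>I. 2 * f i t * f' i t)) (at t)" if "0 \<le> t" "t \<le> 1" for t
    unfolding g_def[abs_def] power2_eq_square
    by (rule DERIV_sum) (use d that in \<open>auto intro!: derivative_eq_intros\<close>)
  have bg: "(\<Sum>i\<in>I. 2 * f i t * f' i t) \<le> c * g t" if t: "0 \<le> t" "t \<le> 1" for t
  proof -
    have "2 * f i t * f' i t \<le> \<bar>K\<bar> * (\<Sum>k\<in>I. (f i t)\<^sup>2 + (f k t)\<^sup>2)" if "i \<in> I" for i
    proof -
      have "\<bar>f' i t\<bar> \<le> \<bar>K\<bar> * (\<Sum>k\<in>I. \<bar>f k t\<bar>)"
        by (rule order_trans[OF bd[OF that t]]) (intro mult_right_mono sum_nonneg, auto)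
      then have "2 * \<bar>f i t\<bar> * \<bar>f' i t\<bar> \<le> 2 * \<bar>f i t\<bar> * (\<bar>K\<bar> * (\<Sum>k\<in>I. \<bar>f k t\<bar>))"
        by (intro mult_left_mono) auto
      also have "\<dots> = \<bar>K\<bar> * (\<Sum>k\<in>I. 2 * \<bar>f i t\<bar> * \<bar>f k t\<bar>)"
        by (simp add: sum_distrib_left mult_ac)
      also have "\<dots> \<le> \<bar>K\<bar> * (\<Sum>k\<in>I. (f i t)\<^sup>2 + (f k t)\<^sup>2)"
      proof (intro mult_left_mono sum_mono)
        fix k
        have "0 \<le> (\<bar>f i t\<bar> - \<bar>f k t\<bar>)\<^sup>2" by simp
        then show "2 * \<bar>f i t\<bar> * \<bar>f k t\<bar> \<le> (f i t)\<^sup>2 + (f k t)\<^sup>2"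
          by (simp add: power2_diff)
      qed simp
      finally show ?thesis using abs_ge_self[of "2 * f i t * f' i t"] by (simp add: abs_mult)
    qed
    then have "(\<Sum>i\<in>I. 2 * f i t * f' i t) \<le> (\<Sum>i\<in>I. \<bar>K\<bar> * (\<Sum>k\<in>I. (f i t)\<^sup>2 + (f k t)\<^sup>2))"
      by (rule sum_mono)
    also have "\<dots> = c * g t"
      by (simp add: sum.distrib g_def c_def algebra_simps flip: sum_distrib_left)
    finally show ?thesis .
  qed
  have "h 1 \<le> h 0"
  proof (rule DERIV_nonpos_imp_nonincreasing[of 0 1 h])
    fix t :: real assume t: "0 \<le> t" "t \<le> 1"
    have "(h has_real_derivative ((\<Sum>i\<in>I. 2 * f i t * f' i t) - c * g t) * exp (- c * t)) (at t)"
      unfolding h_def[abs_def] by (auto intro!: derivative_eq_intros dg[OF t] simp: algebra_simps)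
    moreover have "((\<Sum>i\<in>I. 2 * f i t * f' i t) - c * g t) * exp (- c * t) \<le> 0"
      using bg[OF t] by (simp add: mult_nonpos_nonneg)
    ultimately show "\<exists>y. (h has_real_derivative y) (at t) \<and> y \<le> 0" by blast
  qed simp
  moreover have "h 0 = 0" using z by (simp add: h_def g_def)
  ultimately have "g 1 \<le> 0" by (simp add: h_def mult_le_0_iff)
  then have "g 1 = 0" using g0[of 1] by simp
  then show ?thesis using i I by (simp add: g_def sum_nonneg_eq_0_iff)
qed

section \<open>Smooth right inverses and linear systems on a manifold\<close>

context smooth_mfd
begin

lemma open_nonzero:
  assumes "open N" "\<And>y. y \<in> N \<Longrightarrow> smooth_at M f y"
  shows "open {y \<in> N. f y \<noteq> 0}"
proof -
  have "open (N \<inter> f -` (- {0}))"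
    using assms smooth_at_continuous_on[of N f] by (intro continuous_open_preimage) auto
  moreover have "N \<inter> f -` (- {0}) = {y \<in> N. f y \<noteq> 0}" by auto
  ultimately show ?thesis by simp
qed

text \<open>A right inverse at the single point \<open>x\<close> is extended by induction on the
  rows. Column \<open>a\<close> of \<open>B\<close>, corrected by the inverse found for the earlier
  rows, annihilates those rows, and its product with row \<open>a\<close> is 1 at \<open>x\<close>,
  hence nonzero nearby. Dividing by this product gives the new column; subtracting multiples of it
  makes the old columns annihilate row \<open>a\<close>.\<close>

lemma smooth_right_inverse:
  assumes "finite I" "finite K" "open N" "x \<in> N"
    and E: "\<And>i k y. i \<in> I \<Longrightarrow> k \<in> K \<Longrightarrow> y \<in> N \<Longrightarrow> smooth_at M (E i k) y"
    and inv: "\<And>i j. i \<in> I \<Longrightarrow> j \<in> I \<Longrightarrow> (\<Sum>k\<in>K. E i k x * B k j) = (if i = j then 1 else 0)"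
  obtains N' S where "open N'" "x \<in> N'" "N' \<subseteq> N"
    "\<And>k j y. k \<in> K \<Longrightarrow> j \<in> I \<Longrightarrow> y \<in> N' \<Longrightarrow> smooth_at M (S k j) y"
    "\<And>i j y. i \<in> I \<Longrightarrow> j \<in> I \<Longrightarrow> y \<in> N' \<Longrightarrow> (\<Sum>k\<in>K. E i k y * S k j y) = (if i = j then 1 else 0)"
proof -
  have "\<exists>N' S. open N' \<and> x \<in> N' \<and> N' \<subseteq> N \<and>
    (\<forall>k\<in>K. \<forall>j\<in>I. \<forall>y\<in>N'. smooth_at M (S k j) y) \<and>
    (\<forall>i\<in>I. \<forall>j\<in>I. \<forall>y\<in>N'. (\<Sum>k\<in>K. E i k y * S k j y) = (if i = j then 1 else 0))"
    using \<open>finite I\<close> E inv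
  proof (induction I)
    case empty
    then show ?case using assms by auto
  next
    case (insert a I)
    obtain N1 S1 where N1: "open N1" "x \<in> N1" "N1 \<subseteq> N"
      "\<And>k j y. k \<in> K \<Longrightarrow> j \<in> I \<Longrightarrow> y \<in> N1 \<Longrightarrow> smooth_at M (S1 k j) y"
      "\<And>i j y. i \<in> I \<Longrightarrow> j \<in> I \<Longrightarrow> y \<in> N1 \<Longrightarrow> (\<Sum>k\<in>K. E i k y * S1 k j y) = (if i = j then 1 else 0)"
    proof -
      have "\<exists>N' S. open N' \<and> x \<in> N' \<and> N' \<subseteq> N \<and>
        (\<forall>k\<in>K. \<forall>j\<in>I. \<forall>y\<in>N'. smooth_at M (S k j) y) \<and>
        (\<forall>i\<in>I. \<forall>j\<in>I. \<forall>y\<in>N'. (\<Sum>k\<in>K. E i k y * S k j y) = (if i = j then 1 else 0))"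
        using insert.prems by (intro insert.IH) auto
      then obtain N1 S1 where "open N1 \<and> x \<in> N1 \<and> N1 \<subseteq> N \<and>
        (\<forall>k\<in>K. \<forall>j\<in>I. \<forall>y\<in>N1. smooth_at M (S1 k j) y) \<and>
        (\<forall>i\<in>I. \<forall>j\<in>I. \<forall>y\<in>N1. (\<Sum>k\<in>K. E i k y * S1 k j y) = (if i = j then 1 else 0))"
        by (elim exE)
      then show thesis by (intro that[of N1 S1]) auto
    qed
    define e where "e m y = (\<Sum>l\<in>K. E m l y * B l a)" for m y
    define b where "b k y = B k a - (\<Sum>m\<in>I. e m y * S1 k m y)" for k y
    define \<tau> where "\<tau> y = (\<Sum>k\<in>K. E a k y * b k y)" for y
    define N2 where "N2 = {y \<in> N1. \<tau> y \<noteq> 0}"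
    have E1: "smooth_at M (E i k) y" if "i \<in> insert a I" "k \<in> K" "y \<in> N1" for i k y
      using insert.prems(1) that N1(3) by blast
    have sb: "smooth_at M (b k) y" if "k \<in> K" "y \<in> N1" for k y
      unfolding b_def[abs_def] e_def using that
      by (intro smooth_at_diff smooth_at_const smooth_at_sum smooth_at_mult E1 N1(4)) auto
    have st: "smooth_at M \<tau> y" if "y \<in> N1" for y
      unfolding \<tau>_def[abs_def] using that by (intro smooth_at_sum smooth_at_mult E1 sb) auto
    have eb: "(\<Sum>k\<in>K. E i k y * b k y) = 0" if "i \<in> I" "y \<in> N1" for i y
    proof -
      have "(\<Sum>k\<in>K. E i k y * b k y) = e i y - (\<Sum>k\<in>K. \<Sum>m\<in>I. e m y * (E i k y * S1 k m y))"
        by (simp add: b_def e_def right_diff_distrib sum_subtractf sum_distrib_left mult_ac)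
      also have "(\<Sum>k\<in>K. \<Sum>m\<in>I. e m y * (E i k y * S1 k m y)) = (\<Sum>m\<in>I. e m y * (\<Sum>k\<in>K. E i k y * S1 k m y))"
        by (subst sum.swap) (simp add: sum_distrib_left)
      also have "\<dots> = (\<Sum>m\<in>I. if m = i then e m y else 0)"
        using that by (intro sum.cong) (auto simp: N1(5))
      finally show ?thesis using that insert.hyps by simp
    qed
    \<comment> \<open>At \<open>x\<close> the correction vanishes, because there column
      \<open>a\<close> of \<open>B\<close> is already annihilated by the rows in \<open>I\<close>;
      this is what makes \<open>\<tau> x\<close> equal to 1.\<close>
    have ex: "e m x = 0" if "m \<in> I" for m
      using insert.prems(2)[of m a] that insert.hyps by (auto simp: e_def)
    have "\<tau> x = (\<Sum>k\<in>K. E a k x * B k a)"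
      by (simp add: \<tau>_def b_def ex)
    then have tx: "\<tau> x = 1" using insert.prems(2)[of a a] by simp
    define S where "S k j y = (if j = a then b k y / \<tau> y
      else S1 k j y - (\<Sum>l\<in>K. E a l y * S1 l j y) * (b k y / \<tau> y))" for k j y
    have "open N2" unfolding N2_def by (rule open_nonzero[OF N1(1) st])
    moreover have "x \<in> N2" "N2 \<subseteq> N" using N1 tx by (auto simp: N2_def)
    moreover have "smooth_at M (S k j) y" if "k \<in> K" "j \<in> insert a I" "y \<in> N2" for k j y
    proof (cases "j = a")
      case True
      then show ?thesis unfolding S_def[abs_def] using that
        by (auto simp: N2_def intro!: smooth_at_divide sb st)
    next
      case False
      then show ?thesis unfolding S_def[abs_def] using that
        by (auto simp: N2_def intro!: smooth_at_divide smooth_at_diff smooth_at_mult smooth_at_sum sb st N1(4) E1)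
    qed
    moreover have "(\<Sum>k\<in>K. E i k y * S k j y) = (if i = j then 1 else 0)"
      if ij: "i \<in> insert a I" "j \<in> insert a I" and y: "y \<in> N2" for i j y
    proof -
      have y1: "y \<in> N1" "\<tau> y \<noteq> 0" using y by (auto simp: N2_def)
      have eS: "(\<Sum>k\<in>K. E i k y * (b k y / \<tau> y)) = (\<Sum>k\<in>K. E i k y * b k y) / \<tau> y" for i
        by (simp add: sum_divide_distrib)
      have A: "(\<Sum>k\<in>K. E i k y * (b k y / \<tau> y)) = (if i = a then 1 else 0)" if "i \<in> insert a I" for i
        using that eb[of i y] y1 unfolding eS by (auto simp flip: \<tau>_def)
      show ?thesis
      proof (cases "j = a")
        case True
        then show ?thesis using A[OF ij(1)] by (simp add: S_def)
      next
        case False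
        then have j: "j \<in> I" using ij by simp
        let ?r = "\<Sum>l\<in>K. E a l y * S1 l j y"
        have "(\<Sum>k\<in>K. E i k y * S k j y) = (\<Sum>k\<in>K. E i k y * S1 k j y) - (\<Sum>k\<in>K. ?r * (E i k y * (b k y / \<tau> y)))"
          using False by (simp add: S_def right_diff_distrib sum_subtractf mult_ac)
        also have "(\<Sum>k\<in>K. ?r * (E i k y * (b k y / \<tau> y))) = ?r * (if i = a then 1 else 0)"
          by (simp only: sum_distrib_left[symmetric] A[OF ij(1)])
        finally have *: "(\<Sum>k\<in>K. E i k y * S k j y) = (\<Sum>k\<in>K. E i k y * S1 k j y) - ?r * (if i = a then 1 else 0)" .
        show ?thesis
        proof (cases "i = a")
          case True
          then show ?thesis using * False by simp
        next
          case F: False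
          then have "i \<in> I" using ij by simp
          then show ?thesis using * F N1(5)[OF _ j y1(1)] by simp
        qed
      qed
    qed
    ultimately show ?case by (intro exI[of _ N2] exI[of _ S] conjI ballI)
  qed
  then obtain N' S where *: "open N' \<and> x \<in> N' \<and> N' \<subseteq> N \<and>
    (\<forall>k\<in>K. \<forall>j\<in>I. \<forall>y\<in>N'. smooth_at M (S k j) y) \<and>
    (\<forall>i\<in>I. \<forall>j\<in>I. \<forall>y\<in>N'. (\<Sum>k\<in>K. E i k y * S k j y) = (if i = j then 1 else 0))"
    by (elim exE)
  show ?thesis by (rule that[of N' S]) (use * in auto)
qed

text \<open>The columns \<open>T b\<close>, \<open>b \<in> B\<close>, are to be thought of as the coefficient matrix of a linear system and
  the columns \<open>T c\<close>, \<open>c \<in> J\<close>, as right hand sides. The equation reads \<open>dT = C T + T G\<close>.\<close>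

definition linear_pde ::
  "'m set \<Rightarrow> ('m \<Rightarrow> 'e) \<Rightarrow> 'm set \<Rightarrow> 'i set \<Rightarrow> 'c set \<Rightarrow> 'c set \<Rightarrow> ('i \<Rightarrow> 'c \<Rightarrow> 'm \<Rightarrow> real) \<Rightarrow> bool" where
  "linear_pde W \<phi> N I B J T \<longleftrightarrow> (\<forall>v\<in>model M. \<exists>C G.
      (\<forall>i\<in>I. \<forall>k\<in>I. continuous_on N (C i k)) \<and> (\<forall>b\<in>B. \<forall>c\<in>B \<union> J. continuous_on N (G b c)) \<and>
      (\<forall>y\<in>N. \<forall>i\<in>I. \<forall>c\<in>B \<union> J. dird W \<phi> v (T i c) y =
        (\<Sum>k\<in>I. C i k y * T k c y) + (\<Sum>b\<in>B. T i b y * G b c y)))"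

lemma linear_pdeE:
  assumes "linear_pde W \<phi> N I B J T" "v \<in> model M"
  obtains C G where "\<forall>i\<in>I. \<forall>k\<in>I. continuous_on N (C i k)" "\<forall>b\<in>B. \<forall>c\<in>B \<union> J. continuous_on N (G b c)"
    "\<forall>y\<in>N. \<forall>i\<in>I. \<forall>c\<in>B \<union> J. dird W \<phi> v (T i c) y =
      (\<Sum>k\<in>I. C i k y * T k c y) + (\<Sum>b\<in>B. T i b y * G b c y)"
  using bspec[OF assms(1)[unfolded linear_pde_def] assms(2)] by (elim exE conjE)

text \<open>The columns in \<open>P\<close> form a basis of the span of the columns in
  \<open>B\<close> at every point of \<open>N\<close>, with smooth coefficients \<open>s\<close>, so
  the rank is constant. The last clause turns solvability for a right-hand side at one point into a
  smooth solution on all of \<open>N\<close>, supported on \<open>P\<close>.\<close>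

definition pivoted ::
  "'m set \<Rightarrow> 'c set \<Rightarrow> ('c \<Rightarrow> 'c \<Rightarrow> 'm \<Rightarrow> real) \<Rightarrow> 'i set \<Rightarrow> 'c set \<Rightarrow> 'c set \<Rightarrow>
   ('i \<Rightarrow> 'c \<Rightarrow> 'm \<Rightarrow> real) \<Rightarrow> bool" where
  "pivoted N P s I B J T \<longleftrightarrow> P \<subseteq> B \<and>
    (\<forall>p\<in>P. \<forall>c\<in>B \<union> J. \<forall>y\<in>N. smooth_at M (s p c) y) \<and>
    (\<forall>y\<in>N. \<forall>c\<in>B. \<forall>i\<in>I. T i c y = (\<Sum>p\<in>P. s p c y * T i p y)) \<and>
    (\<forall>y\<in>N. \<forall>u. (\<forall>i\<in>I. (\<Sum>p\<in>P. u p * T i p y) = 0) \<longrightarrow> (\<forall>p\<in>P. u p = 0)) \<and>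
    (\<forall>c\<in>J. (\<exists>y\<in>N. \<exists>u. \<forall>i\<in>I. T i c y = (\<Sum>b\<in>B. u b * T i b y)) \<longrightarrow>
      (\<forall>y\<in>N. \<forall>i\<in>I. T i c y = (\<Sum>p\<in>P. s p c y * T i p y)))"

section \<open>Uniqueness and constant rank in a chart\<close>

context
  fixes W \<phi>
  assumes chart: "(W, \<phi>) \<in> charts M"
begin

lemma convex_chart_nhd:
  assumes "open N" "x \<in> N" "x \<in> W"
  obtains N' where "open N'" "x \<in> N'" "N' \<subseteq> N" "N' \<subseteq> W" "convex (\<phi> ` N')"
proof -
  obtain U where U: "open U" "\<phi> ` (N \<inter> W) = model M \<inter> U" using chart_image_open[OF chart assms(1)] .
  have "\<phi> x \<in> U" using U(2) assms by blast
  then obtain r where r: "r > 0" "ball (\<phi> x) r \<subseteq> U" using U(1) open_contains_ball by blast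
  define N' where "N' = W \<inter> \<phi> -` ball (\<phi> x) r"
  have sub: "N' \<subseteq> N"
  proof
    fix z assume z: "z \<in> N'"
    then have "\<phi> z \<in> \<phi> ` (N \<inter> W)" using U(2) r(2) chart_model[OF chart] by (auto simp: N'_def)
    then show "z \<in> N" using z chart_facts(2)[OF chart] by (auto simp: N'_def dest: inj_onD)
  qed
  have "\<phi> ` N' = model M \<inter> ball (\<phi> x) r"
  proof
    show "\<phi> ` N' \<subseteq> model M \<inter> ball (\<phi> x) r" using chart_model[OF chart] by (auto simp: N'_def)
    show "model M \<inter> ball (\<phi> x) r \<subseteq> \<phi> ` N'"
    proof
      fix z assume z: "z \<in> model M \<inter> ball (\<phi> x) r"
      then have "z \<in> \<phi> ` (N \<inter> W)" using U(2) r(2) by blast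
      then show "z \<in> \<phi> ` N'" using z by (auto simp: N'_def)
    qed
  qed
  then have "convex (\<phi> ` N')"
    using subspace_imp_convex[OF model_subspace] by (simp add: convex_Int)
  moreover have "open N'" unfolding N'_def by (rule chart_vimage_open[OF chart]) simp
  ultimately show ?thesis using that sub assms r by (auto simp: N'_def)
qed

text \<open>Along the coordinate segment from \<open>p\<close> to \<open>q\<close> the equation in
  the direction \<open>\<phi> q - \<phi> p\<close> is a linear ordinary differential equation with
  coefficients bounded by compactness, so zero initial values persist. The direction depends on the
  two points, hence the assumption for all \<open>v\<close>.\<close>

lemma linear_system_zero:
  fixes h :: "'i \<Rightarrow> 'm \<Rightarrow> real"
  assumes I: "finite I" and N: "open N" "N \<subseteq> W" "convex (\<phi> ` N)"
    and h: "\<And>i y. i \<in> I \<Longrightarrow> y \<in> N \<Longrightarrow> smooth_at M (h i) y"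
    and eq: "\<And>v. v \<in> model M \<Longrightarrow> \<exists>a. (\<forall>i\<in>I. \<forall>k\<in>I. continuous_on N (a i k)) \<and>
      (\<forall>i\<in>I. \<forall>y\<in>N. dird W \<phi> v (h i) y = (\<Sum>k\<in>I. a i k y * h k y))"
    and y: "p \<in> N" "q \<in> N" and z: "\<And>i. i \<in> I \<Longrightarrow> h i p = 0" and i: "i \<in> I"
  shows "h i q = 0"
proof -
  define v where "v = \<phi> q - \<phi> p"
  have pq: "\<phi> p \<in> model M" "\<phi> q \<in> model M" using y N(2) chart_model[OF chart] by auto
  then have v: "v \<in> model M" unfolding v_def by (simp add: subspace_diff[OF model_subspace])
  obtain a where a: "\<And>i k. i \<in> I \<Longrightarrow> k \<in> I \<Longrightarrow> continuous_on N (a i k)"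
    "\<And>i y. i \<in> I \<Longrightarrow> y \<in> N \<Longrightarrow> dird W \<phi> v (h i) y = (\<Sum>k\<in>I. a i k y * h k y)"
    using eq[OF v] by blast
  define \<gamma> where "\<gamma> t = inv_into W \<phi> (\<phi> p + t *\<^sub>R v)" for t
  have mem: "\<phi> p + t *\<^sub>R v \<in> \<phi> ` N" if "0 \<le> t" "t \<le> 1" for t
  proof -
    have "(1 - t) *\<^sub>R \<phi> p + t *\<^sub>R \<phi> q \<in> \<phi> ` N"
      using N(3) y that by (intro convexD) auto
    then show ?thesis by (simp add: v_def algebra_simps)
  qed
  have \<gamma>: "\<gamma> t \<in> N" "\<phi> (\<gamma> t) = \<phi> p + t *\<^sub>R v" if t: "0 \<le> t" "t \<le> 1" for t
  proof -
    obtain z where z: "z \<in> N" "\<phi> p + t *\<^sub>R v = \<phi> z" using mem[OF t] by blast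
    then have "\<gamma> t = z" using N(2) chart_inv[OF chart] by (auto simp: \<gamma>_def)
    then show "\<gamma> t \<in> N" "\<phi> (\<gamma> t) = \<phi> p + t *\<^sub>R v" using z by auto
  qed
  have c\<gamma>: "continuous_on {0..1} \<gamma>"
    unfolding \<gamma>_def[abs_def]
    by (rule continuous_on_compose2[OF chart_continuous(2)[OF chart]])
      (use mem image_mono[OF N(2), of \<phi>] in \<open>auto intro!: continuous_intros simp: subset_iff\<close>)
  have "\<exists>L. \<forall>t\<in>{0..1}. \<bar>a i k (\<gamma> t)\<bar> \<le> L" if "i \<in> I" "k \<in> I" for i k
  proof -
    have "continuous_on {0..1} (\<lambda>t. a i k (\<gamma> t))"
      by (rule continuous_on_compose2[OF a(1)[OF that] c\<gamma>]) (use \<gamma> in auto)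
    then have "bounded ((\<lambda>t. a i k (\<gamma> t)) ` {0..1})"
      by (intro compact_imp_bounded compact_continuous_image) auto
    then show ?thesis unfolding bounded_iff by auto
  qed
  then obtain L where L: "\<And>i k t. i \<in> I \<Longrightarrow> k \<in> I \<Longrightarrow> 0 \<le> t \<Longrightarrow> t \<le> 1 \<Longrightarrow> \<bar>a i k (\<gamma> t)\<bar> \<le> L i k"
    by (metis atLeastAtMost_iff)
  define K where "K = (\<Sum>i\<in>I. \<Sum>k\<in>I. \<bar>L i k\<bar>)"
  have K: "\<bar>a i k (\<gamma> t)\<bar> \<le> K" if "i \<in> I" "k \<in> I" "0 \<le> t" "t \<le> 1" for i k t
  proof -
    have "\<bar>a i k (\<gamma> t)\<bar> \<le> \<bar>L i k\<bar>" using L[OF that] by simp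
    also have "\<dots> \<le> (\<Sum>k\<in>I. \<bar>L i k\<bar>)" by (rule member_le_sum[OF that(2)]) (use I in auto)
    also have "\<dots> \<le> K" unfolding K_def by (rule member_le_sum[OF that(1)]) (use I in \<open>auto intro: sum_nonneg\<close>)
    finally show ?thesis .
  qed
  have "h i (\<gamma> 1) = 0"
  proof (rule linear_ode_zero[OF I, where f="\<lambda>i t. h i (\<gamma> t)" and f'="\<lambda>i t. dird W \<phi> v (h i) (\<gamma> t)" and K=K, OF _ _ _ i])
    fix i t assume i: "i \<in> I" and t: "(0::real) \<le> t" "t \<le> 1"
    show "((\<lambda>t. h i (\<gamma> t)) has_real_derivative dird W \<phi> v (h i) (\<gamma> t)) (at t)"
      using dird_along_line[OF chart _ \<gamma>(2)[OF t] h[OF i \<gamma>(1)[OF t]] v] \<gamma>(1)[OF t] N(2)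
      unfolding \<gamma>_def by blast
    have "\<bar>dird W \<phi> v (h i) (\<gamma> t)\<bar> \<le> (\<Sum>k\<in>I. \<bar>a i k (\<gamma> t) * h k (\<gamma> t)\<bar>)"
      unfolding a(2)[OF i \<gamma>(1)[OF t]] by (rule sum_abs)
    also have "\<dots> \<le> (\<Sum>k\<in>I. K * \<bar>h k (\<gamma> t)\<bar>)"
      using K i t by (intro sum_mono) (auto simp: abs_mult intro: mult_right_mono)
    finally show "\<bar>dird W \<phi> v (h i) (\<gamma> t)\<bar> \<le> K * (\<Sum>k\<in>I. \<bar>h k (\<gamma> t)\<bar>)"
      by (simp add: sum_distrib_left)
  next
    fix i assume i: "i \<in> I"
    have "\<gamma> 0 = p" using y N(2) chart_inv[OF chart] by (auto simp: \<gamma>_def)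
    then show "h i (\<gamma> 0) = 0" using z[OF i] by simp
  qed
  moreover have "\<gamma> 1 = q" using y N(2) chart_inv[OF chart] by (auto simp: \<gamma>_def v_def)
  ultimately show ?thesis by simp
qed

text \<open>The induction clears a column by Gaussian elimination with a pivot \<open>T a b\<close>: the remaining
  columns satisfy equations of the same form, and if there is no pivot all columns vanish nearby.\<close>

lemma constant_rank:
  fixes T :: "'i \<Rightarrow> 'c \<Rightarrow> 'm \<Rightarrow> real"
  assumes "finite I" "finite B" "B \<inter> J = {}" "open N" "x \<in> N" "N \<subseteq> W"
    "\<And>i c y. i \<in> I \<Longrightarrow> c \<in> B \<union> J \<Longrightarrow> y \<in> N \<Longrightarrow> smooth_at M (T i c) y"
    "linear_pde W \<phi> N I B J T"
  shows "\<exists>N' P s. open N' \<and> x \<in> N' \<and> N' \<subseteq> N \<and> pivoted N' P s I B J T"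
  using assms(2-)
proof (induction "card B" arbitrary: B T N rule: less_induct)
  case (less B T N)
  note fB = less.prems(1) and BJ = less.prems(2) and N = less.prems(3-5) and sT = less.prems(6) and eqT = less.prems(7)
  show ?case
  proof (cases "\<forall>i\<in>I. \<forall>b\<in>B. T i b x = 0")
    case True
    obtain N' where N': "open N'" "x \<in> N'" "N' \<subseteq> N" "N' \<subseteq> W" "convex (\<phi> ` N')"
      using convex_chart_nhd[OF N(1,2)] N(2,3) by blast
    have T0: "T i b y = 0" if i: "i \<in> I" and b: "b \<in> B" and y: "y \<in> N'" for i b y
    proof -
      let ?h = "\<lambda>(i, b). T i b"
      have "?h (i, b) y = 0"
      proof (rule linear_system_zero[where I="I \<times> B" and h="?h", OF _ N'(1,4,5) _ _ N'(2) y])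
        show "finite (I \<times> B)" using assms(1) fB by simp
        show "smooth_at M (?h ib) y" if "ib \<in> I \<times> B" "y \<in> N'" for ib y
          using that sT N'(3) by auto
        show "?h ib x = 0" if "ib \<in> I \<times> B" for ib using that True by auto
        show "(i, b) \<in> I \<times> B" using i b by simp
        fix v assume v: "v \<in> model M"
        obtain C G where CG: "\<forall>i\<in>I. \<forall>k\<in>I. continuous_on N (C i k)"
          "\<forall>b\<in>B. \<forall>c\<in>B \<union> J. continuous_on N (G b c)"
          "\<forall>y\<in>N. \<forall>i\<in>I. \<forall>c\<in>B \<union> J. dird W \<phi> v (T i c) y =
            (\<Sum>k\<in>I. C i k y * T k c y) + (\<Sum>b\<in>B. T i b y * G b c y)"
          by (rule linear_pdeE[OF eqT v])
        \<comment> \<open>All entries \<open>T i b\<close> together form one unknown vector indexed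
          by pairs: \<open>C\<close> acts on the row index and the transpose of \<open>G\<close> on
          the column index.\<close>
        define a where "a = (\<lambda>(i, b) (k, c) y. (if c = b then C i k y else 0) + (if k = i then G c b y else (0::real)))"
        have "continuous_on N' (a ib kc)" if "ib \<in> I \<times> B" "kc \<in> I \<times> B" for ib kc
        proof -
          obtain i b k c where [simp]: "ib = (i, b)" "kc = (k, c)" by (metis surj_pair)
          have "continuous_on N' (C i k)" "continuous_on N' (G c b)"
            using that CG by (auto intro!: continuous_on_subset[OF _ N'(3)])
          then show ?thesis unfolding a_def
            by (cases "c = b"; cases "k = i") (auto intro!: continuous_intros)
        qed
        moreover have "dird W \<phi> v (?h ib) y = (\<Sum>kc\<in>I \<times> B. a ib kc y * ?h kc y)"
          if ib: "ib \<in> I \<times> B" and y: "y \<in> N'" for ib y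
        proof -
          obtain i b where [simp]: "ib = (i, b)" by (metis surj_pair)
          have "(\<Sum>kc\<in>I \<times> B. a ib kc y * ?h kc y) = (\<Sum>k\<in>I. \<Sum>c\<in>B. a ib (k, c) y * T k c y)"
            by (subst sum.cartesian_product) (auto intro: sum.cong)
          also have "\<dots> = (\<Sum>k\<in>I. \<Sum>c\<in>B. (if c = b then C i k y * T k c y else 0) +
              (if k = i then G c b y * T k c y else 0))"
            by (intro sum.cong) (auto simp: a_def algebra_simps)
          also have "\<dots> = (\<Sum>k\<in>I. \<Sum>c\<in>B. if c = b then C i k y * T k c y else 0) +
              (\<Sum>c\<in>B. \<Sum>k\<in>I. if k = i then G c b y * T k c y else 0)"
            by (subst (3) sum.swap) (simp add: sum.distrib)
          also have "\<dots> = (\<Sum>k\<in>I. C i k y * T k b y) + (\<Sum>c\<in>B. T i c y * G c b y)"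
            using ib assms(1) fB by (simp add: mult.commute)
          finally show ?thesis using CG(3) ib y N'(3) by auto
        qed
        ultimately show "\<exists>a. (\<forall>ib\<in>I \<times> B. \<forall>kc\<in>I \<times> B. continuous_on N' (a ib kc)) \<and>
          (\<forall>ib\<in>I \<times> B. \<forall>y\<in>N'. dird W \<phi> v (?h ib) y = (\<Sum>kc\<in>I \<times> B. a ib kc y * ?h kc y))"
          by blast
      qed
      then show ?thesis by simp
    qed
    \<comment> \<open>With the columns in \<open>B\<close> zero, the term with \<open>G\<close>
      drops out and each right-hand side satisfies a homogeneous equation of its own; a solvable one
      is zero at some point of \<open>N'\<close> and hence throughout.\<close>
    have J0: "T i c y' = 0" if c: "c \<in> J" and y: "y \<in> N'" "\<forall>i\<in>I. T i c y = 0" and i: "i \<in> I" and y': "y' \<in> N'"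
      for i c y y'
    proof (rule linear_system_zero[where I=I and h="\<lambda>i. T i c", OF assms(1) N'(1,4,5) _ _ y(1) y' _ i])
      show "smooth_at M (T i c) y" if "i \<in> I" "y \<in> N'" for i y using that sT c N'(3) by auto
      show "T i c y = 0" if "i \<in> I" for i using that y by blast
      fix v assume v: "v \<in> model M"
      obtain C G where CG: "\<forall>i\<in>I. \<forall>k\<in>I. continuous_on N (C i k)"
          "\<forall>b\<in>B. \<forall>c\<in>B \<union> J. continuous_on N (G b c)"
          "\<forall>y\<in>N. \<forall>i\<in>I. \<forall>c\<in>B \<union> J. dird W \<phi> v (T i c) y =
            (\<Sum>k\<in>I. C i k y * T k c y) + (\<Sum>b\<in>B. T i b y * G b c y)"
        by (rule linear_pdeE[OF eqT v])
      have "dird W \<phi> v (T i c) y = (\<Sum>k\<in>I. C i k y * T k c y)" if "i \<in> I" "y \<in> N'" for i y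
        using CG(3) that N'(3) c T0 by auto
      then show "\<exists>a. (\<forall>i\<in>I. \<forall>k\<in>I. continuous_on N' (a i k)) \<and>
          (\<forall>i\<in>I. \<forall>y\<in>N'. dird W \<phi> v (T i c) y = (\<Sum>k\<in>I. a i k y * T k c y))"
        using CG(1) by (intro exI[of _ C]) (auto intro!: continuous_on_subset[OF _ N'(3)])
    qed
    show ?thesis
      unfolding pivoted_def
    proof (rule exI[of _ N'], rule exI[of _ "{}"], rule exI[of _ "\<lambda>_ _ _. 0"], intro conjI)
      show "\<forall>c\<in>J. (\<exists>y\<in>N'. \<exists>u. \<forall>i\<in>I. T i c y = (\<Sum>b\<in>B. u b * T i b y)) \<longrightarrow>
        (\<forall>y\<in>N'. \<forall>i\<in>I. T i c y = (\<Sum>p\<in>{}. 0 * T i p y))"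
      proof (intro ballI impI)
        fix c i y' assume c: "c \<in> J" "i \<in> I" "y' \<in> N'" "\<exists>y\<in>N'. \<exists>u. \<forall>i\<in>I. T i c y = (\<Sum>b\<in>B. u b * T i b y)"
        from c(4) obtain y u where y: "y \<in> N'" "\<forall>i\<in>I. T i c y = (\<Sum>b\<in>B. u b * T i b y)" by (elim bexE exE)
        have "\<forall>i\<in>I. T i c y = 0"
          using y(2) T0[OF _ _ y(1)] by simp
        from J0[OF c(1) y(1) this c(2,3)] show "T i c y' = (\<Sum>p\<in>{}. 0 * T i p y')" by simp
      qed
    qed (use N' T0 in auto)
  next
    case False
    then obtain a b where ab: "a \<in> I" "b \<in> B" "T a b x \<noteq> 0" by blast
    define \<tau> where "\<tau> = T a b"
    define N1 where "N1 = {y \<in> N. \<tau> y \<noteq> 0}"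
    define T' where "T' i c y = T i c y - T i b y * (T a c y / \<tau> y)" for i c y
    define B' where "B' = B - {b}"
    have N1: "open N1" "x \<in> N1" "N1 \<subseteq> W" "N1 \<subseteq> N"
      using N ab open_nonzero[OF N(1), of \<tau>] sT by (auto simp: N1_def \<tau>_def)
    have sT1: "smooth_at M (T i c) y" if "i \<in> I" "c \<in> B \<union> J" "y \<in> N1" for i c y
      using sT that N1(4) by blast
    have s\<tau>: "smooth_at M \<tau> y" if "y \<in> N1" for y using sT1[of a b y] ab that by (simp add: \<tau>_def)
    have \<tau>: "\<tau> y \<noteq> 0" if "y \<in> N1" for y using that by (simp add: N1_def)
    have cB: "card B' < card B" unfolding B'_def using fB ab(2) by (rule card_Diff1_less)
    have sT': "smooth_at M (T' i c) y" if "i \<in> I" "c \<in> B' \<union> J" "y \<in> N1" for i c y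
      unfolding T'_def[abs_def] using that ab
      by (intro smooth_at_diff smooth_at_mult smooth_at_divide sT1 s\<tau> \<tau>) (auto simp: B'_def)
    have T'b: "T' i b y = 0" if "y \<in> N1" for i y using \<tau>[OF that] by (simp add: T'_def \<tau>_def)
    have sumB': "(\<Sum>d\<in>B'. T' i d y * g d) = (\<Sum>d\<in>B. T' i d y * g d)" if "y \<in> N1" for i y g
      unfolding B'_def using T'b[OF that] fB by (intro sum.mono_neutral_left) auto
    have "\<exists>N' P s. open N' \<and> x \<in> N' \<and> N' \<subseteq> N1 \<and> pivoted N' P s I B' J T'"
    proof (rule less.hyps[OF cB _ _ N1(1-3) sT'])
      show "finite B'" "B' \<inter> J = {}" using fB BJ by (auto simp: B'_def)
      show "linear_pde W \<phi> N1 I B' J T'"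
        unfolding linear_pde_def
      proof
        fix v assume v: "v \<in> model M"
        obtain C G where CG: "\<forall>i\<in>I. \<forall>k\<in>I. continuous_on N (C i k)"
            "\<forall>b\<in>B. \<forall>c\<in>B \<union> J. continuous_on N (G b c)"
            "\<forall>y\<in>N. \<forall>i\<in>I. \<forall>c\<in>B \<union> J. dird W \<phi> v (T i c) y =
              (\<Sum>k\<in>I. C i k y * T k c y) + (\<Sum>b\<in>B. T i b y * G b c y)"
          by (rule linear_pdeE[OF eqT v])
        \<comment> \<open>Differentiating the quotient \<open>T a c / \<tau>\<close> brings in row
          \<open>a\<close> of the original equation. Sorting the terms changes \<open>C\<close> by a
          multiple of its row \<open>a\<close> and \<open>G\<close> by a multiple of its column
          \<open>b\<close>, while the summand for column \<open>b\<close> disappears because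
          \<open>T' i b\<close> is zero.\<close>
        define C' where "C' i k y = C i k y - T i b y * (C a k y / \<tau> y)" for i k y
        define G' where "G' d c y = G d c y - G d b y * (T a c y / \<tau> y)" for d c y
        have cT: "continuous_on N1 (T i c)" if "i \<in> I" "c \<in> B \<union> J" for i c
          using sT1 that by (intro smooth_at_continuous_on) auto
        have c\<tau>: "continuous_on N1 \<tau>" using s\<tau> by (intro smooth_at_continuous_on) auto
        have "continuous_on N1 (C' i k)" if "i \<in> I" "k \<in> I" for i k
        proof -
          have "continuous_on N1 (C i k)" "continuous_on N1 (C a k)"
            using CG(1) that ab by (auto intro!: continuous_on_subset[OF _ N1(4)])
          then show ?thesis unfolding C'_def[abs_def] using that ab \<tau>
            by (intro continuous_intros cT c\<tau>) auto
        qed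
        moreover have "continuous_on N1 (G' d c)" if "d \<in> B'" "c \<in> B' \<union> J" for d c
        proof -
          have "continuous_on N1 (G d c)" "continuous_on N1 (G d b)"
            using CG(2) that ab by (auto simp: B'_def intro!: continuous_on_subset[OF _ N1(4)])
          then show ?thesis unfolding G'_def[abs_def] using that ab \<tau>
            by (intro continuous_intros cT c\<tau>) (auto simp: B'_def)
        qed
        moreover have "dird W \<phi> v (T' i c) y = (\<Sum>k\<in>I. C' i k y * T' k c y) + (\<Sum>d\<in>B'. T' i d y * G' d c y)"
          if y: "y \<in> N1" and i: "i \<in> I" and c: "c \<in> B' \<union> J" for i c y
        proof -
          have c': "c \<in> B \<union> J" and b': "b \<in> B \<union> J" using c ab by (auto simp: B'_def)
          have yW: "y \<in> W" "y \<in> N" using y N1 by auto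
          define Pf where "Pf i c = (\<Sum>k\<in>I. C i k y * T k c y)" for i c
          define Q where "Q i c = (\<Sum>d\<in>B. T i d y * G d c y)" for i c
          define r where "r = T a c y / \<tau> y"
          define t where "t = T i b y / \<tau> y"
          have D: "dird W \<phi> v (T i c) y = Pf i c + Q i c" if "i \<in> I" "c \<in> B \<union> J" for i c
            using CG(3) yW that by (simp add: Pf_def Q_def)
          have P1: "(\<Sum>k\<in>I. C i k y * T' k c y) = Pf i c - r * Pf i b" for i
            by (simp add: Pf_def T'_def r_def right_diff_distrib sum_subtractf sum_distrib_left sum_divide_distrib mult_ac)
          have Q1: "(\<Sum>d\<in>B. T i d y * G' d c y) = Q i c - r * Q i b" for i
            by (simp add: Q_def G'_def r_def right_diff_distrib sum_subtractf sum_distrib_left sum_divide_distrib mult_ac)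
          have R1: "(\<Sum>k\<in>I. C' i k y * T' k c y) = (Pf i c - r * Pf i b) - t * (Pf a c - r * Pf a b)"
            unfolding P1[symmetric]
            by (simp add: C'_def t_def left_diff_distrib right_diff_distrib sum_subtractf sum_distrib_left mult_ac)
          have R2: "(\<Sum>d\<in>B'. T' i d y * G' d c y) = (Q i c - r * Q i b) - t * (Q a c - r * Q a b)"
            unfolding sumB'[OF y] Q1[symmetric]
            by (simp add: T'_def t_def left_diff_distrib right_diff_distrib sum_subtractf sum_distrib_left mult_ac)
          have s: "smooth_at M (T i c) y" "smooth_at M (T i b) y" "smooth_at M (T a c) y" "smooth_at M \<tau> y"
            using sT1 i c' b' ab y s\<tau> by auto
          have sd: "smooth_at M (\<lambda>y. T a c y / \<tau> y) y" by (intro smooth_at_divide s \<tau> y)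
          have "dird W \<phi> v (T' i c) y = dird W \<phi> v (T i c) y - (dird W \<phi> v (T i b) y * (T a c y / \<tau> y) +
              T i b y * ((dird W \<phi> v (T a c) y * \<tau> y - T a c y * dird W \<phi> v \<tau> y) / (\<tau> y * \<tau> y)))"
            unfolding T'_def[abs_def]
            using dird_diff[OF chart s(1) smooth_at_mult[OF s(2) sd] yW(1) v]
              dird_mult[OF chart s(2) sd yW(1) v] dird_divide[OF chart s(3,4) yW(1) v \<tau>[OF y]]
            by simp
          also have "\<dots> = (Pf i c + Q i c) - ((Pf i b + Q i b) * r + t * ((Pf a c + Q a c) - r * (Pf a b + Q a b)))"
            using \<tau>[OF y] D i c' b' ab unfolding \<tau>_def[symmetric] r_def t_def
            by (simp add: \<tau>_def[symmetric] D[OF ab(1), of b, folded \<tau>_def] field_simps)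
          also have "\<dots> = (\<Sum>k\<in>I. C' i k y * T' k c y) + (\<Sum>d\<in>B'. T' i d y * G' d c y)"
            unfolding R1 R2 by (simp add: algebra_simps)
          finally show ?thesis .
        qed
        ultimately show "\<exists>C G. (\<forall>i\<in>I. \<forall>k\<in>I. continuous_on N1 (C i k)) \<and>
            (\<forall>b\<in>B'. \<forall>c\<in>B' \<union> J. continuous_on N1 (G b c)) \<and>
            (\<forall>y\<in>N1. \<forall>i\<in>I. \<forall>c\<in>B' \<union> J. dird W \<phi> v (T' i c) y =
              (\<Sum>k\<in>I. C i k y * T' k c y) + (\<Sum>b\<in>B'. T' i b y * G b c y))"
          by (intro exI[of _ C'] exI[of _ G'] conjI ballI)
      qed
    qed
    then obtain N' P' s' where IH: "open N'" "x \<in> N'" "N' \<subseteq> N1" "P' \<subseteq> B'"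
      "\<forall>p\<in>P'. \<forall>c\<in>B' \<union> J. \<forall>y\<in>N'. smooth_at M (s' p c) y"
      "\<forall>y\<in>N'. \<forall>c\<in>B'. \<forall>i\<in>I. T' i c y = (\<Sum>p\<in>P'. s' p c y * T' i p y)"
      "\<forall>y\<in>N'. \<forall>u. (\<forall>i\<in>I. (\<Sum>p\<in>P'. u p * T' i p y) = 0) \<longrightarrow> (\<forall>p\<in>P'. u p = 0)"
      "\<forall>c\<in>J. (\<exists>y\<in>N'. \<exists>u. \<forall>i\<in>I. T' i c y = (\<Sum>b\<in>B'. u b * T' i b y)) \<longrightarrow>
        (\<forall>y\<in>N'. \<forall>i\<in>I. T' i c y = (\<Sum>p\<in>P'. s' p c y * T' i p y))"
      unfolding pivoted_def by (elim exE conjE)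
    have fP': "finite P'" "b \<notin> P'" using IH(4) fB by (auto simp: B'_def intro: finite_subset)
    define P where "P = insert b P'"
    \<comment> \<open>Rewriting a relation between columns of \<open>T'\<close> in terms of
      \<open>T\<close> collects multiples of column \<open>b\<close>; their total is the coefficient
      of the new pivot \<open>b\<close>.\<close>
    define s where "s p c y = (if c = b then (if p = b then 1 else 0)
      else if p = b then T a c y / \<tau> y - (\<Sum>q\<in>P'. s' q c y * (T a q y / \<tau> y)) else s' p c y)" for p c y
    have expand: "T i c y = (\<Sum>p\<in>P. s p c y * T i p y)"
      if "T' i c y = (\<Sum>p\<in>P'. s' p c y * T' i p y)" "c \<noteq> b" for i c y
    proof -
      have "(\<Sum>p\<in>P'. s p c y * T i p y) = (\<Sum>p\<in>P'. s' p c y * T i p y)"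
        using fP'(2) that(2) by (intro sum.cong) (auto simp: s_def)
      then have "(\<Sum>p\<in>P. s p c y * T i p y) =
          (T a c y / \<tau> y - (\<Sum>q\<in>P'. s' q c y * (T a q y / \<tau> y))) * T i b y + (\<Sum>p\<in>P'. s' p c y * T i p y)"
        using fP' that(2) by (simp add: P_def s_def)
      moreover have "(\<Sum>p\<in>P'. s' p c y * T' i p y) =
          (\<Sum>p\<in>P'. s' p c y * T i p y) - (\<Sum>q\<in>P'. s' q c y * (T a q y / \<tau> y)) * T i b y"
        by (simp add: T'_def right_diff_distrib sum_subtractf sum_distrib_left sum_distrib_right mult_ac)
      ultimately show ?thesis using that(1) by (simp add: T'_def algebra_simps)
    qed
    have "\<forall>p\<in>P. \<forall>c\<in>B \<union> J. \<forall>y\<in>N'. smooth_at M (s p c) y"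
    proof (intro ballI)
      fix p c y assume p: "p \<in> P" "c \<in> B \<union> J" "y \<in> N'"
      have y1: "y \<in> N1" using p IH(3) by blast
      have c': "c \<in> B' \<union> J" if "c \<noteq> b" using p that by (auto simp: B'_def)
      consider "c = b" | "c \<noteq> b" "p = b" | "c \<noteq> b" "p \<noteq> b" by blast
      then show "smooth_at M (s p c) y"
      proof cases
        case 1
        then show ?thesis unfolding s_def[abs_def] by simp
      next
        case 2
        have "q \<in> B \<union> J" if "q \<in> P'" for q using that IH(4) by (auto simp: B'_def)
        then have "smooth_at M (\<lambda>y. T a c y / \<tau> y - (\<Sum>q\<in>P'. s' q c y * (T a q y / \<tau> y))) y"
          using IH(5) c'[OF 2(1)] p ab y1
          by (intro smooth_at_diff smooth_at_sum smooth_at_mult smooth_at_divide sT1 s\<tau> \<tau>) auto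
        then show ?thesis unfolding s_def[abs_def] using 2 by simp
      next
        case 3
        then show ?thesis unfolding s_def[abs_def] using IH(5) c' p by (simp add: P_def)
      qed
    qed
    moreover have "\<forall>y\<in>N'. \<forall>c\<in>B. \<forall>i\<in>I. T i c y = (\<Sum>p\<in>P. s p c y * T i p y)"
    proof (intro ballI)
      fix y c i assume p: "y \<in> N'" "c \<in> B" "i \<in> I"
      show "T i c y = (\<Sum>p\<in>P. s p c y * T i p y)"
      proof (cases "c = b")
        case True
        have "(\<Sum>p\<in>P'. s p b y * T i p y) = 0"
          using fP'(2) by (intro sum.neutral) (auto simp: s_def)
        then show ?thesis using fP' True by (simp add: P_def s_def)
      next
        case False
        then show ?thesis using IH(6) p by (intro expand) (auto simp: B'_def)
      qed
    qed
    moreover have "\<forall>y\<in>N'. \<forall>u. (\<forall>i\<in>I. (\<Sum>p\<in>P. u p * T i p y) = 0) \<longrightarrow> (\<forall>p\<in>P. u p = 0)"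
    proof (intro ballI allI impI)
      fix y u p assume y: "y \<in> N'" and u: "\<forall>i\<in>I. (\<Sum>p\<in>P. u p * T i p y) = 0" and p: "p \<in> P"
      have t: "\<tau> y \<noteq> 0" using y IH(3) \<tau> by blast
      have u': "u b * T i b y + (\<Sum>p\<in>P'. u p * T i p y) = 0" if "i \<in> I" for i
        using u that fP' by (simp add: P_def)
      have ub: "u b = - (\<Sum>p\<in>P'. u p * T a p y) / \<tau> y"
        using u'[OF ab(1)] t unfolding \<tau>_def by (simp add: field_simps)
      have "(\<Sum>p\<in>P'. u p * T' i p y) = 0" if "i \<in> I" for i
      proof -
        have "(\<Sum>p\<in>P'. u p * T' i p y) = (\<Sum>p\<in>P'. u p * T i p y) - (\<Sum>p\<in>P'. u p * T a p y) / \<tau> y * T i b y"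
          by (simp add: T'_def right_diff_distrib sum_subtractf sum_distrib_left sum_distrib_right sum_divide_distrib mult_ac)
        also have "\<dots> = (\<Sum>p\<in>P'. u p * T i p y) + u b * T i b y" using ub by simp
        finally show ?thesis using u'[OF that] by simp
      qed
      then have z: "\<forall>p\<in>P'. u p = 0" using IH(7) y by blast
      then have "u b = 0" using ub by simp
      then show "u p = 0" using z p by (auto simp: P_def)
    qed
    moreover have "\<forall>c\<in>J. (\<exists>y\<in>N'. \<exists>u. \<forall>i\<in>I. T i c y = (\<Sum>b\<in>B. u b * T i b y)) \<longrightarrow>
      (\<forall>y\<in>N'. \<forall>i\<in>I. T i c y = (\<Sum>p\<in>P. s p c y * T i p y))"
    proof (intro ballI impI)
      fix c y' i assume c: "c \<in> J" and ex: "\<exists>y\<in>N'. \<exists>u. \<forall>i\<in>I. T i c y = (\<Sum>b\<in>B. u b * T i b y)"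
        and i: "i \<in> I" and y': "y' \<in> N'"
      from ex obtain y u where y: "y \<in> N'" "\<forall>i\<in>I. T i c y = (\<Sum>b\<in>B. u b * T i b y)" by (elim bexE exE)
      have y1: "y \<in> N1" using y IH(3) by blast
      have "T' i c y = (\<Sum>b\<in>B'. u b * T' i b y)" if "i \<in> I" for i
      proof -
        have "(\<Sum>d\<in>B'. u d * T' i d y) = (\<Sum>d\<in>B. u d * T' i d y)"
          using sumB'[OF y1, of i u] by (simp add: mult.commute)
        also have "\<dots> = (\<Sum>d\<in>B. u d * T i d y) - T i b y * ((\<Sum>d\<in>B. u d * T a d y) / \<tau> y)"
          by (simp add: T'_def right_diff_distrib sum_subtractf sum_distrib_left sum_distrib_right sum_divide_distrib mult_ac)
        also have "\<dots> = T' i c y" using y(2) that ab(1) by (simp add: T'_def)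
        finally show ?thesis by simp
      qed
      then have "\<forall>y\<in>N'. \<forall>i\<in>I. T' i c y = (\<Sum>p\<in>P'. s' p c y * T' i p y)"
        using IH(8) c y(1) by blast
      moreover have "c \<noteq> b" using c ab BJ by blast
      ultimately show "T i c y' = (\<Sum>p\<in>P. s p c y' * T i p y')" using y' i by (intro expand) auto
    qed
    moreover have "P \<subseteq> B" "N' \<subseteq> N" using IH(3,4) ab N1(4) by (auto simp: P_def B'_def)
    ultimately show ?thesis using IH(1,2) unfolding pivoted_def
      by (intro exI[of _ N'] exI[of _ P] exI[of _ s] conjI)
  qed
qed

end

end

section \<open>Tangent vectors\<close>

lemma sum_fun_apply: "(\<Sum>i\<in>I. f i) x = (\<Sum>i\<in>I. f i x)"
  by (induction I rule: infinite_finite_induct) (auto simp: zero_fun_def plus_fun_def)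

lemma scaleR_fun_apply: "(r *\<^sub>R f) x = r *\<^sub>R f x"
  by (simp add: scaleR_fun_def)

context smooth_mfd
begin

lemma tangent_spaceD:
  assumes "X \<in> tangent_space M y" "f \<in> smooth_funs M"
  shows "g \<in> smooth_funs M \<Longrightarrow> X (\<lambda>z. f z + g z) = X f + X g" "X (\<lambda>z. r * f z) = r * X f"
    "g \<in> smooth_funs M \<Longrightarrow> X (\<lambda>z. f z * g z) = X f * g y + f y * X g"
  using assms unfolding tangent_space_def by blast+

lemma subspace_tangent_space: "subspace (tangent_space M y)"
  unfolding subspace_def tangent_space_def
  by (auto simp: zero_fun_def plus_fun_def scaleR_fun_def algebra_simps)

lemma coord_field_smooth: "f \<in> smooth_funs M \<Longrightarrow> coord_field M W \<phi> v y f = dird W \<phi> v f y"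
  by (simp add: coord_field_def dird_def)

context
  fixes W \<phi>
  assumes chart: "(W, \<phi>) \<in> charts M"
begin

lemma coord_field_tangent:
  assumes "y \<in> W" "v \<in> model M"
  shows "coord_field M W \<phi> v y \<in> tangent_space M y"
proof -
  let ?D = "coord_field M W \<phi> v y"
  have c: "?D f = dird W \<phi> v f y" if "\<forall>y. smooth_at M f y" for f
    using that by (intro coord_field_smooth) (simp add: smooth_funs_iff)
  have "?D (\<lambda>y. f y + g y) = ?D f + ?D g" "?D (\<lambda>y. f y * g y) = ?D f * g y + f y * ?D g"
    if "f \<in> smooth_funs M" "g \<in> smooth_funs M" for f g
    using that unfolding smooth_funs_iff
    by (simp_all add: c smooth_at_add smooth_at_mult dird_add[OF chart _ _ assms] dird_mult[OF chart _ _ assms])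
  moreover have "?D (\<lambda>y. r * f y) = r * ?D f" if "f \<in> smooth_funs M" for f r
    using that unfolding smooth_funs_iff
    by (simp add: c smooth_at_mult dird_mult[OF chart _ _ assms] dird_const[OF chart])
  moreover have "?D f = 0" if "f \<notin> smooth_funs M" for f
    using that by (simp add: coord_field_def)
  ultimately show ?thesis unfolding tangent_space_def by simp
qed

lemma coord_field_sum:
  assumes "y \<in> W" "\<And>j. j < d \<Longrightarrow> b j \<in> model M"
  shows "coord_field M W \<phi> (\<Sum>j<d. c j *\<^sub>R b j) y = (\<Sum>j<d. c j *\<^sub>R coord_field M W \<phi> (b j) y)"
proof
  fix f
  have v: "(\<Sum>j<d. c j *\<^sub>R b j) \<in> model M"
    using assms(2) by (intro subspace_sum subspace_scale model_subspace) auto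
  show "coord_field M W \<phi> (\<Sum>j<d. c j *\<^sub>R b j) y f = (\<Sum>j<d. c j *\<^sub>R coord_field M W \<phi> (b j) y) f"
  proof (cases "f \<in> smooth_funs M")
    case True
    then have "smooth_at M f y" by (simp add: smooth_funs_iff)
    then obtain L where L: "linear L" "\<And>v. v \<in> model M \<Longrightarrow> dird W \<phi> v f y = L v"
      using dird_linear[OF chart _ assms(1)] by blast
    show ?thesis
      using True v assms(2) L
      by (simp add: coord_field_smooth sum_fun_apply scaleR_fun_apply linear_sum linear_scale)
  next
    case False
    then show ?thesis by (simp add: coord_field_def sum_fun_apply scaleR_fun_apply)
  qed
qed

lemma coord_field_zero: "coord_field M W \<phi> 0 y = 0"
  using dird_const[OF chart] by (auto simp: coord_field_def fun_eq_iff)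

text \<open>The test function is the coordinate function \<open>h\<close>, the inner product of
  \<open>\<phi>\<close> with \<open>v\<close>: its derivative in direction \<open>v\<close> is the
  squared norm of \<open>v\<close>. A cut-off makes it global without changing this derivative at
  \<open>y\<close>.\<close>

lemma coord_field_eq_0_imp:
  assumes y: "y \<in> W" and v: "v \<in> model M" and 0: "coord_field M W \<phi> v y = 0"
  shows "v = 0"
proof -
  define h where "h p = \<phi> p \<bullet> v" for p
  have h: "smooth_at M h p" if "p \<in> W" for p
    by (rule smooth_atI[OF chart that open_UNIV UNIV_I, of "\<lambda>z. z \<bullet> v"])
      (auto simp: h_def f_inv_into_f intro!: smooth_open_bounded_linear bounded_linear_inner_left)
  obtain g N where g: "g \<in> smooth_funs M" "open N" "y \<in> N" "N \<subseteq> W" "\<And>z. z \<in> N \<Longrightarrow> g z = h z"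
    using globalize_fun[OF chart_facts(1)[OF chart] y, of h] h by metis
  obtain U where U: "open U" "\<phi> ` (UNIV \<inter> W) = model M \<inter> U"
    using chart_image_open[OF chart open_UNIV] .
  have "dird W \<phi> v h y = v \<bullet> v"
  proof (rule dird_eqI[OF chart], rule has_field_derivative_transform_within_open)
    show "((\<lambda>t. (\<phi> y + t *\<^sub>R v) \<bullet> v) has_real_derivative v \<bullet> v) (at 0)"
      by (auto intro!: derivative_eq_intros simp: inner_add_left)
    show "open ((\<lambda>t. \<phi> y + t *\<^sub>R v) -` U)"
      using U(1) by (intro continuous_open_vimage continuous_intros) auto
    show "0 \<in> (\<lambda>t. \<phi> y + t *\<^sub>R v) -` U" using U(2) y by auto
    fix t assume t: "t \<in> (\<lambda>t. \<phi> y + t *\<^sub>R v) -` U"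
    have "\<phi> y + t *\<^sub>R v \<in> model M"
      using v chart_model[OF chart y] model_subspace by (simp add: subspace_add subspace_scale)
    then have "\<phi> y + t *\<^sub>R v \<in> \<phi> ` W" using U(2) t by auto
    then show "(\<phi> y + t *\<^sub>R v) \<bullet> v = h (inv_into W \<phi> (\<phi> y + t *\<^sub>R v))"
      by (simp add: h_def f_inv_into_f)
  qed
  moreover have "dird W \<phi> v g y = dird W \<phi> v h y"
    using g by (intro dird_cong[OF chart _ y v g(2,3)]) (auto simp: smooth_funs_iff)
  ultimately have "v \<bullet> v = coord_field M W \<phi> v y g" using coord_field_smooth[OF g(1)] by simp
  then show ?thesis using 0 by simp
qed

end

lemma model_basis:
  obtains bs where "is_basis_list bs (model M)"
proof -
  obtain B where B: "B \<subseteq> model M" "independent B" "model M \<subseteq> span B"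
    using basis_exists[of "model M"] by metis
  have "finite B" using B(2) by (rule independent_imp_finite)
  then obtain bs where "set bs = B" "distinct bs" using finite_distinct_list by blast
  moreover have "span B = model M" using B model_subspace by (simp add: span_subspace)
  ultimately show ?thesis using B by (intro that[of bs]) (simp add: is_basis_list_def)
qed

lemma framed_coef_smooth:
  assumes "framed E" "(U, es) \<in> frames E" "y \<in> U" "sec_at M E s y" "i < length es"
  shows "smooth_at M (\<lambda>z. bcoef (length es) (\<lambda>i. (es ! i) z) (s z) i) y"
proof -
  obtain c N where c: "\<forall>i<length es. smooth_at M (c i) y" "open N" "y \<in> N"
    "\<forall>z\<in>N. s z = (\<Sum>i<length es. c i z *\<^sub>R (es ! i) z)"
    using assms(2-4) unfolding sec_at_def by blast
  have "c i z = bcoef (length es) (\<lambda>i. (es ! i) z) (s z) i" if "z \<in> U \<inter> N" for z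
    using that c(4) assms(5)
      bcoef_eq[OF framedD(3)[OF assms(1,2)] framedD(1)[OF assms(1)] assms(5), of z "\<lambda>i. c i z"]
    by simp
  then show ?thesis
    by (intro smooth_at_cong[OF c(1)[rule_format, OF assms(5)], of "U \<inter> N"])
      (use framedD(2)[OF assms(1,2)] c(2,3) assms(3) in auto)
qed

subsection \<open>Bundle maps\<close>

lemma bundle_map_sum:
  fixes n :: nat
  assumes "bundle_map M E F \<Phi>" "subspace (fib E z)" "\<And>i. i < n \<Longrightarrow> e i \<in> fib E z"
  shows "\<Phi> z (\<Sum>i<n. c i *\<^sub>R e i) = (\<Sum>i<n. c i *\<^sub>R \<Phi> z (e i))"
  using assms(3)
proof (induction n)
  case 0
  have "\<Phi> z (0 *\<^sub>R 0) = 0 *\<^sub>R \<Phi> z 0"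
    using assms(1) subspace_0[OF assms(2)] unfolding bundle_map_def by blast
  then show ?case by simp
next
  case (Suc n)
  have "(\<Sum>i<n. c i *\<^sub>R e i) \<in> fib E z" "c n *\<^sub>R e n \<in> fib E z"
    using Suc.prems by (auto intro!: subspace_sum subspace_scale assms(2))
  then have "\<Phi> z ((\<Sum>i<n. c i *\<^sub>R e i) + c n *\<^sub>R e n) = \<Phi> z (\<Sum>i<n. c i *\<^sub>R e i) + \<Phi> z (c n *\<^sub>R e n)"
    using assms(1) unfolding bundle_map_def by blast
  moreover have "\<Phi> z (c n *\<^sub>R e n) = c n *\<^sub>R \<Phi> z (e n)"
    using assms(1) Suc.prems[of n] unfolding bundle_map_def by blast
  ultimately show ?case using Suc by simp
qed

lemma bundle_map_in: "bundle_map M E F \<Phi> \<Longrightarrow> u \<in> fib E z \<Longrightarrow> \<Phi> z u \<in> fib F z"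
  by (simp add: bundle_map_def)

lemma bundle_map_sec_at:
  assumes \<Phi>: "bundle_map M E F \<Phi>" and E: "framed E" and F: "framed F"
    and U: "(U, es) \<in> frames E" "y \<in> U" and s: "sec_at M E s y"
  shows "sec_at M F (\<lambda>z. \<Phi> z (s z)) y"
proof -
  let ?n = "length es"
  obtain c N where c: "\<forall>i<?n. smooth_at M (c i) y" "open N" "y \<in> N"
    "\<forall>z\<in>N. s z = (\<Sum>i<?n. c i z *\<^sub>R (es ! i) z)"
    using s U unfolding sec_at_def by blast
  have e: "sec_at M F (\<lambda>z. \<Phi> z ((es ! i) z)) y" if "i < ?n" for i
  proof -
    have "smooth_section_on M F U (\<lambda>z. \<Phi> z ((es ! i) z))"
      using \<Phi> U(1) nth_mem[OF that] unfolding bundle_map_def by blast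
    then show ?thesis using smooth_section_on_iff[OF F framedD(2)[OF E U(1)]] U(2) by blast
  qed
  have "sec_at M F (\<lambda>z. \<Sum>i<?n. c i z *\<^sub>R \<Phi> z ((es ! i) z)) y"
    using c(1) e by (intro sec_at_sum sec_at_scale) auto
  then show ?thesis
  proof (rule sec_at_cong)
    show "open (U \<inter> N)" "y \<in> U \<inter> N" using framedD(2)[OF E U(1)] c U by auto
    fix z assume z: "z \<in> U \<inter> N"
    then have "(es ! i) z \<in> fib E z" if "i < ?n" for i
      using framedD(3)[OF E U(1), of z] that by (simp add: basis_fam_def)
    from bundle_map_sum[OF \<Phi> framedD(1)[OF E] this, where c="\<lambda>i. c i z"]
    show "(\<Sum>i<?n. c i z *\<^sub>R \<Phi> z ((es ! i) z)) = \<Phi> z (s z)" using c(4) z by simp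
  qed
qed

end

section \<open>Transitive Lie algebroids and their representations\<close>

locale algebroid_rep = smooth_mfd M
  for M :: "('m::{t2_space, second_countable_topology}, 'e::euclidean_space) manifold" +
  fixes A :: "('m, 'a::real_vector) lie_algebroid"
    and F :: "('m, 'f::real_vector) vbundle"
    and R :: "'m \<Rightarrow> 'a \<Rightarrow> ('m \<Rightarrow> 'f) \<Rightarrow> 'f"
  assumes algebroid: "lie_algebroid M A" and transitive: "transitive_algebroid M A"
    and bundle_F: "vector_bundle M F" and rep: "lie_representation M A F R"
begin

sublocale A: vbun M A
  by unfold_locales (use algebroid in \<open>simp add: lie_algebroid_def\<close>)

sublocale F: vbun M F
  by unfold_locales (rule bundle_F)

abbreviation "TM \<equiv> tangent_algebroid M"
abbreviation "\<rho> \<equiv> anchor A"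
abbreviation "L \<equiv> adjoint_fib A"

lemma TM_simps: "fib TM y = tangent_space M y" "anchor TM y X = X"
    "(U, es) \<in> frames TM \<longleftrightarrow> (\<exists>\<phi> bs. (U, \<phi>) \<in> charts M \<and> is_basis_list bs (model M) \<and>
      es = map (coord_field M U \<phi>) bs)"
  by (auto simp: tangent_algebroid_def)

lemma anchor_map: "bundle_map M A TM \<rho>"
  using algebroid by (simp add: lie_algebroid_def)

lemma anchor_surj: "\<rho> y ` fib A y = tangent_space M y"
  using transitive by (simp add: transitive_algebroid_def)

lemma anchor_add: "u \<in> fib A y \<Longrightarrow> v \<in> fib A y \<Longrightarrow> \<rho> y (u + v) = \<rho> y u + \<rho> y v"
  and anchor_scale: "u \<in> fib A y \<Longrightarrow> \<rho> y (r *\<^sub>R u) = r *\<^sub>R \<rho> y u"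
  using anchor_map unfolding bundle_map_def by blast+

lemma anchor_tangent: "u \<in> fib A y \<Longrightarrow> \<rho> y u \<in> tangent_space M y"
  using anchor_surj by blast

lemma L_iff: "u \<in> L y \<longleftrightarrow> u \<in> fib A y \<and> \<rho> y u = 0"
  by (simp add: adjoint_fib_def)

lemma subspace_L: "subspace (L y)"
proof -
  have "0 \<in> fib A y" by (rule subspace_0[OF A.fib_subspace])
  then have "\<rho> y 0 = 0" using anchor_scale[of 0 y 0] by simp
  then show ?thesis
    unfolding subspace_def L_iff
    using \<open>0 \<in> fib A y\<close> subspace_add[OF A.fib_subspace] subspace_scale[OF A.fib_subspace]
    by (auto simp: L_iff anchor_add anchor_scale)
qed

text \<open>Spanning is obtained without analysing derivations: the anchor is onto and, being a
  bundle map, sends a frame of \<open>A\<close> to smooth sections of the tangent algebroid, which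
  by definition are combinations of coordinate fields. Independence comes from
  \<open>coord_field_eq_0_imp\<close>.\<close>

lemma tangent_chart:
  assumes "(W, \<phi>) \<in> charts M" "is_basis_list bs (model M)"
  shows "basis_fam (length bs) ((!) bs) (model M)" "j < length bs \<Longrightarrow> bs ! j \<in> model M"
    "y \<in> W \<Longrightarrow> basis_fam (length bs) (\<lambda>j. coord_field M W \<phi> (bs ! j) y) (tangent_space M y)"
proof -
  show bs: "basis_fam (length bs) ((!) bs) (model M)" by (rule basis_list_imp_fam[OF assms(2)])
  then show m: "bs ! j \<in> model M" if "j < length bs" for j using that by (simp add: basis_fam_def)
  assume y: "y \<in> W"
  let ?d = "length bs" and ?es = "map (coord_field M W \<phi>) bs"
  have fr: "(W, ?es) \<in> frames TM" using assms TM_simps(3) by blast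
  show "basis_fam ?d (\<lambda>j. coord_field M W \<phi> (bs ! j) y) (tangent_space M y)"
    unfolding basis_fam_def
  proof (intro conjI allI impI ballI)
    show "coord_field M W \<phi> (bs ! j) y \<in> tangent_space M y" if "j < ?d" for j
      by (rule coord_field_tangent[OF assms(1) y m[OF that]])
    fix X assume "X \<in> tangent_space M y"
    then obtain u where u: "u \<in> fib A y" "X = \<rho> y u" using anchor_surj by blast
    obtain U es where U: "(U, es) \<in> frames A" "y \<in> U" "open U"
      "basis_fam (length es) (\<lambda>i. (es ! i) y) (fib A y)" by (rule A.frame_exists)
    have "\<exists>c. \<rho> y ((es ! i) y) = (\<Sum>j<?d. c j *\<^sub>R coord_field M W \<phi> (bs ! j) y)" if i: "i < length es" for i
    proof -
      have "smooth_section_on M TM U (\<lambda>z. \<rho> z ((es ! i) z))"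
        using anchor_map U(1) nth_mem[OF i] unfolding bundle_map_def by blast
      then obtain c where "\<forall>z\<in>W \<inter> U. \<rho> z ((es ! i) z) = (\<Sum>j<length ?es. c j z *\<^sub>R (?es ! j) z)"
        using fr unfolding smooth_section_on_def by blast
      then show ?thesis using y U(2) by (intro exI[of _ "\<lambda>j. c j y"]) auto
    qed
    then have "\<forall>i. \<exists>c. i < length es \<longrightarrow> \<rho> y ((es ! i) y) = (\<Sum>j<?d. c j *\<^sub>R coord_field M W \<phi> (bs ! j) y)"
      by simp
    from choice[OF this] obtain c where c: "\<forall>i. i < length es \<longrightarrow> \<rho> y ((es ! i) y) = (\<Sum>j<?d. c i j *\<^sub>R coord_field M W \<phi> (bs ! j) y)"
      by (elim exE)
    obtain a where a: "u = (\<Sum>i<length es. a i *\<^sub>R (es ! i) y)"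
      using U(4) u(1) unfolding basis_fam_def by blast
    have "X = (\<Sum>i<length es. a i *\<^sub>R \<rho> y ((es ! i) y))"
      unfolding u(2) a by (rule bundle_map_sum[OF anchor_map A.fib_subspace]) (use U(4) in \<open>simp add: basis_fam_def\<close>)
    also have "\<dots> = (\<Sum>j<?d. (\<Sum>i<length es. a i * c i j) *\<^sub>R coord_field M W \<phi> (bs ! j) y)"
      by (simp add: c scaleR_sum_right scaleR_sum_left) (rule sum.swap)
    finally show "\<exists>c. X = (\<Sum>j<?d. c j *\<^sub>R coord_field M W \<phi> (bs ! j) y)"
      by (intro exI[of _ "\<lambda>j. \<Sum>i<length es. a i * c i j"])
  next
    fix c j assume c: "(\<Sum>j<?d. c j *\<^sub>R coord_field M W \<phi> (bs ! j) y) = 0" and j: "j < ?d"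
    have "coord_field M W \<phi> (\<Sum>j<?d. c j *\<^sub>R bs ! j) y = 0"
      by (simp add: coord_field_sum[OF assms(1) y m] c)
    moreover have "(\<Sum>j<?d. c j *\<^sub>R bs ! j) \<in> model M"
      by (rule basis_fam_sum_in[OF bs model_subspace])
    ultimately have "(\<Sum>j<?d. c j *\<^sub>R bs ! j) = 0" using coord_field_eq_0_imp[OF assms(1) y] by blast
    then show "c j = 0" using bs j unfolding basis_fam_def by blast
  qed
qed

lemma framed_TM: "framed TM"
proof -
  have "open U \<and> is_frame_on (fib TM) U es" if "(U, es) \<in> frames TM" for U es
  proof -
    from that
    obtain \<phi> bs where *: "(U, \<phi>) \<in> charts M" "is_basis_list bs (model M)" "es = map (coord_field M U \<phi>) bs"
      using TM_simps(3) by blast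
    have "is_basis_list (map (\<lambda>e. e y) es) (tangent_space M y)" if "y \<in> U" for y
    proof -
      have "map (\<lambda>e. e y) es = map (\<lambda>j. coord_field M U \<phi> (bs ! j) y) [0..<length bs]"
        using *(3) by (auto intro!: nth_equalityI)
      then show ?thesis
        using basis_fam_imp_list[OF tangent_chart(3)[OF *(1,2) that] subspace_tangent_space] by simp
    qed
    then show ?thesis
      using chart_facts(1)[OF *(1)] by (simp add: is_frame_on_def TM_simps)
  qed
  then show ?thesis
    unfolding framed_def TM_simps(1) using subspace_tangent_space by auto
qed

lemma anchor_section: "a \<in> sections M A \<Longrightarrow> (\<lambda>y. \<rho> y (a y)) \<in> sections M TM"
  unfolding sections_iff[OF framed_TM] TM_simps(1)
  using A.sectionsD anchor_tangent bundle_map_sec_at[OF anchor_map A.framed framed_TM] A.frame_exists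
  by metis

lemma tangent_coef_smooth:
  assumes "(W, \<phi>) \<in> charts M" "is_basis_list bs (model M)" "y \<in> W" "s \<in> sections M TM" "j < length bs"
  shows "smooth_at M (\<lambda>z. bcoef (length bs) (\<lambda>j. coord_field M W \<phi> (bs ! j) z) (s z) j) y"
proof -
  let ?es = "map (coord_field M W \<phi>) bs"
  have "(W, ?es) \<in> frames TM" using assms(1,2) TM_simps(3) by blast
  moreover have "sec_at M TM s y" using assms(4) by (simp add: sections_iff[OF framed_TM])
  ultimately have "smooth_at M (\<lambda>z. bcoef (length ?es) (\<lambda>j. (?es ! j) z) (s z) j) y"
    using assms(3,5) by (intro framed_coef_smooth[OF framed_TM]) simp_all
  moreover have "bcoef (length ?es) (\<lambda>j. (?es ! j) z) (s z) = bcoef (length bs) (\<lambda>j. coord_field M W \<phi> (bs ! j) z) (s z)" for z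
    unfolding bcoef_def by simp
  ultimately show ?thesis by simp
qed

lemma bundle_map_section:
  assumes "bundle_map M A F \<Omega>" "a \<in> sections M A"
  shows "(\<lambda>y. \<Omega> y (a y)) \<in> sections M F"
proof (rule F.sectionsI)
  fix y
  obtain U es where "(U, es) \<in> frames A" "y \<in> U" by (rule A.frame_exists)
  then show "sec_at M F (\<lambda>y. \<Omega> y (a y)) y"
    by (intro bundle_map_sec_at[OF assms(1) A.framed F.framed] A.sectionsD assms(2))
  show "\<Omega> y (a y) \<in> fib F y" using bundle_map_in[OF assms(1)] A.sectionsD(1)[OF assms(2)] by blast
qed

subsection \<open>The operators of the representation\<close>

lemma R_CDO: "u \<in> fib A y \<Longrightarrow> is_CDO M F y (\<rho> y u) (R y u)"
  using rep by (simp add: lie_representation_def)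

lemma R_in: "u \<in> fib A y \<Longrightarrow> \<mu> \<in> sections M F \<Longrightarrow> R y u \<mu> \<in> fib F y"
  using R_CDO by (simp add: is_CDO_def)

lemma R_plus: "u \<in> fib A y \<Longrightarrow> \<mu> \<in> sections M F \<Longrightarrow> \<nu> \<in> sections M F \<Longrightarrow> R y u (\<mu> + \<nu>) = R y u \<mu> + R y u \<nu>"
  using R_CDO by (simp add: is_CDO_def)

lemma R_add: "u \<in> fib A y \<Longrightarrow> \<mu> \<in> sections M F \<Longrightarrow> \<nu> \<in> sections M F \<Longrightarrow>
    R y u (\<lambda>z. \<mu> z + \<nu> z) = R y u \<mu> + R y u \<nu>"
  using R_plus by (simp add: plus_fun_def)

lemma R_scaleR: "u \<in> fib A y \<Longrightarrow> \<mu> \<in> sections M F \<Longrightarrow> R y u (r *\<^sub>R \<mu>) = r *\<^sub>R R y u \<mu>"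
  using R_CDO by (simp add: is_CDO_def)

lemma R_leibniz: "u \<in> fib A y \<Longrightarrow> f \<in> smooth_funs M \<Longrightarrow> \<mu> \<in> sections M F \<Longrightarrow>
    R y u (\<lambda>z. f z *\<^sub>R \<mu> z) = \<rho> y u f *\<^sub>R \<mu> y + f y *\<^sub>R R y u \<mu>"
  using R_CDO by (simp add: is_CDO_def)

lemma R_add_left: "u \<in> fib A y \<Longrightarrow> v \<in> fib A y \<Longrightarrow> \<mu> \<in> sections M F \<Longrightarrow> R y (u + v) \<mu> = R y u \<mu> + R y v \<mu>"
  and R_scale_left: "u \<in> fib A y \<Longrightarrow> \<mu> \<in> sections M F \<Longrightarrow> R y (r *\<^sub>R u) \<mu> = r *\<^sub>R R y u \<mu>"
  and R_frame: "(U, es) \<in> frames A \<Longrightarrow> e \<in> set es \<Longrightarrow> \<mu> \<in> sections M F \<Longrightarrow> smooth_section_on M F U (\<lambda>y. R y (e y) \<mu>)"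
  and R_bracket: "a \<in> sections M A \<Longrightarrow> b \<in> sections M A \<Longrightarrow> \<mu> \<in> sections M F \<Longrightarrow>
    R y (bracket A a b y) \<mu> = R y (a y) (\<lambda>z. R z (b z) \<mu>) - R y (b y) (\<lambda>z. R z (a z) \<mu>)"
  using rep unfolding lie_representation_def by blast+

lemma R_bundle_map: "\<mu> \<in> sections M F \<Longrightarrow> bundle_map M A F (\<lambda>y u. R y u \<mu>)"
  unfolding bundle_map_def using R_in R_add_left R_scale_left R_frame by blast

lemma R_sum_left:
  fixes n :: nat
  assumes "\<mu> \<in> sections M F" "\<And>i. i < n \<Longrightarrow> e i \<in> fib A y"
  shows "R y (\<Sum>i<n. c i *\<^sub>R e i) \<mu> = (\<Sum>i<n. c i *\<^sub>R R y (e i) \<mu>)"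
  by (rule bundle_map_sum[OF R_bundle_map[OF assms(1)] A.fib_subspace]) (rule assms(2))

lemma R_zero: "u \<in> fib A y \<Longrightarrow> R y u (\<lambda>z. 0) = 0"
  using R_leibniz[of u y "\<lambda>_. 0" "\<lambda>_. 0"] R_scaleR[of u y "\<lambda>_. 0" 0] F.sections_zero
  by (simp add: scaleR_fun_def)

lemma R_sum: "u \<in> fib A y \<Longrightarrow> (\<And>i. i < n \<Longrightarrow> \<mu> i \<in> sections M F) \<Longrightarrow>
    R y u (\<lambda>z. \<Sum>i<n. \<mu> i z) = (\<Sum>i<n. R y u (\<mu> i))" for n :: nat
proof (induction n)
  case (Suc n)
  have "R y u (\<lambda>z. (\<Sum>i<n. \<mu> i z) + \<mu> n z) = R y u (\<lambda>z. \<Sum>i<n. \<mu> i z) + R y u (\<mu> n)"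
    using Suc.prems by (intro R_add F.sections_sum_fun) auto
  then show ?case using Suc by simp
qed (simp add: R_zero)

lemma R_local:
  assumes "u \<in> fib A y" "\<mu> \<in> sections M F" "\<nu> \<in> sections M F" "open N" "y \<in> N" "\<And>z. z \<in> N \<Longrightarrow> \<mu> z = \<nu> z"
  shows "R y u \<mu> = R y u \<nu>"
  by (rule F.operator_local[of "R y u" "\<rho> y u", OF R_add[OF assms(1)] R_leibniz[OF assms(1)] assms(2-6)])

lemma R_tensorial:
  assumes "u \<in> L y" "\<mu> \<in> sections M F" "\<nu> \<in> sections M F" "\<mu> y = \<nu> y"
  shows "R y u \<mu> = R y u \<nu>"
proof (rule F.tensorial[of "R y u" y, OF R_add _ assms(2-4)])
  show "u \<in> fib A y" using assms(1) by (simp add: L_iff)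
  then show "R y u (\<lambda>z. f z *\<^sub>R s z) = f y *\<^sub>R R y u s" if "f \<in> smooth_funs M" "s \<in> sections M F" for f s
    using R_leibniz[OF _ that] assms(1) by (simp add: L_iff)
qed

text \<open>The Leibniz rule for coefficients that are smooth only near \<open>y\<close>: they are
  replaced by global functions with the same germs, which changes neither side. The case
  \<open>v = 0\<close> covers elements of \<open>L\<close>.\<close>

lemma R_expand:
  fixes k :: nat
  assumes chart: "(W, \<phi>) \<in> charts M" and y: "y \<in> W" and u: "u \<in> fib A y" "\<rho> y u = coord_field M W \<phi> v y" and v: "v \<in> model M"
    and N: "open N" "y \<in> N" and f: "\<And>a. a < k \<Longrightarrow> f a \<in> sections M F"
    and c: "\<And>a z. a < k \<Longrightarrow> z \<in> N \<Longrightarrow> smooth_at M (c a) z"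
    and \<mu>: "\<mu> \<in> sections M F" "\<And>z. z \<in> N \<Longrightarrow> \<mu> z = (\<Sum>a<k. c a z *\<^sub>R f a z)"
  shows "R y u \<mu> = (\<Sum>a<k. dird W \<phi> v (c a) y *\<^sub>R f a y + c a y *\<^sub>R R y u (f a))"
proof -
  have "\<exists>g N'. g \<in> smooth_funs M \<and> open N' \<and> y \<in> N' \<and> N' \<subseteq> N \<and> (\<forall>z\<in>N'. g z = c a z)" if "a < k" for a
    using globalize_fun[OF N c[OF that]] by metis
  then obtain g N' where g: "\<And>a. a < k \<Longrightarrow> g a \<in> smooth_funs M" "\<And>a. a < k \<Longrightarrow> open (N' a)"
    "\<And>a. a < k \<Longrightarrow> y \<in> N' a" "\<And>a z. a < k \<Longrightarrow> z \<in> N' a \<Longrightarrow> g a z = c a z"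
    by metis
  have gs: "(\<lambda>z. g a z *\<^sub>R f a z) \<in> sections M F" if "a < k" for a
    using that by (intro F.sections_scale_fun g f)
  have "R y u \<mu> = R y u (\<lambda>z. \<Sum>a<k. g a z *\<^sub>R f a z)"
  proof (rule R_local[OF u(1) \<mu>(1)])
    show "(\<lambda>z. \<Sum>a<k. g a z *\<^sub>R f a z) \<in> sections M F" using gs by (intro F.sections_sum_fun) auto
    show "open (N \<inter> (\<Inter>a<k. N' a))" using N g by (intro open_Int open_INT) auto
    show "y \<in> N \<inter> (\<Inter>a<k. N' a)" using N g by auto
    show "\<mu> z = (\<Sum>a<k. g a z *\<^sub>R f a z)" if "z \<in> N \<inter> (\<Inter>a<k. N' a)" for z
      using that \<mu>(2) g(4) by auto
  qed
  also have "\<dots> = (\<Sum>a<k. R y u (\<lambda>z. g a z *\<^sub>R f a z))" by (rule R_sum[OF u(1) gs])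
  also have "\<dots> = (\<Sum>a<k. dird W \<phi> v (c a) y *\<^sub>R f a y + c a y *\<^sub>R R y u (f a))"
  proof (intro sum.cong refl)
    fix a assume "a \<in> {..<k}"
    then have a: "a < k" by simp
    have "dird W \<phi> v (g a) y = dird W \<phi> v (c a) y"
      using g(1)[OF a] by (intro dird_cong[OF chart _ y v g(2)[OF a] g(3)[OF a]] g(4)[OF a]) (auto simp: smooth_funs_iff)
    then show "R y u (\<lambda>z. g a z *\<^sub>R f a z) = dird W \<phi> v (c a) y *\<^sub>R f a y + c a y *\<^sub>R R y u (f a)"
      using R_leibniz[OF u(1) g(1)[OF a] f[OF a]] g(4)[OF a g(3)[OF a]]
      by (simp add: u(2) coord_field_smooth[OF g(1)[OF a]])
  qed
  finally show ?thesis .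
qed

lemma adjoint_action_eq:
  assumes "u \<in> L y" "\<mu> \<in> sections M F"
  shows "adjoint_action M F R y u (\<mu> y) = R y u \<mu>"
  unfolding adjoint_action_def
proof (rule the_equality)
  show "\<forall>\<mu>'\<in>sections M F. \<mu>' y = \<mu> y \<longrightarrow> R y u \<mu>' = R y u \<mu>"
    using R_tensorial[OF assms(1)] assms(2) by blast
  show "w = R y u \<mu>" if "\<forall>\<mu>'\<in>sections M F. \<mu>' y = \<mu> y \<longrightarrow> R y u \<mu>' = w" for w
    using that assms(2) by simp
qed

subsection \<open>The bracket\<close>

lemma bracket_section: "a \<in> sections M A \<Longrightarrow> b \<in> sections M A \<Longrightarrow> bracket A a b \<in> sections M A"
  using algebroid by (simp add: lie_algebroid_def)

lemma bracket_bilinear: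
  assumes "a \<in> sections M A" "b \<in> sections M A" "c \<in> sections M A"
  shows "bracket A (a + b) c = bracket A a c + bracket A b c"
    "bracket A c (a + b) = bracket A c a + bracket A c b" "bracket A a a = 0"
  using algebroid assms unfolding lie_algebroid_def by blast+

lemma bracket_anti:
  assumes "a \<in> sections M A" "b \<in> sections M A"
  shows "bracket A a b = - bracket A b a"
proof -
  have "bracket A (a + b) (a + b) = 0" by (rule bracket_bilinear(3)) (use assms A.sections_add in auto)
  then have "bracket A a b + bracket A b a = 0"
    using bracket_bilinear[OF assms A.sections_add[OF assms]] bracket_bilinear[OF assms assms(1)]
      bracket_bilinear[OF assms assms(2)] bracket_bilinear(3)[OF assms(2,2,2)]
    by simp
  then show ?thesis by (simp add: eq_neg_iff_add_eq_0)
qed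

lemma bracket_leibniz: "a \<in> sections M A \<Longrightarrow> b \<in> sections M A \<Longrightarrow> f \<in> smooth_funs M \<Longrightarrow>
    bracket A a (\<lambda>y. f y *\<^sub>R b y) = (\<lambda>y. f y *\<^sub>R bracket A a b y + \<rho> y (a y) f *\<^sub>R b y)"
  using algebroid by (simp add: lie_algebroid_def)

lemma anchor_bracket: "a \<in> sections M A \<Longrightarrow> b \<in> sections M A \<Longrightarrow>
    (\<lambda>y. \<rho> y (bracket A a b y)) = bracket TM (\<lambda>y. \<rho> y (a y)) (\<lambda>y. \<rho> y (b y))"
  using algebroid by (simp add: lie_algebroid_def)

lemma bracket_tensorial_right:
  assumes "a \<in> sections M A" "a y \<in> L y" "b \<in> sections M A" "b' \<in> sections M A" "b y = b' y"
  shows "bracket A a b y = bracket A a b' y"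
proof (rule A.tensorial[of "\<lambda>b. bracket A a b y" y, OF _ _ assms(3-5)])
  show "bracket A a (\<lambda>z. s z + t z) y = bracket A a s y + bracket A a t y"
    if "s \<in> sections M A" "t \<in> sections M A" for s t
    using bracket_bilinear(2)[OF that assms(1)] by (simp add: plus_fun_def)
  show "bracket A a (\<lambda>z. f z *\<^sub>R s z) y = f y *\<^sub>R bracket A a s y"
    if "f \<in> smooth_funs M" "s \<in> sections M A" for f s
    using bracket_leibniz[OF assms(1) that(2,1)] assms(2) by (simp add: L_iff)
qed

lemma adjoint_bracket_eq:
  assumes "a \<in> sections M A" "b \<in> sections M A" "a y \<in> L y" "b y \<in> L y"
  shows "adjoint_bracket M A y (a y) (b y) = bracket A a b y"
  unfolding adjoint_bracket_def
proof (rule the_equality)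
  show "\<forall>a'\<in>sections M A. \<forall>b'\<in>sections M A. a' y = a y \<and> b' y = b y \<longrightarrow> bracket A a' b' y = bracket A a b y"
  proof (intro ballI impI, elim conjE)
    fix a' b' assume s: "a' \<in> sections M A" "b' \<in> sections M A" "a' y = a y" "b' y = b y"
    have "bracket A a' b' y = bracket A a' b y"
      using bracket_tensorial_right[OF s(1) _ s(2) assms(2) s(4)] s(3) assms(3) by simp
    also have "\<dots> = - bracket A b a' y" using bracket_anti[OF s(1) assms(2)] by simp
    also have "bracket A b a' y = bracket A b a y"
      using bracket_tensorial_right[OF assms(2,4) s(1) assms(1) s(3)] .
    also have "- bracket A b a y = bracket A a b y" using bracket_anti[OF assms(1,2)] by simp
    finally show "bracket A a' b' y = bracket A a b y" .
  qed
  show "w = bracket A a b y"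
    if "\<forall>a'\<in>sections M A. \<forall>b'\<in>sections M A. a' y = a y \<and> b' y = b y \<longrightarrow> bracket A a' b' y = w" for w
    using that assms(1,2) by simp
qed

text \<open>The anchor turns the bracket into a commutator of derivations. One term vanishes since
  \<open>\<rho> y (b y) = 0\<close>; the other applies a derivation to a function that vanishes near
  \<open>y\<close> and therefore equals its product with \<open>1 - \<beta>\<close>. In the case
  that this function is not in \<open>smooth_funs M\<close>, the derivation is 0 on it by
  convention.\<close>

lemma bracket_in_L:
  assumes "a \<in> sections M A" "b \<in> sections M A" "open N" "y \<in> N" "\<And>z. z \<in> N \<Longrightarrow> b z \<in> L z"
  shows "bracket A a b y \<in> L y"
proof -
  have fib: "bracket A a b y \<in> fib A y" by (rule A.sectionsD(1)[OF bracket_section[OF assms(1,2)]])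
  have "\<rho> y (bracket A a b y) f = 0" for f
  proof (cases "f \<in> smooth_funs M")
    case True
    have "\<rho> y (bracket A a b y) f = \<rho> y (a y) (\<lambda>z. \<rho> z (b z) f) - \<rho> y (b y) (\<lambda>z. \<rho> z (a z) f)"
      using fun_cong[OF fun_cong[OF anchor_bracket[OF assms(1,2)]], of y f] True
      by (simp add: tangent_algebroid_def)
    also have "\<rho> y (b y) = 0" using assms(4,5) by (simp add: L_iff)
    also have "\<rho> y (a y) (\<lambda>z. \<rho> z (b z) f) = 0"
    proof -
      define g where "g = (\<lambda>z. \<rho> z (b z) f)"
      have t: "\<rho> y (a y) \<in> tangent_space M y" by (rule anchor_tangent[OF A.sectionsD(1)[OF assms(1)]])
      obtain \<beta> V K where b: "\<beta> \<in> smooth_funs M" "open V" "y \<in> V" "V \<subseteq> K" "closed K" "K \<subseteq> N"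
        "\<And>z. z \<in> V \<Longrightarrow> \<beta> z = 1" "\<And>z. z \<notin> K \<Longrightarrow> \<beta> z = 0"
        using bump[OF assms(3,4)] by metis
      have g0: "g z = 0" if "z \<in> N" for z using assms(5)[OF that] by (simp add: g_def L_iff)
      show ?thesis
      proof (cases "g \<in> smooth_funs M")
        case True
        have 1: "(\<lambda>z. 1 - \<beta> z) \<in> smooth_funs M"
          using b(1) by (auto simp: smooth_funs_iff intro: smooth_at_diff)
        have "\<beta> z = 0 \<or> g z = 0" for z using b g0[of z] by blast
        then have eq: "(\<lambda>z. (1 - \<beta> z) * g z) = g" by (auto simp: fun_eq_iff algebra_simps)
        have "\<rho> y (a y) g = \<rho> y (a y) (\<lambda>z. 1 - \<beta> z) * g y + (1 - \<beta> y) * \<rho> y (a y) g"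
          using tangent_spaceD(3)[OF t 1 True] unfolding eq .
        then show ?thesis using b(3,7) g0[OF assms(4)] unfolding g_def by simp
      next
        case False
        then show ?thesis using t unfolding tangent_space_def g_def by blast
      qed
    qed
    finally show ?thesis by (simp add: zero_fun_def)
  next
    case False
    then show ?thesis using anchor_tangent[OF fib] unfolding tangent_space_def by blast
  qed
  then show ?thesis using fib by (auto simp: L_iff fun_eq_iff)
qed

subsection \<open>Local sections of the adjoint bundle\<close>

text \<open>Surjectivity of the anchor at \<open>x\<close> gives a right inverse of its coefficient
  matrix at that point; \<open>smooth_right_inverse\<close> spreads it over a neighbourhood, and its
  columns are the coefficients of lifts of the coordinate fields.\<close>

lemma local_lifts:
  assumes chart: "(W, \<phi>) \<in> charts M" and x: "x \<in> W" and bs: "is_basis_list bs (model M)"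
  obtains N X where "open N" "x \<in> N" "N \<subseteq> W" "\<And>j. j < length bs \<Longrightarrow> X j \<in> sections M A"
    "\<And>j y. j < length bs \<Longrightarrow> y \<in> N \<Longrightarrow> \<rho> y (X j y) = coord_field M W \<phi> (bs ! j) y"
proof -
  let ?d = "length bs"
  let ?D = "\<lambda>j y. coord_field M W \<phi> (bs ! j) y"
  note t = tangent_chart[OF chart bs]
  obtain N0 n e where e: "A.local_frame N0 n e" "x \<in> N0" "N0 \<subseteq> W"
    using A.local_frame_exists[OF chart_facts(1)[OF chart] x] by metis
  define c where "c j i y = bcoef ?d (\<lambda>j. ?D j y) (\<rho> y (e i y)) j" for j i y
  have ei: "e i y \<in> fib A y" if "i < n" for i y
    by (rule A.sectionsD(1)[OF A.local_frameD(2)[OF e(1) that]])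
  have \<rho>e: "\<rho> y (e i y) = (\<Sum>j<?d. c j i y *\<^sub>R ?D j y)" if "i < n" "y \<in> W" for i y
    using bcoef_sum[OF t(3)[OF that(2)] anchor_tangent[OF ei[OF that(1)]]] by (simp add: c_def)
  have cs: "smooth_at M (c j i) y" if "j < ?d" "i < n" "y \<in> N0" for j i y
    unfolding c_def[abs_def]
    using that(3) e(3) by (intro tangent_coef_smooth[OF chart bs _ anchor_section[OF A.local_frameD(2)[OF e(1) that(2)]] that(1)]) blast
  have "\<exists>u. u \<in> fib A x \<and> \<rho> x u = ?D j x" if "j < ?d" for j
    using anchor_surj[of x] coord_field_tangent[OF chart x t(2)[OF that]] by (metis imageE)
  then obtain u where u: "\<And>j. j < ?d \<Longrightarrow> u j \<in> fib A x" "\<And>j. j < ?d \<Longrightarrow> \<rho> x (u j) = ?D j x" by metis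
  define B where "B i j = bcoef n (\<lambda>i. e i x) (u j) i" for i j
  have "(\<Sum>i<n. c m i x * B i j) = (if m = j then 1 else 0)" if m: "m < ?d" and j: "j < ?d" for m j
  proof -
    have "?D j x = \<rho> x (\<Sum>i<n. B i j *\<^sub>R e i x)"
      using A.local_frame_expand[OF e(1,2) u(1)[OF j]] u(2)[OF j] by (simp add: B_def)
    also have "\<dots> = (\<Sum>i<n. B i j *\<^sub>R \<rho> x (e i x))"
      by (rule bundle_map_sum[OF anchor_map A.fib_subspace ei])
    also have "\<dots> = (\<Sum>m<?d. (\<Sum>i<n. c m i x * B i j) *\<^sub>R ?D m x)"
      by (simp add: \<rho>e[OF _ x] scaleR_sum_right scaleR_sum_left mult.commute) (rule sum.swap)
    finally have "(\<Sum>m<?d. (if m = j then 1 else 0) *\<^sub>R ?D m x) = (\<Sum>m<?d. (\<Sum>i<n. c m i x * B i j) *\<^sub>R ?D m x)"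
      using j by (simp add: if_distrib[of "\<lambda>r. r *\<^sub>R _"] cong: if_cong)
    from basis_fam_unique[OF t(3)[OF x] this m] show ?thesis by simp
  qed
  note inv = this
  obtain N1 S where S: "open N1" "x \<in> N1" "N1 \<subseteq> N0"
    "\<And>k j y. k < n \<Longrightarrow> j < ?d \<Longrightarrow> y \<in> N1 \<Longrightarrow> smooth_at M (S k j) y"
    "\<And>i j y. i < ?d \<Longrightarrow> j < ?d \<Longrightarrow> y \<in> N1 \<Longrightarrow> (\<Sum>k<n. c i k y * S k j y) = (if i = j then 1 else 0)"
  proof (rule smooth_right_inverse[of "{..<?d}" "{..<n}" N0 x c B])
    show "(\<Sum>k<n. c i k x * B k j) = (if i = j then 1 else 0)" if "i \<in> {..<?d}" "j \<in> {..<?d}" for i j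
      using inv that by simp
  qed (use cs e(2) A.local_frameD(1)[OF e(1)] in auto)
  define X' where "X' j y = (\<Sum>i<n. S i j y *\<^sub>R e i y)" for j y
  have "\<exists>t N. t \<in> sections M A \<and> open N \<and> x \<in> N \<and> N \<subseteq> N1 \<and> (\<forall>z\<in>N. t z = X' j z)" if j: "j < ?d" for j
  proof -
    have "X' j z \<in> fib A z" for z
      unfolding X'_def using ei by (intro subspace_sum subspace_scale A.fib_subspace) auto
    moreover have "sec_at M A (X' j) z" if "z \<in> N1" for z
      unfolding X'_def[abs_def] using that j
      by (intro sec_at_sum sec_at_scale S(4) A.sectionsD(2) A.local_frameD(2)[OF e(1)]) auto
    ultimately show ?thesis using A.globalize_section[OF S(1,2), of "X' j"] by metis
  qed
  then obtain X N' where X: "\<And>j. j < ?d \<Longrightarrow> X j \<in> sections M A" "\<And>j. j < ?d \<Longrightarrow> open (N' j)"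
    "\<And>j. j < ?d \<Longrightarrow> x \<in> N' j" "\<And>j z. j < ?d \<Longrightarrow> z \<in> N' j \<Longrightarrow> X j z = X' j z"
    by metis
  show ?thesis
  proof (rule that)
    show "open (N1 \<inter> (\<Inter>j<?d. N' j))" using S(1) X(2) by (intro open_Int open_INT) auto
    show "x \<in> N1 \<inter> (\<Inter>j<?d. N' j)" "N1 \<inter> (\<Inter>j<?d. N' j) \<subseteq> W" using S(2,3) X(3) e(3) by auto
    show "X j \<in> sections M A" if "j < ?d" for j by (rule X(1)[OF that])
    fix j y assume j: "j < ?d" and y: "y \<in> N1 \<inter> (\<Inter>j<?d. N' j)"
    have yW: "y \<in> W" using y S(3) e(3) by blast
    have "\<rho> y (X j y) = \<rho> y (\<Sum>i<n. S i j y *\<^sub>R e i y)" using X(4)[OF j] y j by (simp add: X'_def)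
    also have "\<dots> = (\<Sum>i<n. S i j y *\<^sub>R \<rho> y (e i y))"
      by (rule bundle_map_sum[OF anchor_map A.fib_subspace ei])
    also have "\<dots> = (\<Sum>m<?d. (\<Sum>i<n. c m i y * S i j y) *\<^sub>R ?D m y)"
      by (simp add: \<rho>e[OF _ yW] scaleR_sum_right scaleR_sum_left mult.commute) (rule sum.swap)
    also have "\<dots> = (\<Sum>m<?d. (if m = j then 1 else 0) *\<^sub>R ?D m y)"
      using S(5) j y by (intro sum.cong) auto
    also have "\<dots> = ?D j y" using j by (simp add: if_distrib[of "\<lambda>r. r *\<^sub>R _"] cong: if_cong)
    finally show "\<rho> y (X j y) = ?D j y" .
  qed
qed

text \<open>Subtracting from each member of a frame of \<open>A\<close> the lift of its anchor gives
  sections \<open>l i\<close> of \<open>L\<close>. There are as many of them as the rank of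
  \<open>A\<close>, so they span \<open>L\<close> without being independent in general. An element
  of \<open>L\<close> keeps its frame coefficients, because the subtracted lifts cancel when the
  anchor is 0.\<close>

lemma local_structure:
  assumes chart: "(W, \<phi>) \<in> charts M" and x: "x \<in> W"
  obtains N and n :: nat and l X where "open N" "x \<in> N" "N \<subseteq> W" "\<And>i. i < n \<Longrightarrow> l i \<in> sections M A"
    "\<And>i y. i < n \<Longrightarrow> y \<in> N \<Longrightarrow> l i y \<in> L y"
    "\<And>v. v \<in> model M \<Longrightarrow> X v \<in> sections M A"
    "\<And>v y. v \<in> model M \<Longrightarrow> y \<in> N \<Longrightarrow> \<rho> y (X v y) = coord_field M W \<phi> v y"
    "\<And>s. s \<in> sections M A \<Longrightarrow> \<exists>a. (\<forall>m<n. \<forall>y\<in>N. smooth_at M (a m) y) \<and>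
      (\<forall>y\<in>N. s y \<in> L y \<longrightarrow> s y = (\<Sum>m<n. a m y *\<^sub>R l m y))"
proof -
  obtain bs where bs: "is_basis_list bs (model M)" by (rule model_basis)
  let ?d = "length bs"
  let ?D = "\<lambda>j y. coord_field M W \<phi> (bs ! j) y"
  note t = tangent_chart[OF chart bs]
  obtain N1 X where X: "open N1" "x \<in> N1" "N1 \<subseteq> W" "\<And>j. j < ?d \<Longrightarrow> X j \<in> sections M A"
    "\<And>j y. j < ?d \<Longrightarrow> y \<in> N1 \<Longrightarrow> \<rho> y (X j y) = ?D j y"
    using local_lifts[OF chart x bs] by metis
  obtain N0 n e where e: "A.local_frame N0 n e" "x \<in> N0" "N0 \<subseteq> N1"
    using A.local_frame_exists[OF X(1,2)] by metis
  have ei: "e i y \<in> fib A y" if "i < n" for i y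
    by (rule A.sectionsD(1)[OF A.local_frameD(2)[OF e(1) that]])
  have Xi: "X j y \<in> fib A y" if "j < ?d" for j y by (rule A.sectionsD(1)[OF X(4)[OF that]])
  define c where "c j i y = bcoef ?d (\<lambda>j. ?D j y) (\<rho> y (e i y)) j" for j i y
  have \<rho>e: "\<rho> y (e i y) = (\<Sum>j<?d. c j i y *\<^sub>R ?D j y)" if "i < n" "y \<in> W" for i y
    using bcoef_sum[OF t(3)[OF that(2)] anchor_tangent[OF ei[OF that(1)]]] by (simp add: c_def)
  have cs: "smooth_at M (c j i) y" if "j < ?d" "i < n" "y \<in> N0" for j i y
    unfolding c_def[abs_def]
    using that(3) e(3) X(3) by (intro tangent_coef_smooth[OF chart bs _ anchor_section[OF A.local_frameD(2)[OF e(1) that(2)]] that(1)]) blast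
  define l' where "l' i y = e i y - (\<Sum>j<?d. c j i y *\<^sub>R X j y)" for i y
  have \<rho>X: "\<rho> y (\<Sum>j<?d. g j *\<^sub>R X j y) = (\<Sum>j<?d. g j *\<^sub>R ?D j y)" if "y \<in> N1" for g y
    using bundle_map_sum[OF anchor_map A.fib_subspace Xi] X(5)[OF _ that] by simp
  have sX: "(\<Sum>j<?d. g j *\<^sub>R X j y) \<in> fib A y" for g y
    using Xi by (intro subspace_sum subspace_scale A.fib_subspace) auto
  have l'L: "l' i y \<in> L y" if i: "i < n" and y: "y \<in> N0" for i y
  proof -
    have "\<rho> y (l' i y) = \<rho> y (e i y + (-1) *\<^sub>R (\<Sum>j<?d. c j i y *\<^sub>R X j y))" by (simp add: l'_def)
    also have "\<dots> = \<rho> y (e i y) + (-1) *\<^sub>R \<rho> y (\<Sum>j<?d. c j i y *\<^sub>R X j y)"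
      using anchor_add[OF ei[OF i] subspace_scale[OF A.fib_subspace sX]] anchor_scale[OF sX] by metis
    also have "\<dots> = 0"
      using \<rho>X[of y] y e(3) \<rho>e[OF i, of y] X(3) by (auto simp: subset_iff)
    finally show ?thesis
      unfolding L_iff l'_def using subspace_diff[OF A.fib_subspace ei[OF i] sX] by simp
  qed
  have "\<exists>t N. t \<in> sections M A \<and> open N \<and> x \<in> N \<and> N \<subseteq> N0 \<and> (\<forall>z\<in>N. t z = l' i z)" if i: "i < n" for i
  proof -
    have "sec_at M A (l' i) z" if "z \<in> N0" for z
      unfolding l'_def[abs_def] using that i
      by (intro sec_at_diff sec_at_sum sec_at_scale cs A.sectionsD(2) A.local_frameD(2)[OF e(1)] X(4)) auto
    moreover have "l' i z \<in> fib A z" if "z \<in> N0" for z using l'L[OF i that] by (simp add: L_iff)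
    ultimately show ?thesis using A.globalize_section[OF A.local_frameD(1)[OF e(1)] e(2), of "l' i"] by metis
  qed
  then obtain l N' where l: "\<And>i. i < n \<Longrightarrow> l i \<in> sections M A" "\<And>i. i < n \<Longrightarrow> open (N' i)"
    "\<And>i. i < n \<Longrightarrow> x \<in> N' i" "\<And>i z. i < n \<Longrightarrow> z \<in> N' i \<Longrightarrow> l i z = l' i z"
    by metis
  define N where "N = N0 \<inter> (\<Inter>i<n. N' i)"
  have N: "open N" "x \<in> N" "N \<subseteq> N0"
    unfolding N_def using A.local_frameD(1)[OF e(1)] e(2) l(2,3) by (auto intro!: open_Int open_INT)
  have ll': "l i z = l' i z" if "i < n" "z \<in> N" for i z using l(4) that by (auto simp: N_def)
  define Xv where "Xv v y = (\<Sum>j<?d. bcoef ?d ((!) bs) v j *\<^sub>R X j y)" for v y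
  show ?thesis
  proof (rule that)
    show "open N" "x \<in> N" "N \<subseteq> W" using N e(3) X(3) by auto
    show "l i \<in> sections M A" if "i < n" for i by (rule l(1)[OF that])
    show "l i y \<in> L y" if "i < n" "y \<in> N" for i y using l'L ll' that N(3) by auto
    show "Xv v \<in> sections M A" for v
      unfolding Xv_def[abs_def]
      by (intro A.sections_sum_fun A.sections_scale_fun X(4)) (auto simp: smooth_funs_iff)
    show "\<rho> y (Xv v y) = coord_field M W \<phi> v y" if v: "v \<in> model M" and y: "y \<in> N" for v y
    proof -
      have y': "y \<in> N1" "y \<in> W" using y N(3) e(3) X(3) by auto
      have "\<rho> y (Xv v y) = (\<Sum>j<?d. bcoef ?d ((!) bs) v j *\<^sub>R ?D j y)"
        unfolding Xv_def by (rule \<rho>X[OF y'(1)])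
      also have "\<dots> = coord_field M W \<phi> (\<Sum>j<?d. bcoef ?d ((!) bs) v j *\<^sub>R bs ! j) y"
        by (rule coord_field_sum[OF chart y'(2) t(2), symmetric])
      finally show ?thesis by (simp add: bcoef_sum[OF t(1) v])
    qed
    fix s assume s: "s \<in> sections M A"
    define a where "a m y = bcoef n (\<lambda>i. e i y) (s y) m" for m y
    have "smooth_at M (a m) y" if "m < n" "y \<in> N" for m y
      unfolding a_def[abs_def] using that N(3) s by (intro A.local_frameD(4)[OF e(1)] A.sectionsD(2)) auto
    moreover have "s y = (\<Sum>m<n. a m y *\<^sub>R l m y)" if y: "y \<in> N" and sL: "s y \<in> L y" for y
    proof -
      have y': "y \<in> N0" "y \<in> N1" "y \<in> W" using y N(3) e(3) X(3) by auto
      have sy: "s y = (\<Sum>m<n. a m y *\<^sub>R e m y)"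
        using A.local_frame_expand[OF e(1) y'(1) A.sectionsD(1)[OF s]] by (simp add: a_def)
      have "0 = \<rho> y (\<Sum>m<n. a m y *\<^sub>R e m y)" using sL sy by (simp add: L_iff)
      also have "\<dots> = (\<Sum>m<n. a m y *\<^sub>R \<rho> y (e m y))"
        by (rule bundle_map_sum[OF anchor_map A.fib_subspace ei])
      also have "\<dots> = (\<Sum>j<?d. (\<Sum>m<n. a m y * c j m y) *\<^sub>R ?D j y)"
        by (simp add: \<rho>e[OF _ y'(3)] scaleR_sum_right scaleR_sum_left) (rule sum.swap)
      finally have z: "(\<Sum>m<n. a m y * c j m y) = 0" if "j < ?d" for j
        using t(3)[OF y'(3), unfolded basis_fam_def, THEN conjunct2, THEN conjunct2, rule_format,
            of "\<lambda>j. \<Sum>m<n. a m y * c j m y"] that by simp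
      have "(\<Sum>m<n. a m y *\<^sub>R l m y) = (\<Sum>m<n. a m y *\<^sub>R e m y - (\<Sum>j<?d. (a m y * c j m y) *\<^sub>R X j y))"
        using ll' y by (intro sum.cong) (auto simp: l'_def scaleR_right_diff_distrib scaleR_sum_right)
      also have "\<dots> = s y - (\<Sum>m<n. \<Sum>j<?d. (a m y * c j m y) *\<^sub>R X j y)"
        by (simp add: sum_subtractf sy)
      also have "(\<Sum>m<n. \<Sum>j<?d. (a m y * c j m y) *\<^sub>R X j y) = (\<Sum>j<?d. (\<Sum>m<n. a m y * c j m y) *\<^sub>R X j y)"
        by (subst sum.swap) (simp add: scaleR_sum_left)
      also have "\<dots> = 0" using z by simp
      finally show ?thesis by simp
    qed
    ultimately show "\<exists>a. (\<forall>m<n. \<forall>y\<in>N. smooth_at M (a m) y) \<and>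
      (\<forall>y\<in>N. s y \<in> L y \<longrightarrow> s y = (\<Sum>m<n. a m y *\<^sub>R l m y))" by blast
  qed
qed

text \<open>A combination of the local spanning sections is cut off; the result is a multiple of it
  at each point and so lies in \<open>L\<close> everywhere. This is the form of section on which a
  cocycle vanishing on \<open>L\<close> can be evaluated globally.\<close>

lemma L_section_through:
  assumes "u \<in> L y"
  obtains a where "a \<in> sections M A" "a y = u" "\<And>z. a z \<in> L z"
proof -
  obtain W \<phi> where c: "(W, \<phi>) \<in> charts M" "y \<in> W" by (rule chart_exists)
  obtain N and n :: nat and l where l: "open N" "y \<in> N" "\<And>i. i < n \<Longrightarrow> l i \<in> sections M A"
    "\<And>i y. i < n \<Longrightarrow> y \<in> N \<Longrightarrow> l i y \<in> L y"
    "\<And>s. s \<in> sections M A \<Longrightarrow> \<exists>a. (\<forall>m<n. \<forall>y\<in>N. smooth_at M (a m) y) \<and>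
      (\<forall>y\<in>N. s y \<in> L y \<longrightarrow> s y = (\<Sum>m<n. a m y *\<^sub>R l m y))"
  proof (rule local_structure[OF c], goal_cases)
    case (1 N n l X)
    then show ?case by (intro that[of N n l])
  qed
  obtain s where s: "s \<in> sections M A" "s y = u" using A.section_through assms by (metis L_iff)
  obtain a where a: "s y = (\<Sum>m<n. a m y *\<^sub>R l m y)" using l(5)[OF s(1)] l(2) assms s(2) by metis
  define t where "t z = (\<Sum>m<n. a m y *\<^sub>R l m z)" for z
  have t: "t \<in> sections M A" unfolding t_def[abs_def]
    by (intro A.sections_sum_fun A.sections_scale_fun l(3)) (auto simp: smooth_funs_iff)
  have tL: "t z \<in> L z" if "z \<in> N" for z
    unfolding t_def using l(4) that by (intro subspace_sum subspace_scale subspace_L) auto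
  obtain r N' where r: "r \<in> sections M A" "y \<in> N'" "\<And>z. z \<in> N' \<Longrightarrow> r z = t z"
    "\<And>z. \<exists>k. r z = k *\<^sub>R t z \<and> (k \<noteq> 0 \<longrightarrow> z \<in> N)"
    using A.globalize_section[OF l(1,2), of t] A.sectionsD[OF t] by metis
  have "r z \<in> L z" for z
  proof -
    obtain k where "r z = k *\<^sub>R t z" "k \<noteq> 0 \<longrightarrow> z \<in> N" using r(4) by blast
    then show ?thesis using tL subspace_scale[OF subspace_L] subspace_0[OF subspace_L] by (cases "k = 0") auto
  qed
  moreover have "r y = u" using r(2,3) a s(2) by (simp add: t_def)
  ultimately show ?thesis using that r(1) by blast
qed

end

section \<open>The bundle of invariants\<close>

context algebroid_rep
begin

text \<open>\<open>cocycles1\<close> without the normalisation outside the fibres, so that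
  \<open>\<lambda>y u. R y u \<mu>\<close> qualifies as it stands.\<close>

definition cocycle_map :: "('m \<Rightarrow> 'a \<Rightarrow> 'f) \<Rightarrow> bool" where
  "cocycle_map \<Omega> \<longleftrightarrow> bundle_map M A F \<Omega> \<and> (\<forall>a\<in>sections M A. \<forall>b\<in>sections M A. \<forall>y.
     \<Omega> y (bracket A a b y) = R y (a y) (\<lambda>z. \<Omega> z (b z)) - R y (b y) (\<lambda>z. \<Omega> z (a z)))"

text \<open>\<open>\<nu>\<close> is a primitive, in Lie algebra cohomology, of the restriction of
  \<open>\<Omega>\<close> to \<open>L y\<close>. For the zero cocycle this is invariance, so the
  subbundle of invariants and the kernel of localization are treated by the same linear
  system.\<close>

definition solves :: "('m \<Rightarrow> 'a \<Rightarrow> 'f) \<Rightarrow> 'm \<Rightarrow> 'f \<Rightarrow> bool" where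
  "solves \<Omega> y \<nu> \<longleftrightarrow> \<nu> \<in> fib F y \<and> (\<forall>u\<in>L y. adjoint_action M F R y u \<nu> = \<Omega> y u)"

abbreviation "F\<^sub>0 \<equiv> invariant_fib M A F R"

lemma F0_iff: "\<nu> \<in> F\<^sub>0 y \<longleftrightarrow> solves (\<lambda>_ _. 0) y \<nu>"
  by (simp add: invariant_fib_def solves_def)

lemma solves_section:
  "\<mu> \<in> sections M F \<Longrightarrow> solves \<Omega> y (\<mu> y) \<longleftrightarrow> (\<forall>u\<in>L y. R y u \<mu> = \<Omega> y u)"
  by (simp add: solves_def adjoint_action_eq F.sectionsD(1))

lemma adjoint_action_linear:
  assumes "u \<in> L y" "\<mu> \<in> fib F y" "\<nu> \<in> fib F y"
  shows "adjoint_action M F R y u (r *\<^sub>R \<mu> + t *\<^sub>R \<nu>) =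
    r *\<^sub>R adjoint_action M F R y u \<mu> + t *\<^sub>R adjoint_action M F R y u \<nu>"
proof -
  obtain s where s: "s \<in> sections M F" "s y = \<mu>" using F.section_through[OF assms(2)] .
  obtain s' where s': "s' \<in> sections M F" "s' y = \<nu>" using F.section_through[OF assms(3)] .
  have u: "u \<in> fib A y" using assms(1) by (simp add: L_iff)
  have rs: "r *\<^sub>R s \<in> sections M F" "t *\<^sub>R s' \<in> sections M F" using s s' F.sections_scale by auto
  have "adjoint_action M F R y u ((r *\<^sub>R s + t *\<^sub>R s') y) = R y u (r *\<^sub>R s + t *\<^sub>R s')"
    by (rule adjoint_action_eq[OF assms(1) F.sections_add[OF rs]])
  also have "\<dots> = r *\<^sub>R R y u s + t *\<^sub>R R y u s'"
    by (simp add: R_plus[OF u rs] R_scaleR[OF u] s s')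
  finally show ?thesis
    using adjoint_action_eq[OF assms(1) s(1)] adjoint_action_eq[OF assms(1) s'(1)] s(2) s'(2)
    by (simp add: plus_fun_def scaleR_fun_def)
qed

lemma solves_combination:
  assumes "solves \<Omega> y \<mu>" "solves \<Omega>' y \<nu>"
  shows "solves (\<lambda>y u. r *\<^sub>R \<Omega> y u + t *\<^sub>R \<Omega>' y u) y (r *\<^sub>R \<mu> + t *\<^sub>R \<nu>)"
  using assms unfolding solves_def
  by (auto simp: adjoint_action_linear intro!: subspace_add subspace_scale F.fib_subspace)

lemma subspace_F0: "subspace (F\<^sub>0 y)"
proof -
  have 0: "solves (\<lambda>_ _. 0) y 0"
    using solves_section[OF F.sections_zero] by (simp add: R_zero L_iff)
  show ?thesis
    unfolding subspace_def F0_iff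
    using 0 solves_combination[of "\<lambda>_ _. 0" y _ "\<lambda>_ _. 0" _ 1 1]
      solves_combination[of "\<lambda>_ _. 0" y _ "\<lambda>_ _. 0" 0 _ 0]
    by (auto simp: F0_iff)
qed

lemma F0_subset: "\<nu> \<in> F\<^sub>0 y \<Longrightarrow> \<nu> \<in> fib F y"
  by (simp add: invariant_fib_def)

lemma cocycle_map_R: "\<mu> \<in> sections M F \<Longrightarrow> cocycle_map (\<lambda>y u. R y u \<mu>)"
  unfolding cocycle_map_def using R_bundle_map R_bracket by blast

lemma bundle_map_zero: "bundle_map M A F (\<lambda>_ _. 0)"
  unfolding bundle_map_def
  using subspace_0[OF F.fib_subspace] sec_at_zero
  by (auto simp: smooth_section_on_iff[OF F.framed framedD(2)[OF A.framed]])

lemma cocycle_map_zero: "cocycle_map (\<lambda>_ _. 0)"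
  unfolding cocycle_map_def using bundle_map_zero R_zero A.sectionsD(1) by auto

text \<open>The columns of the linear system are the cocycles \<open>R (f b)\<close> for a frame \<open>f\<close> of \<open>F\<close> and the
  given cocycle \<open>\<Omega>\<close>, evaluated on sections spanning \<open>L\<close>; the cocycle identity for a lift of a
  coordinate field and a section of \<open>L\<close> is the differential equation required by \<open>constant_rank\<close>.\<close>

lemma local_solutions:
  assumes \<Omega>: "cocycle_map \<Omega>"
  obtains N q \<nu> \<sigma> where "open N" "x \<in> N" "\<And>i y. i < q \<Longrightarrow> y \<in> N \<Longrightarrow> sec_at M F (\<nu> i) y"
    "\<And>y. y \<in> N \<Longrightarrow> basis_fam q (\<lambda>i. \<nu> i y) (F\<^sub>0 y)"
    "\<And>y. y \<in> N \<Longrightarrow> sec_at M F \<sigma> y"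
    "\<And>y z. y \<in> N \<Longrightarrow> z \<in> N \<Longrightarrow> \<exists>w. solves \<Omega> z w \<Longrightarrow> solves \<Omega> y (\<sigma> y)"
proof -
  obtain W \<phi> where chart: "(W, \<phi>) \<in> charts M" "x \<in> W" by (rule chart_exists)
  obtain N1 and n :: nat and l X where l: "open N1" "x \<in> N1" "N1 \<subseteq> W" "\<And>i. i < n \<Longrightarrow> l i \<in> sections M A"
    "\<And>i y. i < n \<Longrightarrow> y \<in> N1 \<Longrightarrow> l i y \<in> L y"
    "\<And>v. v \<in> model M \<Longrightarrow> X v \<in> sections M A"
    "\<And>v y. v \<in> model M \<Longrightarrow> y \<in> N1 \<Longrightarrow> \<rho> y (X v y) = coord_field M W \<phi> v y"
    "\<And>s. s \<in> sections M A \<Longrightarrow> \<exists>a. (\<forall>m<n. \<forall>y\<in>N1. smooth_at M (a m) y) \<and>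
      (\<forall>y\<in>N1. s y \<in> L y \<longrightarrow> s y = (\<Sum>m<n. a m y *\<^sub>R l m y))"
  proof (rule local_structure[OF chart], goal_cases)
    case (1 N1 n l X)
    then show ?case by (intro that[of N1 n l X])
  qed
  obtain N k f where f: "F.local_frame N k f" "x \<in> N" "N \<subseteq> N1"
    using F.local_frame_exists[OF l(1,2)] by metis
  have oN: "open N" by (rule F.local_frameD(1)[OF f(1)])
  have NW: "N \<subseteq> W" using f(3) l(3) by blast
  have fs: "f b \<in> sections M F" if "b < k" for b by (rule F.local_frameD(2)[OF f(1) that])
  have bf: "basis_fam k (\<lambda>b. f b y) (fib F y)" if "y \<in> N" for y by (rule F.local_frameD(3)[OF f(1) that])
  define cf where "cf w y a = bcoef k (\<lambda>b. f b y) w a" for w y a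
  have cf: "w = (\<Sum>a<k. cf w y a *\<^sub>R f a y)" if "y \<in> N" "w \<in> fib F y" for w y
    using bcoef_sum[OF bf[OF that(1)] that(2)] by (simp add: cf_def)
  have cf_eq: "cf (\<Sum>a<k. g a *\<^sub>R f a y) y a = g a" if "y \<in> N" "a < k" for g y a
    unfolding cf_def by (rule bcoef_eq[OF bf[OF that(1)] F.fib_subspace that(2)])
  have cf_smooth: "smooth_at M (\<lambda>z. cf (s z) z a) y" if "s \<in> sections M F" "y \<in> N" "a < k" for s y a
    unfolding cf_def by (rule F.local_frameD(4)[OF f(1) that(2) F.sectionsD(2)[OF that(1)] that(3)])
  \<comment> \<open>Index \<open>k\<close>, just past the frame, stands for the given cocycle and is
    the single right-hand side in \<open>?J\<close>.\<close>
  define P where "P c = (if c < k then (\<lambda>y u. R y u (f c)) else \<Omega>)" for c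
  have P: "cocycle_map (P c)" for c using cocycle_map_R[OF fs] \<Omega> by (simp add: P_def)
  have Pb: "bundle_map M A F (P c)" for c using P by (simp add: cocycle_map_def)
  have P_bracket: "P c y (bracket A a b y) = R y (a y) (\<lambda>z. P c z (b z)) - R y (b y) (\<lambda>z. P c z (a z))"
    if "a \<in> sections M A" "b \<in> sections M A" for a b c y
    using P that unfolding cocycle_map_def by blast
  have P_section: "(\<lambda>z. P c z (a z)) \<in> sections M F" if "a \<in> sections M A" for a c
    by (rule bundle_map_section[OF Pb that])
  define T where "T = (\<lambda>(i, a) c y. cf (P c y (l i y)) y a)"
  let ?I = "{..<n} \<times> {..<k}" and ?B = "{..<k}" and ?J = "{k}"
  have sT: "smooth_at M (T ia c) y" if "ia \<in> ?I" "y \<in> N" for ia c y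
    using that cf_smooth[OF P_section[OF l(4)]] by (auto simp: T_def)
  have T_expand: "P c y (l i y) = (\<Sum>a<k. T (i, a) c y *\<^sub>R f a y)" if "i < n" "y \<in> N" for i c y
    unfolding T_def prod.case by (rule cf[OF that(2) F.sectionsD(1)[OF P_section[OF l(4)[OF that(1)]]]])
  have R_T: "R y (l i y) (f b) = (\<Sum>a<k. T (i, a) b y *\<^sub>R f a y)" if "i < n" "y \<in> N" "b < k" for i b y
    using T_expand[OF that(1,2), of b] that(3) by (simp add: P_def)
  have eqT: "linear_pde W \<phi> N ?I ?B ?J T"
    unfolding linear_pde_def
  proof
    fix v assume v: "v \<in> model M"
    note Xs = l(6)[OF v]
    have "\<exists>a. (\<forall>m<n. \<forall>y\<in>N1. smooth_at M (a m) y) \<and>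
      (\<forall>y\<in>N1. bracket A (X v) (l i) y \<in> L y \<longrightarrow> bracket A (X v) (l i) y = (\<Sum>m<n. a m y *\<^sub>R l m y))" if "i < n" for i
      by (rule l(8)[OF bracket_section[OF Xs l(4)[OF that]]])
    then have "\<forall>i. \<exists>a. i < n \<longrightarrow> (\<forall>m<n. \<forall>y\<in>N1. smooth_at M (a m) y) \<and>
      (\<forall>y\<in>N1. bracket A (X v) (l i) y \<in> L y \<longrightarrow> bracket A (X v) (l i) y = (\<Sum>m<n. a m y *\<^sub>R l m y))"
      by simp
    from choice[OF this] obtain h where h: "\<forall>i. i < n \<longrightarrow> (\<forall>m<n. \<forall>y\<in>N1. smooth_at M (h i m) y) \<and>
      (\<forall>y\<in>N1. bracket A (X v) (l i) y \<in> L y \<longrightarrow> bracket A (X v) (l i) y = (\<Sum>m<n. h i m y *\<^sub>R l m y))"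
      by (elim exE)
    define G where "G b c y = cf (P c y (X v y)) y b" for b c y
    have sG: "smooth_at M (G b c) y" if "b < k" "y \<in> N" for b c y
      unfolding G_def[abs_def] by (rule cf_smooth[OF P_section[OF Xs] that(2,1)])
    have G_expand: "P c y (X v y) = (\<Sum>a<k. G a c y *\<^sub>R f a y)" if "y \<in> N" for c y
      unfolding G_def by (rule cf[OF that F.sectionsD(1)[OF P_section[OF Xs]]])
    have R_G: "R y (X v y) (f b) = (\<Sum>a<k. G a b y *\<^sub>R f a y)" if "y \<in> N" "b < k" for b y
      using G_expand[OF that(1), of b] that(2) by (simp add: P_def)
    \<comment> \<open>\<open>h\<close> holds the coefficients of the bracket of the lift with
      \<open>l i\<close> in the spanning sections; \<open>G a b\<close> with \<open>b\<close> below
      \<open>k\<close> are the connection coefficients of the lift in the frame \<open>f\<close>,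
      which enter with a minus sign after solving for the derivative.\<close>
    define C where "C = (\<lambda>(i, a) (m, b) y. (if b = a then h i m y else 0) - (if m = i then G a b y else 0))"
    have key: "dird W \<phi> v (T (i, a) c) y = (\<Sum>j\<in>?I. C (i, a) j y * T j c y) + (\<Sum>b\<in>?B. T (i, a) b y * G b c y)"
      if y: "y \<in> N" and i: "i < n" and a: "a < k" for i a c y
    proof -
      have yW: "y \<in> W" and y1: "y \<in> N1" using y NW f(3) by auto
      have fX: "X v y \<in> fib A y" by (rule A.sectionsD(1)[OF Xs])
      have fl: "l m y \<in> fib A y" if "m < n" for m by (rule A.sectionsD(1)[OF l(4)[OF that]])
      have "bracket A (X v) (l i) y \<in> L y"
        by (rule bracket_in_L[OF Xs l(4)[OF i] l(1) y1 l(5)[OF i]])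
      then have br: "bracket A (X v) (l i) y = (\<Sum>m<n. h i m y *\<^sub>R l m y)" using h i y1 by blast
      have "P c y (bracket A (X v) (l i) y) = (\<Sum>m<n. h i m y *\<^sub>R P c y (l m y))"
        unfolding br by (rule bundle_map_sum[OF Pb A.fib_subspace fl])
      also have "\<dots> = (\<Sum>m<n. \<Sum>a<k. (h i m y * T (m, a) c y) *\<^sub>R f a y)"
        using T_expand[OF _ y] by (simp add: scaleR_sum_right)
      also have "\<dots> = (\<Sum>a<k. (\<Sum>m<n. h i m y * T (m, a) c y) *\<^sub>R f a y)"
        by (subst sum.swap) (simp add: scaleR_sum_left)
      finally have 1: "P c y (bracket A (X v) (l i) y) = (\<Sum>a<k. (\<Sum>m<n. h i m y * T (m, a) c y) *\<^sub>R f a y)" .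
      have "R y (X v y) (\<lambda>z. P c z (l i z)) =
          (\<Sum>b<k. dird W \<phi> v (T (i, b) c) y *\<^sub>R f b y + T (i, b) c y *\<^sub>R R y (X v y) (f b))"
        by (rule R_expand[OF chart(1) yW fX l(7)[OF v y1] v oN y fs _ P_section[OF l(4)[OF i]]])
          (use sT i T_expand[OF i] in auto)
      also have "\<dots> = (\<Sum>b<k. dird W \<phi> v (T (i, b) c) y *\<^sub>R f b y) + (\<Sum>b<k. T (i, b) c y *\<^sub>R (\<Sum>a<k. G a b y *\<^sub>R f a y))"
        using R_G[OF y] by (simp add: sum.distrib)
      also have "(\<Sum>b<k. T (i, b) c y *\<^sub>R (\<Sum>a<k. G a b y *\<^sub>R f a y)) = (\<Sum>a<k. (\<Sum>b<k. G a b y * T (i, b) c y) *\<^sub>R f a y)"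
        by (simp add: scaleR_sum_right scaleR_sum_left mult.commute) (rule sum.swap)
      finally have 2: "R y (X v y) (\<lambda>z. P c z (l i z)) =
          (\<Sum>a<k. (dird W \<phi> v (T (i, a) c) y + (\<Sum>b<k. G a b y * T (i, b) c y)) *\<^sub>R f a y)"
        by (simp add: sum.distrib scaleR_left_distrib)
      \<comment> \<open>Elements of \<open>L\<close> have symbol 0, which is the coordinate vector
        for \<open>v = 0\<close>; the derivative terms of \<open>R_expand\<close> then
        vanish.\<close>
      have "\<rho> y (l i y) = coord_field M W \<phi> 0 y"
        using l(5)[OF i y1] by (simp add: L_iff coord_field_zero[OF chart(1)])
      then have "R y (l i y) (\<lambda>z. P c z (X v z)) =
          (\<Sum>b<k. dird W \<phi> 0 (G b c) y *\<^sub>R f b y + G b c y *\<^sub>R R y (l i y) (f b))"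
        by (rule R_expand[OF chart(1) yW fl[OF i] _ subspace_0[OF model_subspace] oN y fs _ P_section[OF Xs]])
          (use sG G_expand in auto)
      also have "\<dots> = (\<Sum>b<k. G b c y *\<^sub>R (\<Sum>a<k. T (i, a) b y *\<^sub>R f a y))"
        using R_T[OF i y] by (simp add: dird_def)
      also have "\<dots> = (\<Sum>a<k. (\<Sum>b<k. T (i, a) b y * G b c y) *\<^sub>R f a y)"
        by (simp add: scaleR_sum_right scaleR_sum_left mult.commute) (rule sum.swap)
      finally have 3: "R y (l i y) (\<lambda>z. P c z (X v z)) = (\<Sum>a<k. (\<Sum>b<k. T (i, a) b y * G b c y) *\<^sub>R f a y)" .
      have "(\<Sum>a<k. (\<Sum>m<n. h i m y * T (m, a) c y) *\<^sub>R f a y) =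
        (\<Sum>a<k. (dird W \<phi> v (T (i, a) c) y + (\<Sum>b<k. G a b y * T (i, b) c y) - (\<Sum>b<k. T (i, a) b y * G b c y)) *\<^sub>R f a y)"
        using P_bracket[OF Xs l(4)[OF i], of c y] unfolding 1 2 3
        by (simp add: scaleR_left_diff_distrib sum_subtractf)
      from basis_fam_unique[OF bf[OF y] this a]
      have 4: "dird W \<phi> v (T (i, a) c) y = (\<Sum>m<n. h i m y * T (m, a) c y) - (\<Sum>b<k. G a b y * T (i, b) c y)
          + (\<Sum>b<k. T (i, a) b y * G b c y)" by simp
      have "(\<Sum>j\<in>?I. C (i, a) j y * T j c y) = (\<Sum>m<n. \<Sum>b<k. C (i, a) (m, b) y * T (m, b) c y)"
        by (subst sum.cartesian_product) (auto intro: sum.cong)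
      also have "\<dots> = (\<Sum>m<n. \<Sum>b<k. (if b = a then h i m y * T (m, b) c y else 0) -
          (if m = i then G a b y * T (m, b) c y else 0))"
        by (intro sum.cong) (auto simp: C_def algebra_simps)
      also have "\<dots> = (\<Sum>m<n. \<Sum>b<k. if b = a then h i m y * T (m, b) c y else 0) -
          (\<Sum>b<k. \<Sum>m<n. if m = i then G a b y * T (m, b) c y else 0)"
        by (subst (3) sum.swap) (simp add: sum_subtractf)
      also have "\<dots> = (\<Sum>m<n. h i m y * T (m, a) c y) - (\<Sum>b<k. G a b y * T (i, b) c y)"
        using a i by simp
      finally show ?thesis using 4 by simp
    qed
    have "continuous_on N (C ia mb)" if "ia \<in> ?I" "mb \<in> ?I" for ia mb
    proof -
      obtain i a m b where [simp]: "ia = (i, a)" "mb = (m, b)" by (metis surj_pair)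
      have "continuous_on N (h i m)" "continuous_on N (G a b)"
        using h that f(3) sG by (auto intro!: smooth_at_continuous_on)
      then show ?thesis unfolding C_def
        by (cases "b = a"; cases "m = i") (auto intro!: continuous_intros)
    qed
    moreover have "continuous_on N (G b c)" if "b < k" for b c
      using sG that by (auto intro!: smooth_at_continuous_on)
    ultimately show "\<exists>C G. (\<forall>i\<in>?I. \<forall>j\<in>?I. continuous_on N (C i j)) \<and>
      (\<forall>b\<in>?B. \<forall>c\<in>?B \<union> ?J. continuous_on N (G b c)) \<and>
      (\<forall>y\<in>N. \<forall>i\<in>?I. \<forall>c\<in>?B \<union> ?J. dird W \<phi> v (T i c) y =
        (\<Sum>j\<in>?I. C i j y * T j c y) + (\<Sum>b\<in>?B. T i b y * G b c y))"
      using key by (intro exI[of _ C] exI[of _ G]) auto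
  qed
  obtain N' Q s where N': "open N'" "x \<in> N'" "N' \<subseteq> N" and piv: "pivoted N' Q s ?I ?B ?J T"
    using constant_rank[OF chart(1) _ _ _ oN f(2) NW _ eqT] sT by auto
  note piv' = piv[unfolded pivoted_def]
  note cr = N' piv'[THEN conjunct1] piv'[THEN conjunct2, THEN conjunct1]
    piv'[THEN conjunct2, THEN conjunct2, THEN conjunct1]
    piv'[THEN conjunct2, THEN conjunct2, THEN conjunct2, THEN conjunct1]
    piv'[THEN conjunct2, THEN conjunct2, THEN conjunct2, THEN conjunct2]
  have finQ: "finite Q" using cr(4) finite_subset by blast
  \<comment> \<open>The free columns; each of them contributes one basis vector of the
    kernel.\<close>
  define B' where "B' = {..<k} - Q"
  have split_B: "(\<Sum>b<k. g b) = (\<Sum>b\<in>Q. g b) + (\<Sum>b\<in>B'. g b)" for g :: "nat \<Rightarrow> 'w::comm_monoid_add"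
    unfolding B'_def using sum.subset_diff[OF cr(4)] by (simp add: add.commute)
  have solves_iff: "(\<forall>u\<in>L y. \<Omega>' y u = R y u (\<lambda>z. \<Sum>b<k. w b *\<^sub>R f b z)) \<longleftrightarrow>
      (\<forall>(i, a)\<in>?I. cf (\<Omega>' y (l i y)) y a = (\<Sum>b<k. w b * T (i, a) b y))"
    if y: "y \<in> N" and \<Omega>': "bundle_map M A F \<Omega>'" for \<Omega>' y w
  proof -
    have Rw: "R y u (\<lambda>z. \<Sum>b<k. w b *\<^sub>R f b z) = (\<Sum>b<k. w b *\<^sub>R R y u (f b))" if "u \<in> fib A y" for u
    proof -
      have "(\<lambda>z. w b *\<^sub>R f b z) \<in> sections M F" if "b < k" for b
        using F.sections_scale[OF fs[OF that]] by (simp add: scaleR_fun_def)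
      moreover have "R y u (\<lambda>z. w b *\<^sub>R f b z) = w b *\<^sub>R R y u (f b)" if "b < k" for b
        using R_scaleR[OF \<open>u \<in> fib A y\<close> fs[OF that]] by (simp add: scaleR_fun_def)
      ultimately show ?thesis using R_sum[OF \<open>u \<in> fib A y\<close>, of k "\<lambda>b z. w b *\<^sub>R f b z"] by simp
    qed
    have y1: "y \<in> N1" using y f(3) by blast
    have fl: "l m y \<in> fib A y" if "m < n" for m by (rule A.sectionsD(1)[OF l(4)[OF that]])
    have Rl: "R y (l i y) (\<lambda>z. \<Sum>b<k. w b *\<^sub>R f b z) = (\<Sum>a<k. (\<Sum>b<k. w b * T (i, a) b y) *\<^sub>R f a y)" if "i < n" for i
    proof -
      have "R y (l i y) (\<lambda>z. \<Sum>b<k. w b *\<^sub>R f b z) = (\<Sum>b<k. w b *\<^sub>R (\<Sum>a<k. T (i, a) b y *\<^sub>R f a y))"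
        unfolding Rw[OF fl[OF that]] using R_T[OF that y] by simp
      then show ?thesis by (simp add: scaleR_sum_right scaleR_sum_left) (rule sum.swap)
    qed
    show ?thesis
    proof
      assume *: "\<forall>u\<in>L y. \<Omega>' y u = R y u (\<lambda>z. \<Sum>b<k. w b *\<^sub>R f b z)"
      show "\<forall>(i, a)\<in>?I. cf (\<Omega>' y (l i y)) y a = (\<Sum>b<k. w b * T (i, a) b y)"
      proof -
        have "cf (\<Omega>' y (l i y)) y a = (\<Sum>b<k. w b * T (i, a) b y)" if ia: "i < n" "a < k" for i a
        proof -
          have "\<Omega>' y (l i y) = (\<Sum>a<k. (\<Sum>b<k. w b * T (i, a) b y) *\<^sub>R f a y)"
            using * l(5)[OF ia(1) y1] Rl[OF ia(1)] by auto
          then show ?thesis using cf_eq[OF y, of a] ia by simp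
        qed
        then show ?thesis by auto
      qed
    next
      assume *: "\<forall>(i, a)\<in>?I. cf (\<Omega>' y (l i y)) y a = (\<Sum>b<k. w b * T (i, a) b y)"
      show "\<forall>u\<in>L y. \<Omega>' y u = R y u (\<lambda>z. \<Sum>b<k. w b *\<^sub>R f b z)"
      proof
        fix u assume u: "u \<in> L y"
        then obtain r where r: "r \<in> sections M A" "r y = u" using A.section_through by (metis L_iff)
        obtain g where g: "u = (\<Sum>m<n. g m y *\<^sub>R l m y)" using l(8)[OF r(1)] y1 u r(2) by blast
        have "\<Omega>' y (l m y) = R y (l m y) (\<lambda>z. \<Sum>b<k. w b *\<^sub>R f b z)" if m: "m < n" for m
        proof -
          have "\<Omega>' y (l m y) = (\<Sum>a<k. cf (\<Omega>' y (l m y)) y a *\<^sub>R f a y)"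
            by (rule cf[OF y bundle_map_in[OF \<Omega>' fl[OF m]]])
          also have "\<dots> = (\<Sum>a<k. (\<Sum>b<k. w b * T (m, a) b y) *\<^sub>R f a y)"
            using * m by (intro sum.cong) auto
          finally show ?thesis using Rl[OF m] by simp
        qed
        moreover have "\<Omega>' y u = (\<Sum>m<n. g m y *\<^sub>R \<Omega>' y (l m y))"
          unfolding g by (rule bundle_map_sum[OF \<Omega>' A.fib_subspace fl])
        moreover have "R y u (\<lambda>z. \<Sum>b<k. w b *\<^sub>R f b z) = (\<Sum>m<n. g m y *\<^sub>R R y (l m y) (\<lambda>z. \<Sum>b<k. w b *\<^sub>R f b z))"
          unfolding g
        proof (rule R_sum_left[OF _ fl])
          show "(\<lambda>z. \<Sum>b<k. w b *\<^sub>R f b z) \<in> sections M F"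
            by (intro F.sections_sum_fun F.sections_scale_fun fs) (auto simp: smooth_funs_iff)
        qed
        ultimately show "\<Omega>' y u = R y u (\<lambda>z. \<Sum>b<k. w b *\<^sub>R f b z)" by simp
      qed
    qed
  qed
  have wsec: "(\<lambda>z. \<Sum>b<k. w b *\<^sub>R f b z) \<in> sections M F" for w
    by (intro F.sections_sum_fun F.sections_scale_fun fs) (auto simp: smooth_funs_iff)
  have solves_coord: "solves \<Omega>' y (\<Sum>b<k. w b *\<^sub>R f b y) \<longleftrightarrow>
      (\<forall>(i, a)\<in>?I. cf (\<Omega>' y (l i y)) y a = (\<Sum>b<k. w b * T (i, a) b y))"
    if "y \<in> N" "bundle_map M A F \<Omega>'" for \<Omega>' y w
    unfolding solves_iff[OF that, of w, symmetric] by (auto simp: solves_section[OF wsec, of \<Omega>' y w])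
  have cf0: "cf 0 y a = 0" if "y \<in> N" "a < k" for y a
    using cf_eq[OF that, of "\<lambda>_. 0"] by simp
  have F0_coord: "(\<Sum>b<k. w b *\<^sub>R f b y) \<in> F\<^sub>0 y \<longleftrightarrow> (\<forall>i\<in>?I. (\<Sum>b<k. w b * T i b y) = 0)" if "y \<in> N" for y w
    unfolding F0_iff solves_coord[OF that bundle_map_zero] using cf0[OF that] by (force simp: eq_commute[of 0])
  obtain e where e: "bij_betw e {..<card B'} B'"
    using ex_bij_betw_nat_finite[of B'] by (auto simp: B'_def atLeast0LessThan)
  have reindex: "(\<Sum>j<card B'. g (e j)) = (\<Sum>b\<in>B'. g b)" for g :: "nat \<Rightarrow> 'w::comm_monoid_add"
    by (rule sum.reindex_bij_betw[OF e])
  \<comment> \<open>The kernel vector of the free column \<open>b\<close>: the frame section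
    \<open>f b\<close> minus the combination of pivot sections whose columns reproduce column
    \<open>b\<close>.\<close>
  define \<nu>' where "\<nu>' b z = f b z - (\<Sum>p\<in>Q. s p b z *\<^sub>R f p z)" for b z
  have combine: "(\<Sum>b\<in>B'. g b *\<^sub>R \<nu>' b z) = (\<Sum>b<k. (if b \<in> Q then - (\<Sum>c\<in>B'. g c * s b c z) else g b) *\<^sub>R f b z)" for g z
  proof -
    have "(\<Sum>b\<in>B'. g b *\<^sub>R \<nu>' b z) = (\<Sum>b\<in>B'. g b *\<^sub>R f b z) - (\<Sum>b\<in>B'. \<Sum>p\<in>Q. (g b * s p b z) *\<^sub>R f p z)"
      by (simp add: \<nu>'_def scaleR_right_diff_distrib sum_subtractf scaleR_sum_right)
    also have "(\<Sum>b\<in>B'. \<Sum>p\<in>Q. (g b * s p b z) *\<^sub>R f p z) = (\<Sum>p\<in>Q. (\<Sum>b\<in>B'. g b * s p b z) *\<^sub>R f p z)"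
      by (subst sum.swap) (simp add: scaleR_sum_left)
    finally show ?thesis
      unfolding split_B by (simp add: B'_def sum_negf)
  qed
  have bas: "basis_fam (card B') (\<lambda>j. \<nu>' (e j) y) (F\<^sub>0 y)" if y: "y \<in> N'" for y
    unfolding basis_fam_def
  proof (intro conjI allI impI ballI)
    have yN: "y \<in> N" using y cr(3) by blast
    fix j assume "j < card B'"
    then have b: "e j \<in> B'" using e by (auto simp: bij_betw_def)
    define g where "g b = (if b = e j then 1 else 0 :: real)" for b
    have "\<nu>' (e j) y = (\<Sum>b\<in>B'. g b *\<^sub>R \<nu>' b y)"
      using b by (simp add: g_def if_distrib[of "\<lambda>r. r *\<^sub>R _"] B'_def cong: if_cong)
    also have "\<dots> = (\<Sum>b<k. (if b \<in> Q then - s b (e j) y else g b) *\<^sub>R f b y)"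
      unfolding combine using b by (intro sum.cong) (auto simp: g_def if_distrib[of "\<lambda>r. r * _"] B'_def cong: if_cong)
    also have "\<dots> \<in> F\<^sub>0 y"
      unfolding F0_coord[OF yN]
    proof
      fix i assume i: "i \<in> ?I"
      have "(\<Sum>b<k. (if b \<in> Q then - s b (e j) y else g b) * T i b y) =
          - (\<Sum>p\<in>Q. s p (e j) y * T i p y) + (\<Sum>b\<in>B'. g b * T i b y)"
        unfolding split_B by (simp add: B'_def sum_negf)
      also have "(\<Sum>b\<in>B'. g b * T i b y) = T i (e j) y"
        using b by (simp add: g_def if_distrib[of "\<lambda>r. r * _"] B'_def cong: if_cong)
      also have "\<dots> = (\<Sum>p\<in>Q. s p (e j) y * T i p y)"
        using cr(6) y i b by (auto simp: B'_def)
      finally show "(\<Sum>b<k. (if b \<in> Q then - s b (e j) y else g b) * T i b y) = 0" by simp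
    qed
    finally show "\<nu>' (e j) y \<in> F\<^sub>0 y" .
  next
    have yN: "y \<in> N" using y cr(3) by blast
    fix w assume w: "w \<in> F\<^sub>0 y"
    define g where "g = cf w y"
    have wg: "w = (\<Sum>b<k. g b *\<^sub>R f b y)" unfolding g_def by (rule cf[OF yN F0_subset[OF w]])
    have ker: "(\<Sum>b<k. g b * T i b y) = 0" if "i \<in> ?I" for i
      using w that unfolding wg F0_coord[OF yN] by blast
    have "(\<Sum>p\<in>Q. (g p + (\<Sum>b\<in>B'. g b * s p b y)) * T i p y) = 0" if i: "i \<in> ?I" for i
    proof -
      have "(\<Sum>b\<in>B'. g b * T i b y) = (\<Sum>b\<in>B'. \<Sum>p\<in>Q. g b * s p b y * T i p y)"
        using cr(6) y i by (intro sum.cong) (auto simp: B'_def sum_distrib_left mult.assoc)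
      also have "\<dots> = (\<Sum>p\<in>Q. (\<Sum>b\<in>B'. g b * s p b y) * T i p y)"
        by (subst sum.swap) (simp add: sum_distrib_right)
      finally show ?thesis using ker[OF i] unfolding split_B by (simp add: distrib_right sum.distrib)
    qed
    then have "\<forall>p\<in>Q. g p + (\<Sum>b\<in>B'. g b * s p b y) = 0"
      using cr(7)[rule_format, OF y, of "\<lambda>p. g p + (\<Sum>b\<in>B'. g b * s p b y)"] by blast
    then have "w = (\<Sum>b\<in>B'. g b *\<^sub>R \<nu>' b y)"
      unfolding combine wg by (intro sum.cong) (auto simp: add_eq_0_iff2)
    then have "w = (\<Sum>j<card B'. g (e j) *\<^sub>R \<nu>' (e j) y)"
      using reindex[of "\<lambda>b. g b *\<^sub>R \<nu>' b y"] by simp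
    then show "\<exists>c. w = (\<Sum>j<card B'. c j *\<^sub>R \<nu>' (e j) y)" by (intro exI[of _ "\<lambda>j. g (e j)"])
  next
    have yN: "y \<in> N" using y cr(3) by blast
    fix c j assume c: "(\<Sum>j<card B'. c j *\<^sub>R \<nu>' (e j) y) = 0" and j: "j < card B'"
    define g where "g b = c (the_inv_into {..<card B'} e b)" for b
    have ge: "g (e j) = c j" if "j < card B'" for j
      using that e by (simp add: g_def bij_betw_def the_inv_into_f_f)
    have "0 = (\<Sum>j<card B'. g (e j) *\<^sub>R \<nu>' (e j) y)" using c ge by simp
    also have "\<dots> = (\<Sum>b<k. (if b \<in> Q then - (\<Sum>c\<in>B'. g c * s b c y) else g b) *\<^sub>R f b y)"
      unfolding reindex[of "\<lambda>b. g b *\<^sub>R \<nu>' b y"] by (rule combine)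
    finally have *: "(\<Sum>b<k. (if b \<in> Q then - (\<Sum>c\<in>B'. g c * s b c y) else g b) *\<^sub>R f b y) = (\<Sum>b<k. 0 *\<^sub>R f b y)" by simp
    have "e j \<in> B'" using e j by (auto simp: bij_betw_def)
    then have "g (e j) = 0" using basis_fam_unique[OF bf[OF yN] *, of "e j"] by (simp add: B'_def)
    then show "c j = 0" using ge[OF j] by simp
  qed
  \<comment> \<open>The candidate with all free coordinates 0, smooth on \<open>N'\<close> in any
    case; the last clause of \<open>pivoted\<close> makes it a solution as soon as one point of
    \<open>N'\<close> admits a solution.\<close>
  define \<sigma> where "\<sigma> z = (\<Sum>p\<in>Q. s p k z *\<^sub>R f p z)" for z
  have Qk: "p < k" if "p \<in> Q" for p using that cr(4) by auto
  have fsec: "sec_at M F (f p) y" if "p < k" for p y by (rule F.sectionsD(2)[OF fs[OF that]])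
  show ?thesis
  proof (rule that[of N' "card B'" "\<lambda>j. \<nu>' (e j)" \<sigma>])
    show "open N'" "x \<in> N'" by (rule cr(1), rule cr(2))
    show "sec_at M F (\<nu>' (e j)) y" if "j < card B'" "y \<in> N'" for j y
    proof -
      have "e j \<in> B'" using e that(1) by (auto simp: bij_betw_def)
      then have "e j < k" by (simp add: B'_def)
      then show ?thesis unfolding \<nu>'_def[abs_def] using cr(5) that(2) Qk
        by (intro sec_at_diff sec_at_sum sec_at_scale fsec) auto
    qed
    show "basis_fam (card B') (\<lambda>j. \<nu>' (e j) y) (F\<^sub>0 y)" if "y \<in> N'" for y by (rule bas[OF that])
    show "sec_at M F \<sigma> y" if "y \<in> N'" for y
      unfolding \<sigma>_def[abs_def] using cr(5) that Qk
      by (intro sec_at_sum sec_at_scale fsec) auto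
    fix y z assume y: "y \<in> N'" and z: "z \<in> N'" and ex: "\<exists>w. solves \<Omega> z w"
    have yN: "y \<in> N" and zN: "z \<in> N" using y z cr(3) by auto
    have \<Omega>b: "bundle_map M A F \<Omega>" using \<Omega> by (simp add: cocycle_map_def)
    have Tk: "T (i, a) k y = cf (\<Omega> y (l i y)) y a" for i a y by (simp add: T_def P_def)
    obtain w where w: "solves \<Omega> z w" using ex by blast
    have "w = (\<Sum>b<k. cf w z b *\<^sub>R f b z)" by (rule cf[OF zN]) (use w in \<open>simp add: solves_def\<close>)
    then have "solves \<Omega> z (\<Sum>b<k. cf w z b *\<^sub>R f b z)" using w by simp
    then have "\<forall>i\<in>?I. T i k z = (\<Sum>b<k. cf w z b * T i b z)"
      unfolding solves_coord[OF zN \<Omega>b] by (auto simp: Tk)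
    then have "\<exists>y\<in>N'. \<exists>u. \<forall>i\<in>?I. T i k y = (\<Sum>b<k. u b * T i b y)" using z by (intro bexI[of _ z] exI[of _ "cf w z"])
    then have "\<forall>i\<in>?I. T i k y = (\<Sum>p\<in>Q. s p k y * T i p y)" using cr(8) y by blast
    moreover have "(\<Sum>p\<in>Q. s p k y * T i p y) = (\<Sum>b<k. (if b \<in> Q then s b k y else 0) * T i b y)" for i
      unfolding split_B by (simp add: B'_def)
    moreover have "\<sigma> y = (\<Sum>b<k. (if b \<in> Q then s b k y else 0) *\<^sub>R f b y)"
      unfolding split_B \<sigma>_def by (simp add: B'_def)
    ultimately show "solves \<Omega> y (\<sigma> y)"
      using solves_coord[OF yN \<Omega>b, of "\<lambda>b. if b \<in> Q then s b k y else 0"] by (auto simp: Tk)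
  qed
qed

section \<open>Global solvability by connectedness and gluing\<close>

lemma solves_affine:
  assumes "solves \<Omega> y u" "solves \<Omega> y v"
  shows "solves \<Omega> y (r *\<^sub>R u + (1 - r) *\<^sub>R v)"
  using solves_combination[OF assms, of r "1 - r"] by (simp flip: scaleR_left_distrib)

text \<open>By \<open>local_solutions\<close>, solvability at one point of a suitable neighbourhood
  implies it at all others, so every point has a neighbourhood inside the solvable set or inside its
  complement.\<close>

lemma solvable_everywhere:
  assumes conn: "connected (UNIV :: 'm set)" and \<Omega>: "cocycle_map \<Omega>" and x: "solves \<Omega> x w"
  shows "\<exists>w. solves \<Omega> y w"
proof -
  let ?S = "{y. \<exists>w. solves \<Omega> y w}"
  have nhd: "\<exists>N. open N \<and> x \<in> N \<and> (N \<subseteq> ?S \<or> N \<subseteq> - ?S)" for x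
  proof -
    obtain N \<sigma> where N: "open N" "x \<in> N"
      "\<And>y z. y \<in> N \<Longrightarrow> z \<in> N \<Longrightarrow> \<exists>w. solves \<Omega> z w \<Longrightarrow> solves \<Omega> y (\<sigma> y)"
      using local_solutions[OF \<Omega>, of x] by metis
    then have "N \<subseteq> ?S \<or> N \<subseteq> - ?S" by blast
    then show ?thesis using N by blast
  qed
  have "open ?S"
    by (subst open_subopen) (use nhd in \<open>blast\<close>)
  moreover have "open (- ?S)"
    by (subst open_subopen) (use nhd in \<open>blast\<close>)
  ultimately have "?S = {} \<or> - ?S = {}"
    using connectedD[OF conn, of ?S "- ?S"] by auto
  then show ?thesis using x by blast
qed

lemma global_solution:
  assumes \<Omega>: "cocycle_map \<Omega>" and ex: "\<And>y. \<exists>w. solves \<Omega> y w"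
  obtains \<mu> where "\<mu> \<in> sections M F" "\<And>y. solves \<Omega> y (\<mu> y)"
proof -
  have "\<exists>U s. open U \<and> y \<in> U \<and> (\<forall>z\<in>U. s z \<in> fib F z \<and> sec_at M F s z \<and> s z \<in> {v. solves \<Omega> z v})" for y
  proof -
    obtain N \<sigma> where N: "open N" "y \<in> N" "\<And>y. y \<in> N \<Longrightarrow> sec_at M F \<sigma> y"
      "\<And>y z. y \<in> N \<Longrightarrow> z \<in> N \<Longrightarrow> \<exists>w. solves \<Omega> z w \<Longrightarrow> solves \<Omega> y (\<sigma> y)"
      using local_solutions[OF \<Omega>, of y] by metis
    have "solves \<Omega> z (\<sigma> z)" if "z \<in> N" for z using N(4)[OF that that ex] .
    then show ?thesis using N by (intro exI[of _ N] exI[of _ \<sigma>]) (auto simp: solves_def)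
  qed
  then have "\<exists>s\<in>sections M F. \<forall>y. s y \<in> {v. solves \<Omega> y v}"
    by (intro F.glue_sections) (auto intro: solves_affine)
  then show ?thesis using that by blast
qed

abbreviation "E\<^sub>0 \<equiv> invariant_bundle M A F R"

section \<open>The invariants as a vector bundle\<close>

lemma E0_simps: "fib E\<^sub>0 = F\<^sub>0"
  "(U, es) \<in> frames E\<^sub>0 \<longleftrightarrow> open U \<and> is_frame_on F\<^sub>0 U es \<and> (\<forall>e\<in>set es. smooth_section_on M F U e)"
  by (auto simp: invariant_bundle_def subbundle_def)

lemma framed_E0: "framed E\<^sub>0"
  unfolding framed_def by (auto simp: E0_simps subspace_F0)

text \<open>The frames of the invariant bundle are arbitrary frames of \<open>invariant_fib\<close>
  that are smooth in \<open>F\<close>, so coefficients in any such frame must be shown to be smooth.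
  Its matrix \<open>E\<close> in a frame of \<open>F\<close> has independent rows at
  \<open>y\<close>; a smooth right inverse \<open>S\<close> of \<open>E\<close> converts the
  coefficients of \<open>s\<close> in \<open>F\<close> into those in the given frame.\<close>

lemma sec_at_E0I:
  assumes s: "sec_at M F s y" and N: "open N" "y \<in> N" "\<And>z. z \<in> N \<Longrightarrow> s z \<in> F\<^sub>0 z"
  shows "sec_at M E\<^sub>0 s y"
  unfolding sec_at_def
proof clarify
  fix U es assume U: "(U, es) \<in> frames E\<^sub>0" "y \<in> U"
  let ?m = "length es"
  note fr = framedD[OF framed_E0, unfolded E0_simps(1)]
  have oU: "open U" by (rule fr(2)[OF U(1)])
  have bas: "basis_fam ?m (\<lambda>i. (es ! i) z) (F\<^sub>0 z)" if "z \<in> U" for z by (rule fr(3)[OF U(1) that])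
  have es: "sec_at M F (es ! i) z" if "i < ?m" "z \<in> U" for i z
    using U(1) that smooth_section_on_iff[OF F.framed oU] unfolding E0_simps by (meson nth_mem)
  obtain N1 k f where f: "F.local_frame N1 k f" "y \<in> N1" "N1 \<subseteq> U \<inter> N"
    using F.local_frame_exists[OF open_Int[OF oU N(1)] IntI[OF U(2) N(2)]] by metis
  have bf: "basis_fam k (\<lambda>b. f b z) (fib F z)" if "z \<in> N1" for z by (rule F.local_frameD(3)[OF f(1) that])
  define E where "E i b z = bcoef k (\<lambda>b. f b z) ((es ! i) z) b" for i b z
  have E: "(es ! i) z = (\<Sum>b<k. E i b z *\<^sub>R f b z)" if "i < ?m" "z \<in> N1" for i z
  proof -
    have "(es ! i) z \<in> F\<^sub>0 z" using bas[of z] that f(3) by (auto simp: basis_fam_def)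
    then show ?thesis unfolding E_def by (rule F.local_frame_expand[OF f(1) that(2) F0_subset])
  qed
  have sE: "smooth_at M (E i b) z" if "i < ?m" "b < k" "z \<in> N1" for i b z
    unfolding E_def[abs_def] using that f(3) by (intro F.local_frameD(4)[OF f(1)] es) auto
  \<comment> \<open>A functional dual to the \<open>j\<close>-th frame vector at \<open>y\<close>;
    its values on the frame of \<open>F\<close> form column \<open>j\<close> of a right inverse of
    \<open>E\<close> at this point.\<close>
  have "\<exists>g. linear g \<and> (\<forall>i<?m. g ((es ! i) y) = (if i = j then 1 else 0 :: real))" if j: "j < ?m" for j
  proof -
    have il: "is_basis_list (map (\<lambda>e. e y) es) (F\<^sub>0 y)"
      using U unfolding E0_simps is_frame_on_def by blast
    then have "independent (set (map (\<lambda>e. e y) es))" by (simp add: is_basis_list_def)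
    then obtain g where g: "linear g" "\<forall>v\<in>set (map (\<lambda>e. e y) es). g v = (if v = (es ! j) y then 1 else 0 :: real)"
      using linear_independent_extend[of "set (map (\<lambda>e. e y) es)" "\<lambda>v. if v = (es ! j) y then 1 else 0 :: real"] by blast
    have "(es ! i) y = (es ! j) y \<longleftrightarrow> i = j" if "i < ?m" for i
      using il nth_eq_iff_index_eq[of "map (\<lambda>e. e y) es" i j] that j by (simp add: is_basis_list_def)
    then show ?thesis using g by (intro exI[of _ g]) auto
  qed
  then have "\<forall>j. \<exists>g. j < ?m \<longrightarrow> linear g \<and> (\<forall>i<?m. g ((es ! i) y) = (if i = j then 1 else 0 :: real))" by simp
  from choice[OF this] obtain g where
    g: "\<forall>j. j < ?m \<longrightarrow> linear (g j) \<and> (\<forall>i<?m. g j ((es ! i) y) = (if i = j then 1 else 0 :: real))" by (elim exE)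
  have inv: "(\<Sum>b<k. E i b y * g j (f b y)) = (if i = j then 1 else 0)" if "i < ?m" "j < ?m" for i j
  proof -
    have l: "linear (g j)" using g that by blast
    have "g j ((es ! i) y) = (\<Sum>b<k. E i b y * g j (f b y))"
      unfolding E[OF that(1) f(2)] by (simp add: linear_sum[OF l] linear_scale[OF l])
    then show ?thesis using g that by simp
  qed
  obtain N2 S where S: "open N2" "y \<in> N2" "N2 \<subseteq> N1"
    "\<And>k' j z. k' \<in> {..<k} \<Longrightarrow> j \<in> {..<?m} \<Longrightarrow> z \<in> N2 \<Longrightarrow> smooth_at M (S k' j) z"
    "\<And>i j z. i \<in> {..<?m} \<Longrightarrow> j \<in> {..<?m} \<Longrightarrow> z \<in> N2 \<Longrightarrow> (\<Sum>k'<k. E i k' z * S k' j z) = (if i = j then 1 else 0)"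
    using smooth_right_inverse[of "{..<?m}" "{..<k}" N1 y E "\<lambda>b j. g j (f b y)"]
      F.local_frameD(1)[OF f(1)] f(2) sE inv by auto
  define c where "c j z = (\<Sum>b<k. bcoef k (\<lambda>b. f b z) (s z) b * S b j z)" for j z
  have "smooth_at M (c j) y" if "j < ?m" for j
    unfolding c_def[abs_def] using that S(2,4)
    by (intro smooth_at_sum smooth_at_mult F.local_frameD(4)[OF f(1,2) s]) auto
  moreover have "s z = (\<Sum>i<?m. c i z *\<^sub>R (es ! i) z)" if z: "z \<in> N2" for z
  proof -
    have z1: "z \<in> N1" "z \<in> U" "z \<in> N" using z S(3) f(3) by auto
    obtain \<gamma> where \<gamma>: "s z = (\<Sum>i<?m. \<gamma> i *\<^sub>R (es ! i) z)"
      using bas[OF z1(2)] N(3)[OF z1(3)] unfolding basis_fam_def by blast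
    also have "\<dots> = (\<Sum>b<k. (\<Sum>i<?m. \<gamma> i * E i b z) *\<^sub>R f b z)"
      using E[OF _ z1(1)] by (simp add: scaleR_sum_right scaleR_sum_left) (rule sum.swap)
    finally have bc: "bcoef k (\<lambda>b. f b z) (s z) b = (\<Sum>i<?m. \<gamma> i * E i b z)" if "b < k" for b
      using bcoef_eq[OF bf[OF z1(1)] F.fib_subspace that, of "\<lambda>b. \<Sum>i<?m. \<gamma> i * E i b z"] by simp
    have "c j z = \<gamma> j" if "j < ?m" for j
    proof -
      have "c j z = (\<Sum>b<k. \<Sum>i<?m. \<gamma> i * (E i b z * S b j z))"
        by (simp add: c_def bc sum_distrib_right mult.assoc)
      also have "\<dots> = (\<Sum>i<?m. \<gamma> i * (\<Sum>b<k. E i b z * S b j z))"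
        by (subst sum.swap) (simp add: sum_distrib_left)
      also have "\<dots> = (\<Sum>i<?m. \<gamma> i * (if i = j then 1 else 0))"
        using S(5) that z by (intro sum.cong) auto
      finally show ?thesis using that by (simp add: if_distrib[of "\<lambda>r. _ * r"] cong: if_cong)
    qed
    then show ?thesis using \<gamma> by simp
  qed
  ultimately show "\<exists>c N. (\<forall>i<length es. smooth_at M (c i) y) \<and> open N \<and> y \<in> N \<and>
      (\<forall>z\<in>N. s z = (\<Sum>i<length es. c i z *\<^sub>R (es ! i) z))"
    using S(1,2) by (intro exI[of _ c] exI[of _ N2]) auto
qed

text \<open>The covering frames are the kernel bases supplied by \<open>local_solutions\<close>,
  applied to the zero cocycle; smooth transitions between all frames follow from
  \<open>sec_at_E0I\<close>.\<close>

lemma vector_bundle_E0: "vector_bundle M E\<^sub>0"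
  unfolding vector_bundle_def
proof (intro conjI allI)
  show "subspace (fib E\<^sub>0 x)" for x by (simp add: E0_simps subspace_F0)
  show "(\<Union>(U, es)\<in>frames E\<^sub>0. U) = UNIV"
  proof -
    have "\<exists>U es. (U, es) \<in> frames E\<^sub>0 \<and> x \<in> U" for x
    proof -
      obtain N q \<nu> where N: "open N" "x \<in> N" "\<And>i y. i < q \<Longrightarrow> y \<in> N \<Longrightarrow> sec_at M F (\<nu> i) y"
        "\<And>y. y \<in> N \<Longrightarrow> basis_fam q (\<lambda>i. \<nu> i y) (F\<^sub>0 y)"
        using local_solutions[OF cocycle_map_zero, of x] by metis
      have "is_frame_on F\<^sub>0 N (map \<nu> [0..<q])"
        unfolding is_frame_on_def using basis_fam_imp_list[OF N(4) subspace_F0] by (simp add: comp_def)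
      moreover have "smooth_section_on M F N (\<nu> i)" if "i < q" for i
        unfolding smooth_section_on_iff[OF F.framed N(1)]
        using N(3,4) that F0_subset unfolding basis_fam_def by blast
      ultimately have "(N, map \<nu> [0..<q]) \<in> frames E\<^sub>0" using N(1) by (auto simp: E0_simps)
      then show ?thesis using N(2) by blast
    qed
    then show ?thesis by fast
  qed
  show "\<forall>(U, es)\<in>frames E\<^sub>0. open U \<and> is_frame_on (fib E\<^sub>0) U es" by (auto simp: E0_simps)
  show "\<forall>(U, es)\<in>frames E\<^sub>0. \<forall>e\<in>set es. smooth_section_on M E\<^sub>0 U e"
  proof clarify
    fix U es e assume U: "(U, es) \<in> frames E\<^sub>0" and e: "e \<in> set es"
    have *: "open U" "is_frame_on F\<^sub>0 U es" "smooth_section_on M F U e" using U e by (auto simp: E0_simps)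
    obtain i where i: "i < length es" "e = es ! i" using e by (metis in_set_conv_nth)
    have "e z \<in> F\<^sub>0 z" if "z \<in> U" for z
      using framedD(3)[OF framed_E0 U that] i by (simp add: E0_simps basis_fam_def)
    then show "smooth_section_on M E\<^sub>0 U e"
      unfolding smooth_section_on_iff[OF framed_E0 *(1)] E0_simps(1)
      using *(1,3) smooth_section_on_iff[OF F.framed *(1)] by (auto intro: sec_at_E0I)
  qed
qed

sublocale E0: vbun M "invariant_bundle M A F R"
  by unfold_locales (rule vector_bundle_E0)

lemma sec_at_E0D:
  assumes "sec_at M E\<^sub>0 s y" shows "sec_at M F s y"
proof -
  obtain U es where U: "(U, es) \<in> frames E\<^sub>0" "y \<in> U" "open U" by (rule E0.frame_exists)
  obtain c N where c: "\<forall>i<length es. smooth_at M (c i) y" "open N" "y \<in> N"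
    "\<forall>z\<in>N. s z = (\<Sum>i<length es. c i z *\<^sub>R (es ! i) z)"
    using assms U unfolding sec_at_def by blast
  have "sec_at M F (es ! i) y" if "i < length es" for i
    using U that smooth_section_on_iff[OF F.framed U(3)] unfolding E0_simps by (meson nth_mem)
  then have "sec_at M F (\<lambda>z. \<Sum>i<length es. c i z *\<^sub>R (es ! i) z) y"
    using c(1) by (intro sec_at_sum sec_at_scale) auto
  then show ?thesis by (rule sec_at_cong[OF _ c(2,3)]) (use c(4) in simp)
qed

lemma sections_E0_iff: "s \<in> sections M E\<^sub>0 \<longleftrightarrow> s \<in> sections M F \<and> (\<forall>y. s y \<in> F\<^sub>0 y)"
  unfolding sections_iff[OF framed_E0] sections_iff[OF F.framed] E0_simps(1)
  using sec_at_E0D sec_at_E0I[OF _ open_UNIV UNIV_I] F0_subset by blast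

lemma sections_E0I:
  assumes "s \<in> sections M F" "\<And>y u. u \<in> L y \<Longrightarrow> R y u s = 0"
  shows "s \<in> sections M E\<^sub>0"
  using assms solves_section[OF assms(1), of "\<lambda>_ _. 0"] by (simp add: sections_E0_iff F0_iff)

lemma sections_E0D:
  assumes "s \<in> sections M E\<^sub>0" shows "s \<in> sections M F" "u \<in> L y \<Longrightarrow> R y u s = 0"
proof -
  show s: "s \<in> sections M F" using assms by (simp add: sections_E0_iff)
  show "u \<in> L y \<Longrightarrow> R y u s = 0"
    using assms solves_section[OF s, of "\<lambda>_ _. 0" y] by (simp add: sections_E0_iff F0_iff)
qed

section \<open>The pullback along the anchor\<close>

abbreviation "R\<^sub>0 \<equiv> reduced_connection A R"

text \<open>Two lifts of a tangent vector differ by an element of \<open>L\<close>, which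
  annihilates sections of the invariant bundle, so the description by \<open>THE\<close> has a
  unique solution.\<close>

lemma reduced_eq:
  assumes "\<nu> \<in> sections M E\<^sub>0" "u \<in> fib A y"
  shows "R\<^sub>0 y (\<rho> y u) \<nu> = R y u \<nu>"
  unfolding reduced_connection_def
proof (rule the_equality)
  show "\<forall>u'\<in>fib A y. \<rho> y u' = \<rho> y u \<longrightarrow> R y u' \<nu> = R y u \<nu>"
  proof (intro ballI impI)
    fix u' assume u': "u' \<in> fib A y" "\<rho> y u' = \<rho> y u"
    have m: "(-1) *\<^sub>R u \<in> fib A y" by (rule subspace_scale[OF A.fib_subspace assms(2)])
    have "u' + (-1) *\<^sub>R u \<in> L y"
      using u' m anchor_add[OF u'(1) m] anchor_scale[OF assms(2), of "-1"] subspace_add[OF A.fib_subspace u'(1) m]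
      by (simp add: L_iff)
    then have "R y (u' + (-1) *\<^sub>R u) \<nu> = 0" by (rule sections_E0D(2)[OF assms(1)])
    then show "R y u' \<nu> = R y u \<nu>"
      using R_add_left[OF u'(1) m sections_E0D(1)[OF assms(1)]]
        R_scale_left[OF assms(2) sections_E0D(1)[OF assms(1)], of "-1"] by simp
  qed
  show "w = R y u \<nu>" if "\<forall>u'\<in>fib A y. \<rho> y u' = \<rho> y u \<longrightarrow> R y u' \<nu> = w" for w
    using that assms(2) by simp
qed

text \<open>Evaluate the cocycle identity on a section of \<open>L\<close> and an arbitrary section.\<close>

lemma cocycle_section_E0:
  assumes \<Omega>: "cocycle_map \<Omega>" "\<And>y u. u \<in> L y \<Longrightarrow> \<Omega> y u = 0" and a: "a \<in> sections M A"
  shows "(\<lambda>y. \<Omega> y (a y)) \<in> sections M E\<^sub>0"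
proof (rule sections_E0I)
  show "(\<lambda>y. \<Omega> y (a y)) \<in> sections M F"
    using bundle_map_section[OF _ a] \<Omega>(1) by (simp add: cocycle_map_def)
  fix y u assume "u \<in> L y"
  then obtain b where b: "b \<in> sections M A" "b y = u" "\<And>z. b z \<in> L z" by (rule L_section_through) blast
  have "bracket A a b y \<in> L y" by (rule bracket_in_L[OF a b(1) open_UNIV UNIV_I b(3)])
  then have "\<Omega> y (bracket A a b y) = 0" by (rule \<Omega>(2))
  moreover have "\<Omega> y (bracket A a b y) = R y (a y) (\<lambda>z. \<Omega> z (b z)) - R y (b y) (\<lambda>z. \<Omega> z (a z))"
    using \<Omega>(1) a b(1) unfolding cocycle_map_def by blast
  moreover have "R y (a y) (\<lambda>z. \<Omega> z (b z)) = 0"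
    using \<Omega>(2)[OF b(3)] R_zero[OF A.sectionsD(1)[OF a]] by simp
  ultimately show "R y u (\<lambda>y. \<Omega> y (a y)) = 0" using b(2) by simp
qed

text \<open>Local lifts are combinations of lifts of coordinate fields. The lifts of a given vector
  form an affine space, so \<open>glue_sections\<close> applies. The lift must be global because the
  cocycle identity is stated for global sections.\<close>

lemma lift_section:
  assumes a: "a \<in> sections M TM"
  obtains a' where "a' \<in> sections M A" "\<And>y. \<rho> y (a' y) = a y"
proof -
  have ay: "a y \<in> tangent_space M y" "sec_at M TM a y" for y
    using a unfolding sections_iff[OF framed_TM] TM_simps(1) by auto
  have "\<exists>U s. open U \<and> y \<in> U \<and> (\<forall>z\<in>U. s z \<in> fib A z \<and> sec_at M A s z \<and> s z \<in> {u \<in> fib A z. \<rho> z u = a z})" for y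
  proof -
    obtain W \<phi> where c: "(W, \<phi>) \<in> charts M" "y \<in> W" by (rule chart_exists)
    obtain bs where bs: "is_basis_list bs (model M)" by (rule model_basis)
    let ?d = "length bs"
    let ?D = "\<lambda>j y. coord_field M W \<phi> (bs ! j) y"
    note t = tangent_chart[OF c(1) bs]
    obtain N X where X: "open N" "y \<in> N" "N \<subseteq> W" "\<And>j. j < ?d \<Longrightarrow> X j \<in> sections M A"
      "\<And>j y. j < ?d \<Longrightarrow> y \<in> N \<Longrightarrow> \<rho> y (X j y) = ?D j y"
      using local_lifts[OF c bs] by metis
    define h where "h j z = bcoef ?d (\<lambda>j. ?D j z) (a z) j" for j z
    have sh: "smooth_at M (h j) z" if "j < ?d" "z \<in> W" for j z
      unfolding h_def[abs_def] by (rule tangent_coef_smooth[OF c(1) bs that(2) a that(1)])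
    define s where "s z = (\<Sum>j<?d. h j z *\<^sub>R X j z)" for z
    have Xi: "X j z \<in> fib A z" if "j < ?d" for j z by (rule A.sectionsD(1)[OF X(4)[OF that]])
    have "s z \<in> fib A z" for z
      unfolding s_def using Xi by (intro subspace_sum subspace_scale A.fib_subspace) auto
    moreover have "sec_at M A s z" if "z \<in> N" for z
      unfolding s_def[abs_def] using that X(3)
      by (intro sec_at_sum sec_at_scale sh A.sectionsD(2)[OF X(4)]) auto
    moreover have "\<rho> z (s z) = a z" if "z \<in> N" for z
    proof -
      have "\<rho> z (s z) = (\<Sum>j<?d. h j z *\<^sub>R ?D j z)"
        unfolding s_def using bundle_map_sum[OF anchor_map A.fib_subspace Xi] X(5)[OF _ that] by simp
      also have "\<dots> = a z" unfolding h_def by (rule bcoef_sum[OF t(3) ay(1)]) (use that X(3) in auto)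
      finally show ?thesis .
    qed
    ultimately show ?thesis using X(1,2) by (intro exI[of _ N] exI[of _ s]) auto
  qed
  moreover have "r *\<^sub>R u + (1 - r) *\<^sub>R v \<in> {u \<in> fib A y. \<rho> y u = a y}"
    if "u \<in> {u \<in> fib A y. \<rho> y u = a y}" "v \<in> {u \<in> fib A y. \<rho> y u = a y}" for y u v r
    using that
    by (auto simp: anchor_add anchor_scale subspace_scale[OF A.fib_subspace] simp flip: scaleR_left_distrib
        intro!: subspace_add[OF A.fib_subspace])
  ultimately have "\<exists>s\<in>sections M A. \<forall>y. s y \<in> {u \<in> fib A y. \<rho> y u = a y}"
    by (intro A.glue_sections)
  then show ?thesis using that by blast
qed

lemma bundle_map_cong:
  assumes "bundle_map M A F \<Phi>" "\<And>y u. u \<in> fib A y \<Longrightarrow> \<Phi> y u = \<Psi> y u"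
  shows "bundle_map M A F \<Psi>"
proof -
  have "smooth_section_on M F U (\<lambda>y. \<Psi> y (e y))" if U: "(U, es) \<in> frames A" and e: "e \<in> set es" for U es e
  proof -
    have oU: "open U" by (rule framedD(2)[OF A.framed U])
    obtain i where i: "i < length es" "e = es ! i" using e by (metis in_set_conv_nth)
    have ef: "e z \<in> fib A z" if "z \<in> U" for z
      using framedD(3)[OF A.framed U that] i by (simp add: basis_fam_def)
    have "smooth_section_on M F U (\<lambda>y. \<Phi> y (e y))" using assms(1) U e unfolding bundle_map_def by blast
    then have *: "\<Phi> y (e y) \<in> fib F y" "sec_at M F (\<lambda>y. \<Phi> y (e y)) y" if "y \<in> U" for y
      using that unfolding smooth_section_on_iff[OF F.framed oU] by auto
    show ?thesis
      unfolding smooth_section_on_iff[OF F.framed oU]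
      using * assms(2)[OF ef] sec_at_cong[OF *(2) oU] by auto
  qed
  moreover have "\<Psi> y u \<in> fib F y" "\<Psi> y (r *\<^sub>R u) = r *\<^sub>R \<Psi> y u" if "u \<in> fib A y" for y u r
    using assms(1) that subspace_scale[OF A.fib_subspace that]
    by (simp_all add: bundle_map_def assms(2)[symmetric])
  moreover have "\<Psi> y (u + v) = \<Psi> y u + \<Psi> y v" if "u \<in> fib A y" "v \<in> fib A y" for y u v
    using assms(1) that subspace_add[OF A.fib_subspace that]
    by (simp add: bundle_map_def assms(2)[symmetric])
  ultimately show ?thesis unfolding bundle_map_def by blast
qed

lemma cocycle_map_cong:
  assumes "cocycle_map \<Phi>" "\<And>y u. u \<in> fib A y \<Longrightarrow> \<Phi> y u = \<Psi> y u"
  shows "cocycle_map \<Psi>"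
proof -
  have "bundle_map M A F \<Psi>"
    by (rule bundle_map_cong[of \<Phi>]) (use assms in \<open>simp_all add: cocycle_map_def\<close>)
  moreover have "(\<lambda>z. \<Phi> z (a z)) = (\<lambda>z. \<Psi> z (a z))" if "a \<in> sections M A" for a
    using assms(2) A.sectionsD(1)[OF that] by auto
  moreover have "\<Phi> y (bracket A a b y) = \<Psi> y (bracket A a b y)" if "a \<in> sections M A" "b \<in> sections M A" for a b y
    by (rule assms(2)[OF A.sectionsD(1)[OF bracket_section[OF that]]])
  ultimately show ?thesis using assms(1) unfolding cocycle_map_def by simp
qed

section \<open>Comparison of cocycles and coboundaries along the anchor\<close>

abbreviation "Z \<equiv> cocycles1 M A F R"
abbreviation "B \<equiv> coboundaries1 M A F R"
abbreviation "Z\<^sub>0 \<equiv> cocycles1 M TM E\<^sub>0 R\<^sub>0"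
abbreviation "B\<^sub>0 \<equiv> coboundaries1 M TM E\<^sub>0 R\<^sub>0"

lemma cocycles_iff: "\<Omega> \<in> Z \<longleftrightarrow> cocycle_map \<Omega> \<and> (\<forall>y u. u \<notin> fib A y \<longrightarrow> \<Omega> y u = 0)"
  unfolding cocycles1_def cochains1_def cocycle_map_def by blast

lemma cocycle_map_zero_on: "cocycle_map \<Omega> \<Longrightarrow> \<Omega> y 0 = 0"
  using subspace_0[OF A.fib_subspace, of y] unfolding cocycle_map_def bundle_map_def
  by (metis scaleR_zero_left)

text \<open>Everything about \<open>\<theta>\<close> is read off through lifts: values and linearity
  from lifts of vectors, smoothness from local lifts of coordinate fields, the cocycle identity from
  global lifts, since the anchor of their bracket is the bracket of the fields. The values are
  invariant by \<open>cocycle_section_E0\<close>, which applies because a pullback that is a cocycle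
  vanishes on \<open>L\<close>.\<close>

lemma cocycle_descends:
  assumes \<theta>: "\<And>y X. X \<notin> tangent_space M y \<Longrightarrow> \<theta> y X = 0" and \<Omega>: "anchor_pullback A \<theta> \<in> Z"
  shows "\<theta> \<in> Z\<^sub>0"
proof -
  let ?\<Omega> = "anchor_pullback A \<theta>"
  have c: "cocycle_map ?\<Omega>" using \<Omega> by (simp add: cocycles_iff)
  then have bm: "bundle_map M A F ?\<Omega>" by (simp add: cocycle_map_def)
  have eq: "\<theta> y (\<rho> y u) = ?\<Omega> y u" if "u \<in> fib A y" for y u using that by (simp add: anchor_pullback_def)
  have van: "?\<Omega> y u = 0" if "u \<in> L y" for y u
    using that cocycle_map_zero_on[OF c, of y] eq[of u y] eq[OF subspace_0[OF A.fib_subspace], of y]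
      anchor_scale[OF subspace_0[OF A.fib_subspace], of y 0]
    by (simp add: L_iff)
  have lift: "\<exists>u\<in>fib A y. X = \<rho> y u" if "X \<in> tangent_space M y" for X y
    using that anchor_surj[of y] by blast
  have sec: "(\<lambda>y. \<theta> y (\<rho> y (a y))) \<in> sections M E\<^sub>0" if "a \<in> sections M A" for a
    using cocycle_section_E0[OF c van that] eq[OF A.sectionsD(1)[OF that]] by simp
  have "\<theta> y X \<in> F\<^sub>0 y" if X: "X \<in> tangent_space M y" for y X
  proof -
    obtain u where u: "u \<in> fib A y" "X = \<rho> y u" using lift[OF X] by blast
    obtain a where "a \<in> sections M A" "a y = u" using A.section_through[OF u(1)] .
    then show ?thesis using E0.sectionsD(1)[OF sec, of a y] u(2) by (simp add: E0_simps)
  qed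
  moreover have "\<theta> y (X + Y) = \<theta> y X + \<theta> y Y" if XY: "X \<in> tangent_space M y" "Y \<in> tangent_space M y" for y X Y
  proof -
    obtain u v where uv: "u \<in> fib A y" "X = \<rho> y u" "v \<in> fib A y" "Y = \<rho> y v" using lift[OF XY(1)] lift[OF XY(2)] by blast
    have "\<theta> y (\<rho> y (u + v)) = ?\<Omega> y u + ?\<Omega> y v"
      using eq[OF subspace_add[OF A.fib_subspace uv(1,3)]] bm uv by (simp add: bundle_map_def)
    then show ?thesis using eq uv anchor_add by simp
  qed
  moreover have "\<theta> y (r *\<^sub>R X) = r *\<^sub>R \<theta> y X" if X: "X \<in> tangent_space M y" for y X r
  proof -
    obtain u where u: "u \<in> fib A y" "X = \<rho> y u" using lift[OF X] by blast
    have "\<theta> y (\<rho> y (r *\<^sub>R u)) = r *\<^sub>R ?\<Omega> y u"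
      using eq[OF subspace_scale[OF A.fib_subspace u(1)]] bm u by (simp add: bundle_map_def)
    then show ?thesis using eq u anchor_scale by simp
  qed
  moreover have "smooth_section_on M E\<^sub>0 U (\<lambda>y. \<theta> y (e y))" if U: "(U, es) \<in> frames TM" and e: "e \<in> set es" for U es e
  proof -
    have oU: "open U" by (rule framedD(2)[OF framed_TM U])
    obtain \<phi> bs where *: "(U, \<phi>) \<in> charts M" "is_basis_list bs (model M)" "es = map (coord_field M U \<phi>) bs"
      using U TM_simps(3) by blast
    obtain j where j: "j < length bs" "e = coord_field M U \<phi> (bs ! j)"
      using e *(3) by (auto simp: in_set_conv_nth)
    have "\<theta> y (e y) \<in> F\<^sub>0 y \<and> sec_at M E\<^sub>0 (\<lambda>y. \<theta> y (e y)) y" if y: "y \<in> U" for y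
    proof -
      obtain N X where X: "open N" "y \<in> N" "N \<subseteq> U" "\<And>j. j < length bs \<Longrightarrow> X j \<in> sections M A"
        "\<And>j y. j < length bs \<Longrightarrow> y \<in> N \<Longrightarrow> \<rho> y (X j y) = coord_field M U \<phi> (bs ! j) y"
        using local_lifts[OF *(1) y *(2)] by metis
      have s: "(\<lambda>y. \<theta> y (\<rho> y (X j y))) \<in> sections M E\<^sub>0" by (rule sec[OF X(4)[OF j(1)]])
      have e': "\<theta> z (\<rho> z (X j z)) = \<theta> z (e z)" if "z \<in> N" for z using X(5)[OF j(1) that] j(2) by simp
      have "\<theta> y (e y) \<in> F\<^sub>0 y" using s e'[OF X(2)] unfolding sections_E0_iff by metis
      then show ?thesis using sec_at_cong[OF E0.sectionsD(2)[OF s] X(1,2) e'] by blast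
    qed
    then show ?thesis unfolding smooth_section_on_iff[OF framed_E0 oU] E0_simps(1) by blast
  qed
  ultimately have bm0: "bundle_map M TM E\<^sub>0 \<theta>"
    unfolding bundle_map_def TM_simps(1) E0_simps(1) by blast
  have "\<theta> y (bracket TM a b y) = R\<^sub>0 y (a y) (\<lambda>z. \<theta> z (b z)) - R\<^sub>0 y (b y) (\<lambda>z. \<theta> z (a z))"
    if ab: "a \<in> sections M TM" "b \<in> sections M TM" for a b y
  proof -
    obtain a' where a': "a' \<in> sections M A" "\<And>y. \<rho> y (a' y) = a y" using lift_section[OF ab(1)] by metis
    obtain b' where b': "b' \<in> sections M A" "\<And>y. \<rho> y (b' y) = b y" using lift_section[OF ab(2)] by metis
    have "bracket TM a b y = \<rho> y (bracket A a' b' y)"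
      using fun_cong[OF anchor_bracket[OF a'(1) b'(1)], of y] a'(2) b'(2) by simp
    then have "\<theta> y (bracket TM a b y) = ?\<Omega> y (bracket A a' b' y)"
      using eq[OF A.sectionsD(1)[OF bracket_section[OF a'(1) b'(1)]]] by simp
    also have "\<dots> = R y (a' y) (\<lambda>z. ?\<Omega> z (b' z)) - R y (b' y) (\<lambda>z. ?\<Omega> z (a' z))"
      using c a'(1) b'(1) unfolding cocycle_map_def by blast
    also have "\<dots> = R y (a' y) (\<lambda>z. \<theta> z (\<rho> z (b' z))) - R y (b' y) (\<lambda>z. \<theta> z (\<rho> z (a' z)))"
      using eq[OF A.sectionsD(1)[OF a'(1)]] eq[OF A.sectionsD(1)[OF b'(1)]] by simp
    also have "\<dots> = R\<^sub>0 y (\<rho> y (a' y)) (\<lambda>z. \<theta> z (\<rho> z (b' z))) - R\<^sub>0 y (\<rho> y (b' y)) (\<lambda>z. \<theta> z (\<rho> z (a' z)))"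
      using reduced_eq[OF sec[OF b'(1)] A.sectionsD(1)[OF a'(1)]]
        reduced_eq[OF sec[OF a'(1)] A.sectionsD(1)[OF b'(1)]] by simp
    finally show ?thesis using a'(2) b'(2) by simp
  qed
  then show ?thesis using bm0 \<theta> unfolding cocycles1_def cochains1_def by (auto simp: TM_simps(1))
qed

lemma pullback_cocycle:
  assumes "\<theta> \<in> Z\<^sub>0"
  shows "anchor_pullback A \<theta> \<in> Z"
proof -
  let ?\<Psi> = "\<lambda>y u. \<theta> y (\<rho> y u)"
  have bm0: "bundle_map M TM E\<^sub>0 \<theta>"
    and cc: "\<And>a b y. a \<in> sections M TM \<Longrightarrow> b \<in> sections M TM \<Longrightarrow>
      \<theta> y (bracket TM a b y) = R\<^sub>0 y (a y) (\<lambda>z. \<theta> z (b z)) - R\<^sub>0 y (b y) (\<lambda>z. \<theta> z (a z))"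
    using assms unfolding cocycles1_def cochains1_def by auto
  have lin: "\<theta> y X \<in> F\<^sub>0 y" "\<theta> y (r *\<^sub>R X) = r *\<^sub>R \<theta> y X" if "X \<in> tangent_space M y" for y X r
    using bm0 that unfolding bundle_map_def TM_simps(1) E0_simps(1) by blast+
  have add: "\<theta> y (X + Y) = \<theta> y X + \<theta> y Y" if "X \<in> tangent_space M y" "Y \<in> tangent_space M y" for y X Y
    using bm0 that unfolding bundle_map_def TM_simps(1) by blast
  have sat: "sec_at M E\<^sub>0 (\<lambda>z. \<theta> z (s z)) y" if "sec_at M TM s y" for s y
  proof -
    obtain W \<phi> where c: "(W, \<phi>) \<in> charts M" "y \<in> W" by (rule chart_exists)
    obtain bs where bs: "is_basis_list bs (model M)" by (rule model_basis)
    have fr: "(W, map (coord_field M W \<phi>) bs) \<in> frames TM" using c bs TM_simps(3) by blast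
    show ?thesis by (rule bundle_map_sec_at[OF bm0 framed_TM framed_E0 fr c(2) that])
  qed
  have "smooth_section_on M F U (\<lambda>y. \<theta> y (\<rho> y (e y)))" if U: "(U, es) \<in> frames A" and e: "e \<in> set es" for U es e
  proof -
    have oU: "open U" by (rule framedD(2)[OF A.framed U])
    have "smooth_section_on M TM U (\<lambda>y. \<rho> y (e y))" using anchor_map U e unfolding bundle_map_def by blast
    then show ?thesis
      unfolding smooth_section_on_iff[OF framed_TM oU] smooth_section_on_iff[OF F.framed oU] TM_simps(1)
      using sat sec_at_E0D lin(1) F0_subset by blast
  qed
  then have bm: "bundle_map M A F ?\<Psi>"
    unfolding bundle_map_def
    using lin add anchor_tangent F0_subset by (auto simp: anchor_add anchor_scale)
  have sec: "(\<lambda>z. \<theta> z (\<rho> z (a z))) \<in> sections M E\<^sub>0" if "a \<in> sections M A" for a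
    using anchor_section[OF that] sat lin(1) unfolding sections_iff[OF framed_E0] sections_iff[OF framed_TM] TM_simps(1) E0_simps(1)
    by blast
  have "?\<Psi> y (bracket A a b y) = R y (a y) (\<lambda>z. ?\<Psi> z (b z)) - R y (b y) (\<lambda>z. ?\<Psi> z (a z))"
    if ab: "a \<in> sections M A" "b \<in> sections M A" for a b y
    using fun_cong[OF anchor_bracket[OF ab], of y] cc[OF anchor_section[OF ab(1)] anchor_section[OF ab(2)], of y]
      reduced_eq[OF sec[OF ab(2)] A.sectionsD(1)[OF ab(1)]] reduced_eq[OF sec[OF ab(1)] A.sectionsD(1)[OF ab(2)]]
    by simp
  then have "cocycle_map ?\<Psi>" using bm unfolding cocycle_map_def by blast
  then have "cocycle_map (anchor_pullback A \<theta>)"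
    by (rule cocycle_map_cong) (simp add: anchor_pullback_def)
  then show ?thesis by (simp add: cocycles_iff anchor_pullback_def)
qed

abbreviation "T\<^sub>0 \<equiv> {\<theta> :: 'm \<Rightarrow> (('m \<Rightarrow> real) \<Rightarrow> real) \<Rightarrow> 'f. \<forall>y X. X \<notin> tangent_space M y \<longrightarrow> \<theta> y X = 0}"

text \<open>Among forms normalised outside the tangent spaces, closedness is a condition on the
  pullback alone. Together with \<open>B0_iff\<close> this presents closed and exact forms as
  preimages under one linear map, the setting of \<open>induced_map_iso\<close>.\<close>

lemma Z0_iff: "Z\<^sub>0 = {\<theta> \<in> T\<^sub>0. anchor_pullback A \<theta> \<in> Z}"
proof -
  have "\<theta> \<in> T\<^sub>0" if "\<theta> \<in> Z\<^sub>0" for \<theta>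
    using that unfolding cocycles1_def cochains1_def by (simp add: TM_simps(1))
  then show ?thesis using cocycle_descends pullback_cocycle by blast
qed

lemma coboundary_cocycle: "\<mu> \<in> sections M F \<Longrightarrow> coboundary0 A R \<mu> \<in> Z"
  unfolding cocycles_iff by (auto simp: coboundary0_def intro: cocycle_map_cong[OF cocycle_map_R])

lemma pullback_coboundary:
  assumes "\<nu> \<in> sections M E\<^sub>0"
  shows "anchor_pullback A (coboundary0 TM R\<^sub>0 \<nu>) = coboundary0 A R \<nu>"
  using reduced_eq[OF assms] anchor_tangent
  by (auto simp: anchor_pullback_def coboundary0_def TM_simps(1) fun_eq_iff)

text \<open>The source of injectivity on cohomology: a primitive \<open>\<mu>\<close> of the
  pullback is annihilated by \<open>L\<close>, since the pullback vanishes there, so it is a section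
  of the invariant bundle and its reduced differential is \<open>\<theta>\<close>.\<close>

lemma B0_iff: "B\<^sub>0 = {\<theta> \<in> T\<^sub>0. anchor_pullback A \<theta> \<in> B}"
proof (intro equalityI subsetI)
  fix \<theta> assume "\<theta> \<in> B\<^sub>0"
  then obtain \<nu> where \<nu>: "\<nu> \<in> sections M E\<^sub>0" "\<theta> = coboundary0 TM R\<^sub>0 \<nu>"
    unfolding coboundaries1_def by blast
  have "anchor_pullback A \<theta> \<in> B"
    unfolding \<nu>(2) pullback_coboundary[OF \<nu>(1)] coboundaries1_def using sections_E0D(1)[OF \<nu>(1)] by blast
  moreover have "\<theta> \<in> T\<^sub>0" by (simp add: \<nu>(2) coboundary0_def TM_simps(1))
  ultimately show "\<theta> \<in> {\<theta> \<in> T\<^sub>0. anchor_pullback A \<theta> \<in> B}" by blast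
next
  fix \<theta> assume "\<theta> \<in> {\<theta> \<in> T\<^sub>0. anchor_pullback A \<theta> \<in> B}"
  then obtain \<mu> where \<mu>: "\<mu> \<in> sections M F" "anchor_pullback A \<theta> = coboundary0 A R \<mu>" and T0: "\<theta> \<in> T\<^sub>0"
    unfolding coboundaries1_def by blast
  have eq: "\<theta> y (\<rho> y u) = R y u \<mu>" if "u \<in> fib A y" for y u
    using fun_cong[OF fun_cong[OF \<mu>(2)], of y u] that by (simp add: anchor_pullback_def coboundary0_def)
  have "R y u \<mu> = 0" if "u \<in> L y" for y u
  proof -
    have "R y u \<mu> = \<theta> y (\<rho> y 0)"
      using eq[of u y] that anchor_scale[OF subspace_0[OF A.fib_subspace], of y 0] by (simp add: L_iff)
    also have "\<dots> = R y (0 *\<^sub>R 0) \<mu>" using eq[OF subspace_0[OF A.fib_subspace]] by simp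
    also have "\<dots> = 0" using R_scale_left[OF subspace_0[OF A.fib_subspace] \<mu>(1), of y 0] by simp
    finally show ?thesis .
  qed
  then have E: "\<mu> \<in> sections M E\<^sub>0" by (rule sections_E0I[OF \<mu>(1)])
  have "\<theta> y X = coboundary0 TM R\<^sub>0 \<mu> y X" for y X
  proof (cases "X \<in> tangent_space M y")
    case True
    then obtain u where "u \<in> fib A y" "X = \<rho> y u" using anchor_surj[of y] by blast
    then show ?thesis using eq reduced_eq[OF E] True by (simp add: coboundary0_def TM_simps(1))
  next
    case False
    then show ?thesis using T0 by (simp add: coboundary0_def TM_simps(1))
  qed
  then have "\<theta> = coboundary0 TM R\<^sub>0 \<mu>" by (intro ext)
  then show "\<theta> \<in> B\<^sub>0" using E unfolding coboundaries1_def by blast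
qed

section \<open>Linear structure of cocycles and coboundaries\<close>

lemma cocycle_map_combination:
  assumes "cocycle_map \<Phi>" "cocycle_map \<Psi>"
  shows "cocycle_map (\<lambda>y u. r *\<^sub>R \<Phi> y u + t *\<^sub>R \<Psi> y u)"
proof -
  have bm: "bundle_map M A F \<Phi>" "bundle_map M A F \<Psi>" using assms by (auto simp: cocycle_map_def)
  have "smooth_section_on M F U (\<lambda>y. r *\<^sub>R \<Phi> y (e y) + t *\<^sub>R \<Psi> y (e y))"
    if U: "(U, es) \<in> frames A" and e: "e \<in> set es" for U es e
  proof -
    have oU: "open U" by (rule framedD(2)[OF A.framed U])
    have "smooth_section_on M F U (\<lambda>y. \<Phi> y (e y))" "smooth_section_on M F U (\<lambda>y. \<Psi> y (e y))"
      using bm U e unfolding bundle_map_def by blast+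
    then show ?thesis
      unfolding smooth_section_on_iff[OF F.framed oU]
      by (auto intro!: sec_at_add sec_at_scale subspace_add subspace_scale F.fib_subspace)
  qed
  then have "bundle_map M A F (\<lambda>y u. r *\<^sub>R \<Phi> y u + t *\<^sub>R \<Psi> y u)"
    using bm subspace_add[OF F.fib_subspace] subspace_scale[OF F.fib_subspace]
    unfolding bundle_map_def by (auto simp: algebra_simps)
  moreover have "R y u (\<lambda>z. r *\<^sub>R \<Phi> z (a z) + t *\<^sub>R \<Psi> z (a z)) = r *\<^sub>R R y u (\<lambda>z. \<Phi> z (a z)) + t *\<^sub>R R y u (\<lambda>z. \<Psi> z (a z))"
    if u: "u \<in> fib A y" and a: "a \<in> sections M A" for u y a
  proof -
    have s: "(\<lambda>z. \<Phi> z (a z)) \<in> sections M F" "(\<lambda>z. \<Psi> z (a z)) \<in> sections M F"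
      using bundle_map_section[OF bm(1) a] bundle_map_section[OF bm(2) a] .
    show ?thesis
      using R_add[OF u F.sections_scale[OF s(1), of r] F.sections_scale[OF s(2), of t]]
        R_scaleR[OF u s(1)] R_scaleR[OF u s(2)]
      by (simp add: scaleR_fun_def)
  qed
  moreover have "\<Phi> y (bracket A a b y) = R y (a y) (\<lambda>z. \<Phi> z (b z)) - R y (b y) (\<lambda>z. \<Phi> z (a z))"
    "\<Psi> y (bracket A a b y) = R y (a y) (\<lambda>z. \<Psi> z (b z)) - R y (b y) (\<lambda>z. \<Psi> z (a z))"
    if "a \<in> sections M A" "b \<in> sections M A" for a b y
    using assms that unfolding cocycle_map_def by blast+
  ultimately show ?thesis
    unfolding cocycle_map_def by (auto simp: A.sectionsD(1) scaleR_right_diff_distrib)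
qed

lemma subspace_Z: "subspace Z"
proof -
  have comb: "cocycle_map (r *\<^sub>R \<Phi> + t *\<^sub>R \<Psi>)" if "cocycle_map \<Phi>" "cocycle_map \<Psi>" for \<Phi> \<Psi> r t
    using cocycle_map_combination[OF that] by (simp add: plus_fun_def scaleR_fun_def)
  have 0: "cocycle_map 0" using cocycle_map_zero by (simp add: zero_fun_def)
  show ?thesis
    unfolding subspace_def cocycles_iff
    using 0 comb[of _ _ 1 1] comb[OF _ 0, of _ _ 0]
    by (auto simp: cocycles_iff zero_fun_def plus_fun_def scaleR_fun_def)
qed

lemma coboundary_combination:
  assumes "\<mu> \<in> sections M F" "\<nu> \<in> sections M F"
  shows "coboundary0 A R (r *\<^sub>R \<mu> + t *\<^sub>R \<nu>) = r *\<^sub>R coboundary0 A R \<mu> + t *\<^sub>R coboundary0 A R \<nu>"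
  using R_plus[OF _ F.sections_scale[OF assms(1)] F.sections_scale[OF assms(2)]] R_scaleR[OF _ assms(1)] R_scaleR[OF _ assms(2)]
  by (auto simp: fun_eq_iff coboundary0_def plus_fun_def scaleR_fun_def)

lemma subspace_B: "subspace B"
proof -
  have 0: "(\<lambda>_. 0) \<in> sections M F" by (rule F.sections_zero)
  have "coboundary0 A R (\<lambda>_. 0) = 0" by (auto simp: fun_eq_iff coboundary0_def R_zero)
  then have "0 \<in> B" using 0 unfolding coboundaries1_def by (metis image_eqI)
  moreover have "r *\<^sub>R x + t *\<^sub>R y \<in> B" if xy: "x \<in> B" "y \<in> B" for x y r t
  proof -
    obtain \<mu> \<nu> where *: "\<mu> \<in> sections M F" "x = coboundary0 A R \<mu>" "\<nu> \<in> sections M F" "y = coboundary0 A R \<nu>"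
      using xy unfolding coboundaries1_def by blast
    have "r *\<^sub>R \<mu> + t *\<^sub>R \<nu> \<in> sections M F" by (intro F.sections_add F.sections_scale *)
    then show ?thesis using coboundary_combination[OF *(1,3)] *(2,4) unfolding coboundaries1_def by (metis image_eqI)
  qed
  from this[of _ _ 1 1] this[of _ _ _ 0] \<open>0 \<in> B\<close> have "0 \<in> B" "\<And>x y. x \<in> B \<Longrightarrow> y \<in> B \<Longrightarrow> x + y \<in> B" "\<And>r x. x \<in> B \<Longrightarrow> r *\<^sub>R x \<in> B"
    by (auto simp: algebra_simps) 
  then show ?thesis unfolding subspace_def by blast
qed

lemma subspace_T0: "subspace T\<^sub>0"
  by (auto simp: subspace_def zero_fun_def plus_fun_def scaleR_fun_def)

lemma pullback_linear: "anchor_pullback A (\<theta> + \<theta>') = anchor_pullback A \<theta> + anchor_pullback A \<theta>'"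
  "anchor_pullback A (r *\<^sub>R \<theta>) = r *\<^sub>R anchor_pullback A \<theta>"
  for \<theta> \<theta>' :: "'m \<Rightarrow> (('m \<Rightarrow> real) \<Rightarrow> real) \<Rightarrow> 'f"
  by (auto simp: fun_eq_iff anchor_pullback_def plus_fun_def scaleR_fun_def)

end

section \<open>Quotients of vector spaces\<close>

abbreviation cls :: "'v::real_vector set \<Rightarrow> 'v set \<Rightarrow> 'v \<Rightarrow> 'v set" where
  "cls Z B z \<equiv> cong_mod Z B `` {z}"

lemma equiv_cong_mod:
  assumes "subspace B"
  shows "equiv Z (cong_mod Z B)"
proof (rule equivI)
  show "cong_mod Z B \<subseteq> Z \<times> Z" by (auto simp: cong_mod_def)
  show "refl_on Z (cong_mod Z B)"
    using subspace_0[OF assms] by (auto simp: refl_on_def cong_mod_def)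
  show "sym (cong_mod Z B)"
    using subspace_neg[OF assms] by (fastforce simp: sym_def cong_mod_def)
  show "trans (cong_mod Z B)"
  proof (rule transI)
    fix u v w assume "(u, v) \<in> cong_mod Z B" "(v, w) \<in> cong_mod Z B"
    then show "(u, w) \<in> cong_mod Z B"
      using subspace_add[OF assms, of "u - v" "v - w"] by (simp add: cong_mod_def)
  qed
qed

lemma cls_eq_iff: "subspace B \<Longrightarrow> z \<in> Z \<Longrightarrow> w \<in> Z \<Longrightarrow> cls Z B z = cls Z B w \<longleftrightarrow> z - w \<in> B"
  using eq_equiv_class_iff[OF equiv_cong_mod] by (fastforce simp: cong_mod_def)

lemma carrier_quotient_space: "space_carrier (quotient_space Z B) = cls Z B ` Z"
  by (auto simp: quotient_space_def quotient_def)

lemma mem_cls: "w \<in> cls Z B z \<longleftrightarrow> z \<in> Z \<and> w \<in> Z \<and> z - w \<in> B"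
  by (simp add: cong_mod_def)

lemma cls_self: "subspace B \<Longrightarrow> z \<in> Z \<Longrightarrow> z \<in> cls Z B z"
  by (simp add: cong_mod_def subspace_0)

text \<open>\<open>induced_map\<close> is a union over representatives; compatibility of
  \<open>h\<close> with the two congruences makes all members of this union the same class.\<close>

lemma induced_map_cls:
  assumes "subspace B" "subspace B'" "z \<in> Z" "\<And>z. z \<in> Z \<Longrightarrow> h z \<in> Z'"
    "\<And>z w. z \<in> Z \<Longrightarrow> w \<in> Z \<Longrightarrow> z - w \<in> B \<Longrightarrow> h z - h w \<in> B'"
  shows "induced_map Z' B' h (cls Z B z) = cls Z' B' (h z)"
proof -
  have "cls Z' B' (h w) = cls Z' B' (h z)" if "w \<in> cls Z B z" for w
    using that assms(4) assms(5)[of z w] cls_eq_iff[OF assms(2)] by (metis mem_cls)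
  then show ?thesis
    unfolding induced_map_def using cls_self[OF assms(1,3)] by blast
qed

lemma quotient_add:
  assumes "subspace Z" "subspace B" "z \<in> Z" "w \<in> Z"
  shows "space_add (quotient_space Z B) (cls Z B z) (cls Z B w) = cls Z B (z + w)"
proof -
  have "cls Z B (z' + w') = cls Z B (z + w)" if "z' \<in> cls Z B z" "w' \<in> cls Z B w" for z' w'
  proof -
    have "(z - z') + (w - w') \<in> B" using that subspace_add[OF assms(2)] by (simp add: cong_mod_def)
    then have "(z + w) - (z' + w') \<in> B" by (simp add: algebra_simps)
    then show ?thesis
      using that subspace_add[OF assms(1)] assms(3,4) cls_eq_iff[OF assms(2), of "z + w" Z "z' + w'"]
      by (simp add: cong_mod_def)
  qed
  moreover have "space_add (quotient_space Z B) c d = (\<Union>z\<in>c. \<Union>w\<in>d. cls Z B (z + w))" for c d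
    by (simp add: quotient_space_def)
  moreover have "cls Z B z \<noteq> {}" "cls Z B w \<noteq> {}"
    using cls_self[OF assms(2,3)] cls_self[OF assms(2,4)] by blast+
  ultimately show ?thesis by (simp only:) (intro SUP_eq_const)
qed

lemma quotient_scale:
  assumes "subspace Z" "subspace B" "z \<in> Z"
  shows "space_scale (quotient_space Z B) r (cls Z B z) = cls Z B (r *\<^sub>R z)"
proof -
  have "cls Z B (r *\<^sub>R z') = cls Z B (r *\<^sub>R z)" if "z' \<in> cls Z B z" for z'
  proof -
    have "r *\<^sub>R z - r *\<^sub>R z' \<in> B"
      using that subspace_scale[OF assms(2), of "z - z'" r] by (simp add: cong_mod_def scaleR_right_diff_distrib)
    then show ?thesis
      using that subspace_scale[OF assms(1)] assms(3) cls_eq_iff[OF assms(2), of "r *\<^sub>R z" Z "r *\<^sub>R z'"]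
      by (simp add: cong_mod_def)
  qed
  moreover have "space_scale (quotient_space Z B) r c = (\<Union>z\<in>c. cls Z B (r *\<^sub>R z))" for c
    by (simp add: quotient_space_def)
  moreover have "cls Z B z \<noteq> {}" using cls_self[OF assms(2,3)] by blast
  ultimately show ?thesis by (simp only:) (intro SUP_eq_const)
qed

text \<open>\<open>Z0\<close> and \<open>B0\<close> are full preimages in \<open>S\<close>. If the
  images of two elements of \<open>Z0\<close> differ by an element of \<open>B\<close>, their
  difference lies in \<open>S\<close> and is mapped into \<open>B\<close>, hence lies in
  \<open>B0\<close>; this is injectivity. The target is the image, so surjectivity is
  automatic.\<close>

lemma induced_map_iso:
  assumes Z: "subspace Z" "subspace B" and S: "subspace S"
    and h: "\<And>a b. h (a + b) = h a + h b" "\<And>r a. h (r *\<^sub>R a) = r *\<^sub>R h a"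
    and Z0: "Z0 = {a \<in> S. h a \<in> Z}" and B0: "B0 = {a \<in> S. h a \<in> B}"
  shows "linear_iso_onto (quotient_space Z0 B0) (quotient_space Z B)
    (induced_map Z B h ` space_carrier (quotient_space Z0 B0)) (induced_map Z B h)"
    and "z \<in> Z0 \<Longrightarrow> induced_map Z B h (cls Z0 B0 z) = cls Z B (h z)"
proof -
  have hd: "h (a - b) = h a - h b" for a b
    using h(1)[of "a - b" b] by simp
  have h0: "h 0 = 0" using h(1)[of 0 0] by simp
  have sub: "subspace Z0" "subspace B0"
    unfolding Z0 B0 using S Z by (auto simp: subspace_def h h0)
  have ind: "induced_map Z B h (cls Z0 B0 z) = cls Z B (h z)" if "z \<in> Z0" for z
    by (rule induced_map_cls[OF sub(2) Z(2) that]) (auto simp: Z0 B0 hd)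
  then show "z \<in> Z0 \<Longrightarrow> induced_map Z B h (cls Z0 B0 z) = cls Z B (h z)" .
  have hZ: "h z \<in> Z" if "z \<in> Z0" for z using that by (simp add: Z0)
  show "linear_iso_onto (quotient_space Z0 B0) (quotient_space Z B)
    (induced_map Z B h ` space_carrier (quotient_space Z0 B0)) (induced_map Z B h)"
    unfolding linear_iso_onto_def carrier_quotient_space
  proof (intro conjI ballI allI)
    show "induced_map Z B h ` cls Z0 B0 ` Z0 \<subseteq> cls Z B ` Z" using ind hZ by auto
    have "inj_on (induced_map Z B h) (cls Z0 B0 ` Z0)"
    proof (rule inj_onI)
      fix c d assume "c \<in> cls Z0 B0 ` Z0" "d \<in> cls Z0 B0 ` Z0" and eq: "induced_map Z B h c = induced_map Z B h d"
      then obtain z w where zw: "z \<in> Z0" "w \<in> Z0" "c = cls Z0 B0 z" "d = cls Z0 B0 w" by blast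
      then have "h z - h w \<in> B" using eq ind cls_eq_iff[OF Z(2) hZ hZ] by auto
      moreover have "z - w \<in> S" using zw S unfolding Z0 by (auto intro: subspace_diff)
      ultimately have "z - w \<in> B0" by (simp add: B0 hd)
      then show "c = d" using zw cls_eq_iff[OF sub(2)] by simp
    qed
    then show "bij_betw (induced_map Z B h) (cls Z0 B0 ` Z0) (induced_map Z B h ` cls Z0 B0 ` Z0)"
      by (simp add: bij_betw_def)
  next
    fix c d assume "c \<in> cls Z0 B0 ` Z0" "d \<in> cls Z0 B0 ` Z0"
    then obtain z w where zw: "z \<in> Z0" "w \<in> Z0" "c = cls Z0 B0 z" "d = cls Z0 B0 w" by blast
    then show "induced_map Z B h (space_add (quotient_space Z0 B0) c d) =
        space_add (quotient_space Z B) (induced_map Z B h c) (induced_map Z B h d)"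
      using subspace_add[OF sub(1)] by (simp add: quotient_add sub Z ind hZ h)
  next
    fix c r assume "c \<in> cls Z0 B0 ` Z0"
    then obtain z where z: "z \<in> Z0" "c = cls Z0 B0 z" by blast
    then show "induced_map Z B h (space_scale (quotient_space Z0 B0) r c) =
        space_scale (quotient_space Z B) r (induced_map Z B h c)"
      using subspace_scale[OF sub(1)] by (simp add: quotient_scale sub Z ind hZ h)
  qed
qed

lemma space_kernel_induced:
  assumes Z: "subspace B" "subspace B'" and 0: "0 \<in> Z'"
    and g: "\<And>a. a \<in> Z \<Longrightarrow> g a \<in> Z'" "\<And>a b. a \<in> Z \<Longrightarrow> b \<in> Z \<Longrightarrow> a - b \<in> B \<Longrightarrow> g a - g b \<in> B'"
  shows "space_kernel (quotient_space Z B) (quotient_space Z' B') (induced_map Z' B' g) =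
    cls Z B ` {z \<in> Z. g z \<in> B'}"
proof -
  have ind: "induced_map Z' B' g (cls Z B z) = cls Z' B' (g z)" if "z \<in> Z" for z
    by (rule induced_map_cls[OF Z that]) (use g in auto)
  have "induced_map Z' B' g (cls Z B z) = cls Z' B' 0 \<longleftrightarrow> g z \<in> B'" if "z \<in> Z" for z
    using cls_eq_iff[OF Z(2) g(1)[OF that] 0] ind[OF that] by simp
  moreover have "space_zero (quotient_space Z' B') = cls Z' B' 0" by (simp add: quotient_space_def)
  ultimately show ?thesis
    unfolding space_kernel_def carrier_quotient_space by auto
qed

section \<open>The kernel of the localization map\<close>

context algebroid_rep
begin

lemma adjoint_restriction_cocycle:
  assumes "\<Omega> \<in> Z"
  shows "(\<lambda>u. if u \<in> L x then \<Omega> x u else 0) \<in> adjoint_cocycles1 M A F R x"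
proof -
  have c: "cocycle_map \<Omega>" using assms by (simp add: cocycles_iff)
  then have bm: "bundle_map M A F \<Omega>" by (simp add: cocycle_map_def)
  have Lf: "u \<in> fib A x" if "u \<in> L x" for u using that by (simp add: L_iff)
  have br: "adjoint_bracket M A x u v \<in> L x \<and> \<Omega> x (adjoint_bracket M A x u v) =
      adjoint_action M F R x u (\<Omega> x v) - adjoint_action M F R x v (\<Omega> x u)"
    if uv: "u \<in> L x" "v \<in> L x" for u v
  proof -
    obtain a where a: "a \<in> sections M A" "a x = u" using A.section_through[OF Lf[OF uv(1)]] .
    \<comment> \<open>The section through \<open>u\<close> may be arbitrary; the one through
      \<open>v\<close> is taken in \<open>L\<close> everywhere, so that \<open>bracket_in_L\<close>
      applies.\<close>
    obtain b where b: "b \<in> sections M A" "b x = v" "\<And>z. b z \<in> L z" by (rule L_section_through[OF uv(2)]) blast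
    have "bracket A a b x \<in> L x" by (rule bracket_in_L[OF a(1) b(1) open_UNIV UNIV_I b(3)])
    moreover have "adjoint_bracket M A x u v = bracket A a b x"
      using adjoint_bracket_eq[OF a(1) b(1), of x] uv a(2) b(2) by simp
    moreover have "\<Omega> x (bracket A a b x) = R x (a x) (\<lambda>z. \<Omega> z (b z)) - R x (b x) (\<lambda>z. \<Omega> z (a z))"
      using c a(1) b(1) unfolding cocycle_map_def by blast
    ultimately show ?thesis
      using adjoint_action_eq[OF uv(1) bundle_map_section[OF bm b(1)]]
        adjoint_action_eq[OF uv(2) bundle_map_section[OF bm a(1)]] a(2) b(2) by simp
  qed
  show ?thesis
    unfolding adjoint_cocycles1_def lie_cocycles1_def
    using br bm subspace_add[OF subspace_L, of _ x] subspace_scale[OF subspace_L, of _ x]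
    by (auto simp: bundle_map_def Lf)
qed

lemma subspace_adjoint_coboundaries: "subspace (adjoint_coboundaries1 M A F R x)"
proof -
  let ?d = "\<lambda>\<nu> u. if u \<in> L x then adjoint_action M F R x u \<nu> else 0"
  have lin: "r *\<^sub>R ?d \<mu> + t *\<^sub>R ?d \<nu> = ?d (r *\<^sub>R \<mu> + t *\<^sub>R \<nu>)" if "\<mu> \<in> fib F x" "\<nu> \<in> fib F x" for r t \<mu> \<nu>
    using adjoint_action_linear[OF _ that] by (auto simp: fun_eq_iff plus_fun_def scaleR_fun_def)
  have comb: "r *\<^sub>R \<alpha> + t *\<^sub>R \<beta> \<in> ?d ` fib F x" if "\<alpha> \<in> ?d ` fib F x" "\<beta> \<in> ?d ` fib F x" for r t \<alpha> \<beta>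
  proof -
    obtain \<mu> \<nu> where *: "\<mu> \<in> fib F x" "\<nu> \<in> fib F x" "\<alpha> = ?d \<mu>" "\<beta> = ?d \<nu>" using \<open>\<alpha> \<in> _\<close> \<open>\<beta> \<in> _\<close> by blast
    have "r *\<^sub>R \<mu> + t *\<^sub>R \<nu> \<in> fib F x"
      using * by (intro subspace_add subspace_scale F.fib_subspace)
    then show ?thesis unfolding *(3,4) lin[OF *(1,2)] by (rule imageI)
  qed
  have "?d 0 \<in> ?d ` fib F x" using subspace_0[OF F.fib_subspace] by (rule imageI)
  from comb[OF this this, of 0 0] comb[of _ _ 1 1] comb[of _ _ _ 0]
  show ?thesis
    unfolding adjoint_coboundaries1_def lie_coboundaries1_def subspace_def by simp
qed

text \<open>Translates vanishing of the localized class into the solvability at one point from which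
  \<open>solvable_everywhere\<close> starts.\<close>

lemma adjoint_coboundary_iff:
  "(\<lambda>u. if u \<in> L x then \<Omega> x u else 0) \<in> adjoint_coboundaries1 M A F R x \<longleftrightarrow> (\<exists>w. solves \<Omega> x w)"
  unfolding adjoint_coboundaries1_def lie_coboundaries1_def solves_def image_iff fun_eq_iff
  by (metis (no_types, lifting))

lemma cohomologous_to_pullback:
  assumes conn: "connected (UNIV :: 'm set)" and \<Omega>: "\<Omega> \<in> Z" and x: "solves \<Omega> x w"
  obtains \<theta> where "\<theta> \<in> Z\<^sub>0" "\<Omega> - anchor_pullback A \<theta> \<in> B"
proof -
  have c: "cocycle_map \<Omega>" using \<Omega> by (simp add: cocycles_iff)
  obtain \<mu> where \<mu>: "\<mu> \<in> sections M F" "\<And>y. solves \<Omega> y (\<mu> y)"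
    using global_solution[OF c solvable_everywhere[OF conn c x]] by metis
  define \<Psi> where "\<Psi> = \<Omega> - coboundary0 A R \<mu>"
  have \<Psi>: "\<Psi> \<in> Z" unfolding \<Psi>_def by (rule subspace_diff[OF subspace_Z \<Omega> coboundary_cocycle[OF \<mu>(1)]])
  have van: "\<Psi> y u = 0" if "u \<in> L y" for y u
    using \<mu>(2)[of y] solves_section[OF \<mu>(1), of \<Omega> y] that
    by (simp add: \<Psi>_def coboundary0_def L_iff fun_diff_def)
  have out: "\<Psi> y u = 0" if "u \<notin> fib A y" for y u using \<Psi> that by (simp add: cocycles_iff)
  have bm: "bundle_map M A F \<Psi>" using \<Psi> by (simp add: cocycles_iff cocycle_map_def)
  \<comment> \<open>Any lift may be chosen: two lifts differ by an element of \<open>L\<close>, on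
    which \<open>\<Psi>\<close> vanishes. The value 0 outside the tangent space is the normalisation
    of cochains.\<close>
  define \<theta> where "\<theta> y X = (if X \<in> tangent_space M y then \<Psi> y (SOME u. u \<in> fib A y \<and> \<rho> y u = X) else 0)" for y X
  have "\<theta> y (\<rho> y u) = \<Psi> y u" if u: "u \<in> fib A y" for y u
  proof -
    define u' where "u' = (SOME u'. u' \<in> fib A y \<and> \<rho> y u' = \<rho> y u)"
    have u': "u' \<in> fib A y" "\<rho> y u' = \<rho> y u"
      using someI[of "\<lambda>u'. u' \<in> fib A y \<and> \<rho> y u' = \<rho> y u" u] u by (auto simp: u'_def)
    have m: "(-1) *\<^sub>R u \<in> fib A y" by (rule subspace_scale[OF A.fib_subspace u])
    have "u' + (-1) *\<^sub>R u \<in> L y"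
      using u' anchor_add[OF u'(1) m] anchor_scale[OF u, of "-1"] subspace_add[OF A.fib_subspace u'(1) m]
      by (simp add: L_iff)
    then have "\<Psi> y (u' + (-1) *\<^sub>R u) = 0" by (rule van)
    moreover have "\<Psi> y (u' + (-1) *\<^sub>R u) = \<Psi> y u' + \<Psi> y ((-1) *\<^sub>R u)" "\<Psi> y ((-1) *\<^sub>R u) = (-1) *\<^sub>R \<Psi> y u"
      using bm u u'(1) m unfolding bundle_map_def by blast+
    ultimately have "\<Psi> y u' = \<Psi> y u" by simp
    then show ?thesis using anchor_tangent[OF u] by (simp add: \<theta>_def u'_def)
  qed
  then have pb: "anchor_pullback A \<theta> = \<Psi>"
    using out by (auto simp: fun_eq_iff anchor_pullback_def)
  have "\<theta> \<in> Z\<^sub>0" by (rule cocycle_descends) (use \<Psi> pb in \<open>auto simp: \<theta>_def\<close>)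
  moreover have "\<Omega> - anchor_pullback A \<theta> \<in> B"
    unfolding pb \<Psi>_def coboundaries1_def using \<mu>(1) by simp
  ultimately show ?thesis using that by blast
qed

text \<open>Gives the inclusion of the image in the kernel: a pullback vanishes on \<open>L\<close>,
  so on \<open>L x\<close> the cocycle \<open>\<Omega>\<close> agrees with the coboundary of
  \<open>\<mu>\<close>, and \<open>\<mu> x\<close> is a solution.\<close>

lemma pullback_solves_zero:
  assumes \<theta>: "\<theta> \<in> Z\<^sub>0" and B: "\<Omega> - anchor_pullback A \<theta> \<in> B"
  shows "\<exists>w. solves \<Omega> x w"
proof -
  obtain \<mu> where \<mu>: "\<mu> \<in> sections M F" "\<Omega> - anchor_pullback A \<theta> = coboundary0 A R \<mu>"
    using B unfolding coboundaries1_def by blast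
  have c: "cocycle_map (anchor_pullback A \<theta>)" using pullback_cocycle[OF \<theta>] by (simp add: cocycles_iff)
  have "R x u \<mu> = \<Omega> x u" if u: "u \<in> L x" for u
  proof -
    have "\<rho> x 0 = 0" using subspace_0[OF subspace_L, of x] by (simp add: L_iff)
    then have "anchor_pullback A \<theta> x u = anchor_pullback A \<theta> x 0"
      using u subspace_0[OF A.fib_subspace, of x] by (simp add: anchor_pullback_def L_iff)
    then have "anchor_pullback A \<theta> x u = 0" using cocycle_map_zero_on[OF c] by simp
    then show ?thesis
      using fun_cong[OF fun_cong[OF \<mu>(2)], of x u] u by (simp add: coboundary0_def L_iff fun_diff_def)
  qed
  then show ?thesis using solves_section[OF \<mu>(1), of \<Omega> x] by blast
qed

lemma kernel_localization:
  assumes conn: "connected (UNIV :: 'm set)"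
  shows "space_kernel (cohomology1 M A F R) (adjoint_cohomology1 M A F R x) (localization1 M A F R x) =
      anchor_pullback_cohomology M A F R ` space_carrier (deRham1 M A F R)"
    and "linear_iso_onto (deRham1 M A F R) (cohomology1 M A F R)
      (anchor_pullback_cohomology M A F R ` space_carrier (deRham1 M A F R)) (anchor_pullback_cohomology M A F R)"
proof -
  let ?h = "anchor_pullback A :: ('m \<Rightarrow> (('m \<Rightarrow> real) \<Rightarrow> real) \<Rightarrow> 'f) \<Rightarrow> 'm \<Rightarrow> 'a \<Rightarrow> 'f"
  let ?g = "\<lambda>\<Omega> u. if u \<in> L x then \<Omega> x u else 0"
  note iso = induced_map_iso[OF subspace_Z subspace_B subspace_T0 pullback_linear Z0_iff B0_iff]
  show "linear_iso_onto (deRham1 M A F R) (cohomology1 M A F R)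
      (anchor_pullback_cohomology M A F R ` space_carrier (deRham1 M A F R)) (anchor_pullback_cohomology M A F R)"
    unfolding deRham1_def cohomology1_def anchor_pullback_cohomology_def by (rule iso(1))
  have image: "anchor_pullback_cohomology M A F R ` space_carrier (deRham1 M A F R) = (\<lambda>\<theta>. cls Z B (?h \<theta>)) ` Z\<^sub>0"
    unfolding deRham1_def cohomology1_def anchor_pullback_cohomology_def carrier_quotient_space image_image
    by (rule image_cong) (use iso(2) in auto)
  have gd: "?g a - ?g b = ?g (a - b)" for a b :: "'m \<Rightarrow> 'a \<Rightarrow> 'f" by (auto simp: fun_eq_iff fun_diff_def)
  have "space_kernel (cohomology1 M A F R) (adjoint_cohomology1 M A F R x) (localization1 M A F R x) =
      cls Z B ` {\<Omega> \<in> Z. ?g \<Omega> \<in> adjoint_coboundaries1 M A F R x}"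
    unfolding cohomology1_def adjoint_cohomology1_def localization1_def
  proof (rule space_kernel_induced[OF subspace_B subspace_adjoint_coboundaries])
    show "?g \<Omega> \<in> adjoint_cocycles1 M A F R x" if "\<Omega> \<in> Z" for \<Omega> by (rule adjoint_restriction_cocycle[OF that])
    from this[OF subspace_0[OF subspace_Z]] show "0 \<in> adjoint_cocycles1 M A F R x"
      by (simp add: zero_fun_def cong: if_cong)
    fix a b assume "a - b \<in> B"
    then obtain \<mu> where \<mu>: "\<mu> \<in> sections M F" "a - b = coboundary0 A R \<mu>" unfolding coboundaries1_def by blast
    \<comment> \<open>A coboundary of \<open>\<mu>\<close> restricts to the Lie algebra coboundary
      of \<open>\<mu> x\<close>, so localization is well defined on classes.\<close>
    have "solves (coboundary0 A R \<mu>) x (\<mu> x)"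
      using solves_section[OF \<mu>(1)] by (simp add: coboundary0_def L_iff)
    then show "?g a - ?g b \<in> adjoint_coboundaries1 M A F R x"
      unfolding gd adjoint_coboundary_iff \<mu>(2) by blast
  qed
  also have "\<dots> = cls Z B ` {\<Omega> \<in> Z. \<exists>w. solves \<Omega> x w}"
    by (simp only: adjoint_coboundary_iff)
  also have "\<dots> = (\<lambda>\<theta>. cls Z B (?h \<theta>)) ` Z\<^sub>0"
  proof (intro equalityI subsetI)
    fix c assume "c \<in> cls Z B ` {\<Omega> \<in> Z. \<exists>w. solves \<Omega> x w}"
    then obtain \<Omega> w where \<Omega>: "\<Omega> \<in> Z" "solves \<Omega> x w" "c = cls Z B \<Omega>" by blast
    obtain \<theta> where \<theta>: "\<theta> \<in> Z\<^sub>0" "\<Omega> - ?h \<theta> \<in> B" using cohomologous_to_pullback[OF conn \<Omega>(1,2)] .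
    then have "c = cls Z B (?h \<theta>)"
      unfolding \<Omega>(3) using cls_eq_iff[OF subspace_B \<Omega>(1) pullback_cocycle[OF \<theta>(1)]] by simp
    then show "c \<in> (\<lambda>\<theta>. cls Z B (?h \<theta>)) ` Z\<^sub>0" using \<theta>(1) by blast
  next
    fix c assume "c \<in> (\<lambda>\<theta>. cls Z B (?h \<theta>)) ` Z\<^sub>0"
    then obtain \<theta> where \<theta>: "\<theta> \<in> Z\<^sub>0" "c = cls Z B (?h \<theta>)" by blast
    have "\<exists>w. solves (?h \<theta>) x w"
      by (rule pullback_solves_zero[OF \<theta>(1)]) (simp add: subspace_0[OF subspace_B])
    then show "c \<in> cls Z B ` {\<Omega> \<in> Z. \<exists>w. solves \<Omega> x w}" using \<theta> pullback_cocycle[OF \<theta>(1)] by blast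
  qed
  finally show "space_kernel (cohomology1 M A F R) (adjoint_cohomology1 M A F R x) (localization1 M A F R x) =
      anchor_pullback_cohomology M A F R ` space_carrier (deRham1 M A F R)"
    unfolding image .
qed

end

theorem theorem3p9:
  fixes M :: "('m::{t2_space, second_countable_topology}, 'e::euclidean_space) manifold"
    and A :: "('m, 'a::real_vector) lie_algebroid"
    and F :: "('m, 'f::real_vector) vbundle"
    and R :: "'m \<Rightarrow> 'a \<Rightarrow> ('m \<Rightarrow> 'f) \<Rightarrow> 'f"
    and x :: 'm
  assumes "smooth_manifold M" and "connected (UNIV :: 'm set)"
    and "lie_algebroid M A" and "transitive_algebroid M A"
    and "vector_bundle M F" and "lie_representation M A F R"
  shows "space_kernel (cohomology1 M A F R) (adjoint_cohomology1 M A F R x)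
             (localization1 M A F R x)
           = anchor_pullback_cohomology M A F R ` space_carrier (deRham1 M A F R)
         \<and> linear_iso_onto (deRham1 M A F R) (cohomology1 M A F R)
             (anchor_pullback_cohomology M A F R ` space_carrier (deRham1 M A F R))
             (anchor_pullback_cohomology M A F R)"
proof -
  interpret algebroid_rep M A F R
    by unfold_locales (use assms in auto)
  show ?thesis using kernel_localization[OF assms(2)] by blast
qed

end
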